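(* Let $n\ge 2$ be an integer. For every exponentially branching simplicial tree $T$ there exists a bilipschitz embedding $\psi:\mathbb{H}^n\to T\times\cdots\times T$ of the hyperbolic space $\mathbb{H}^n$ into the $2(n-1)$-fold product of $T$.
   Context: $\mathbb{H}^n$ is $n$-dimensional real hyperbolic space with its standard metric. Trees carry the simplicial metric in which every edge has length $1$, and a product of trees carries the $l_1$-product metric (sum of the distances in the factors). A pointed simplicial tree $(T,t_0)$ (with $t_0$ a vertex) is called exponentially branching if there exists $\sigma>0$ such that every vertex $t\in T$ has more than $e^{\sigma d(t,t_0)}$ neighbours, where $d$ is the metric on $T$; a tree is called exponentially branching if it is so with respect to some base vertex. A map $f$ between metric spaces is a bilipschitz embedding if there is $L\ge 1$ with $L^{-1}d(x,y)\le d(f(x),f(y))\le L\,d(x,y)$ for all $x,y$. *)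

theory Defs
  imports Complex_Main "HOL-Library.FuncSet" "HOL-Library.Indicator_Function"
begin

section \<open>Real hyperbolic space\<close>

text \<open>Hyperboloid model: the upper sheet of the unit hyperboloid in Minkowski space
  \<open>\<real>\<^bsup>n,1\<^esup>\<close>, with \<open>cosh d(x,y) = - \<langle>x,y\<rangle>\<close> (curvature \<open>-1\<close>). Index \<open>0\<close> is the time coordinate;
  points are extensional functions, so \<open>x i = undefined\<close> for \<open>i > n\<close>.\<close>

definition lorentz_form :: "nat \<Rightarrow> (nat \<Rightarrow> real) \<Rightarrow> (nat \<Rightarrow> real) \<Rightarrow> real" where
  "lorentz_form n x y = (\<Sum>i = 1..n. x i * y i) - x 0 * y 0"

definition hyperbolic_space :: "nat \<Rightarrow> (nat \<Rightarrow> real) set" where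
  "hyperbolic_space n = {x \<in> {0..n} \<rightarrow>\<^sub>E UNIV. lorentz_form n x x = -1 \<and> 0 < x 0}"

definition hyperbolic_dist :: "nat \<Rightarrow> (nat \<Rightarrow> real) \<Rightarrow> (nat \<Rightarrow> real) \<Rightarrow> real" where
  "hyperbolic_dist n x y = arcosh (- lorentz_form n x y)"


section \<open>Simplicial trees\<close>

text \<open>A graph is given by a vertex set \<open>V\<close> of arbitrary cardinality and a set \<open>E\<close> of unordered
  edges; it need not be locally finite.\<close>

definition simplicial_graph :: "'v set \<Rightarrow> 'v set set \<Rightarrow> bool" where
  "simplicial_graph V E \<longleftrightarrow> (\<forall>e\<in>E. e \<subseteq> V \<and> card e = 2)"

definition graph_connected :: "'v set \<Rightarrow> 'v set set \<Rightarrow> bool" where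
  "graph_connected V E \<longleftrightarrow> (\<forall>u\<in>V. \<forall>v\<in>V. (u, v) \<in> {(x, y). {x, y} \<in> E}\<^sup>*)"

definition graph_cycle :: "'v set set \<Rightarrow> 'v list \<Rightarrow> bool" where
  "graph_cycle E c \<longleftrightarrow>
     3 \<le> length c \<and> distinct c \<and> successively (\<lambda>x y. {x, y} \<in> E) c \<and> {last c, hd c} \<in> E"

definition simplicial_tree :: "'v set \<Rightarrow> 'v set set \<Rightarrow> bool" where
  "simplicial_tree V E \<longleftrightarrow>
     simplicial_graph V E \<and> V \<noteq> {} \<and> graph_connected V E \<and> (\<nexists>c. graph_cycle E c)"

definition graph_neighbours :: "'v set set \<Rightarrow> 'v \<Rightarrow> 'v set" where
  "graph_neighbours E t = {u. {t, u} \<in> E}"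


subsection \<open>The geometric realization and its length metric\<close>

text \<open>Points of the realization are given by barycentric coordinates.\<close>

definition graph_simplices :: "'v set \<Rightarrow> 'v set set \<Rightarrow> 'v set set" where
  "graph_simplices V E = (\<lambda>v. {v}) ` V \<union> E"

definition closed_cell :: "'v set \<Rightarrow> ('v \<Rightarrow> real) set" where
  "closed_cell S = {p. (\<forall>v. 0 \<le> p v) \<and> {v. p v \<noteq> 0} \<subseteq> S \<and> sum p S = 1}"

definition geometric_realization :: "'v set \<Rightarrow> 'v set set \<Rightarrow> ('v \<Rightarrow> real) set" where
  "geometric_realization V E = (\<Union>S\<in>graph_simplices V E. closed_cell S)"

definition vertex_point :: "'v \<Rightarrow> 'v \<Rightarrow> real" where
  "vertex_point v = indicator {v}"

text \<open>Distance inside one closed edge of length \<open>1\<close>: for \<open>p\<close>, \<open>q\<close> in the cell of \<open>{u, v}\<close> we have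
  \<open>p v = 1 - p u\<close> and \<open>q v = 1 - q u\<close>, so the value below is \<open>\<bar>p u - q u\<bar>\<close>.\<close>

definition cell_dist :: "('v \<Rightarrow> real) \<Rightarrow> ('v \<Rightarrow> real) \<Rightarrow> real" where
  "cell_dist p q = (\<Sum>v | p v \<noteq> 0 \<or> q v \<noteq> 0. \<bar>p v - q v\<bar>) / 2"

text \<open>The simplicial metric is the length metric: the infimum of the lengths of strings of points
  in which consecutive points lie in a common closed cell.\<close>

definition strings_between ::
    "'v set \<Rightarrow> 'v set set \<Rightarrow> ('v \<Rightarrow> real) \<Rightarrow> ('v \<Rightarrow> real) \<Rightarrow> ('v \<Rightarrow> real) list set" where
  "strings_between V E p q =
     {ps. ps \<noteq> [] \<and> hd ps = p \<and> last ps = q \<and>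
          successively (\<lambda>a b. \<exists>S\<in>graph_simplices V E. a \<in> closed_cell S \<and> b \<in> closed_cell S) ps}"

definition string_length :: "('v \<Rightarrow> real) list \<Rightarrow> real" where
  "string_length ps = (\<Sum>i < length ps - 1. cell_dist (ps ! i) (ps ! Suc i))"

definition simplicial_dist ::
    "'v set \<Rightarrow> 'v set set \<Rightarrow> ('v \<Rightarrow> real) \<Rightarrow> ('v \<Rightarrow> real) \<Rightarrow> real" where
  "simplicial_dist V E p q = (INF ps\<in>strings_between V E p q. string_length ps)"


subsection \<open>Exponential branching\<close>

text \<open>A vertex with infinitely many neighbours satisfies every lower bound on its valence, whereas
  \<open>card\<close> is \<open>0\<close> on infinite sets.\<close>

definition exponentially_branching_at :: "'v set \<Rightarrow> 'v set set \<Rightarrow> 'v \<Rightarrow> bool" where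
  "exponentially_branching_at V E t0 \<longleftrightarrow>
     (\<exists>\<sigma>>0. \<forall>t\<in>V. infinite (graph_neighbours E t) \<or>
        exp (\<sigma> * simplicial_dist V E (vertex_point t) (vertex_point t0))
          < real (card (graph_neighbours E t)))"

definition exponentially_branching :: "'v set \<Rightarrow> 'v set set \<Rightarrow> bool" where
  "exponentially_branching V E \<longleftrightarrow> (\<exists>t0\<in>V. exponentially_branching_at V E t0)"


section \<open>Products and bilipschitz embeddings\<close>

definition power_space :: "nat \<Rightarrow> 'a set \<Rightarrow> (nat \<Rightarrow> 'a) set" where
  "power_space k X = {..<k} \<rightarrow>\<^sub>E X"

definition l1_power_dist ::
    "nat \<Rightarrow> ('a \<Rightarrow> 'a \<Rightarrow> real) \<Rightarrow> (nat \<Rightarrow> 'a) \<Rightarrow> (nat \<Rightarrow> 'a) \<Rightarrow> real" where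
  "l1_power_dist k d x y = (\<Sum>i<k. d (x i) (y i))"

definition bilipschitz_embedding ::
    "'a set \<Rightarrow> ('a \<Rightarrow> 'a \<Rightarrow> real) \<Rightarrow> 'b set \<Rightarrow> ('b \<Rightarrow> 'b \<Rightarrow> real) \<Rightarrow> ('a \<Rightarrow> 'b) \<Rightarrow> bool" where
  "bilipschitz_embedding X dX Y dY f \<longleftrightarrow>
     f \<in> X \<rightarrow> Y \<and>
     (\<exists>L\<ge>1. \<forall>x\<in>X. \<forall>y\<in>X. inverse L * dX x y \<le> dY (f x) (f y) \<and> dY (f x) (f y) \<le> L * dX x y)"

end

theory Submission
  imports Defs
begin

text \<open>
  In horospherical coordinates hyperbolic \<open>n\<close>-space embeds into a product of \<open>n - 1\<close> hyperbolic planes that share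
  the height coordinate, so it suffices to embed the plane into \<open>T \<times> T\<close>.

  In polar coordinates (circumference \<open>12\<close>, radius \<open>H\<close> in units of \<open>ln 3\<close>) the circle of radius \<open>n + 1\<close>
  carries the grid of multiples of \<open>3\<^sup>-\<^sup>n\<close>. On it lives a zigzag function \<open>phi\<close> whose minima sit at the even
  and whose maxima at the odd grid points; at a minimum \<open>phi\<close> stays constant when \<open>H\<close> grows, at a maximum it
  grows with unit speed, and in each gap a new maximum and a new minimum are born at one point. The
  interpolated height and its complement to \<open>H\<close>, which is the same function turned by one unit, are locally
  bilipschitz coordinates. Each is the height function of a tree (the tree of components of its
  superlevel sets), and the map of the plane into the product of these two trees is bilipschitz: the
  oscillation of the zigzag between two points of a circle is comparable with their distance.

  These trees have infinite valence, so they are folded into \<open>T\<close>. The edge above height \<open>k\<close> is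
  replaced by a label, taken from a finite set of size exponential in \<open>k\<close>, which exponential branching
  of \<open>T\<close> permits. The labels come from a greedy colouring that separates edges at
  distance linear in \<open>k\<close>. If two paths nevertheless show the same labels up to height \<open>m\<close> after they
  have separated, they are so far apart that the other coordinate differs by a multiple of \<open>m\<close>, which
  pays for the loss.
\<close>

section \<open>Branches and rays in a simplicial tree\<close>

text \<open>The obstacle is that folding may confuse labels in both coordinates at once. A
  coordinate that loses \<open>m\<close> because of a confusion forces a ridge that rises by at
  least \<open>2 * m\<close> above the lower of the two points. With heights \<open>h\<close>,
  \<open>h'\<close> and complements \<open>H - h\<close>, \<open>H - h'\<close> this gives
  \<open>2 * m \<le> H - min h h'\<close> for the first loss and, by symmetry,
  \<open>2 * m' \<le> max h h'\<close> for the second. Together the losses eat at most half of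
  \<open>(H - min h h') + max h h'\<close>, and the other half is seen. A ridge of relative height
  \<open>m\<close> would give nothing, which is why the colouring has to reach so far.

  The subdivision factor is odd so that a vertex keeps its type when its number is tripled, while
  the turn by one unit, a shift by \<open>3 ^ n\<close>, exchanges maxima and minima. The
  circumference 12 leaves room for wrap-around: points at most half a circle apart have codes read
  at vertices less than \<open>10 * 3 ^ n\<close> apart, and the ancestors of these in row
  \<open>m\<close> are less than the full period \<open>12 * 3 ^ m\<close> apart.\<close>

lemma rtrancl_distinct_list:
  assumes "(x, y) \<in> r\<^sup>*"
  shows "\<exists>ps. ps \<noteq> [] \<and> hd ps = x \<and> last ps = y \<and> distinct ps \<and> successively (\<lambda>a b. (a, b) \<in> r) ps"
  using assms
proof (induction rule: rtrancl_induct)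
  case base
  show ?case by (rule exI[of _ "[x]"]) simp
next
  case (step y z)
  then obtain ps where ps: "ps \<noteq> []" "hd ps = x" "last ps = y" "distinct ps"
      "successively (\<lambda>a b. (a, b) \<in> r) ps" by blast
  show ?case
  proof (cases "z \<in> set ps")
    case True
    then obtain as bs where ab: "ps = as @ z # bs" by (meson split_list)
    have "successively (\<lambda>a b. (a, b) \<in> r) (as @ [z])"
      using ps(5) unfolding ab by (auto simp: successively_append_iff)
    moreover have "hd (as @ [z]) = x" using ps(2) unfolding ab by (cases as) auto
    ultimately show ?thesis using ps(4) unfolding ab by (intro exI[of _ "as @ [z]"]) auto
  next
    case False
    have "successively (\<lambda>a b. (a, b) \<in> r) (ps @ [z])"
      using ps step.hyps by (auto simp: successively_append_iff)
    then show ?thesis using ps False by (intro exI[of _ "ps @ [z]"]) auto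
  qed
qed

definition branch :: "'v set set \<Rightarrow> 'v \<Rightarrow> 'v \<Rightarrow> 'v set" where
  "branch E u v = {t. (v, t) \<in> {(x, y). {x, y} \<in> E - {{u, v}}}\<^sup>*}"

locale tree =
  fixes V :: "'v set" and E :: "'v set set"
  assumes simplicial_tree: "simplicial_tree V E"
begin

lemma edge_cases:
  assumes "e \<in> E"
  obtains u v where "e = {u, v}" "u \<noteq> v" "u \<in> V" "v \<in> V"
  using assms simplicial_tree
  unfolding simplicial_tree_def simplicial_graph_def by (metis card_2_iff insert_subset)

lemma edgeD:
  assumes "{u, v} \<in> E" shows "u \<noteq> v" "u \<in> V" "v \<in> V"
proof -
  have "card {u, v} = 2" "{u, v} \<subseteq> V"
    using assms simplicial_tree unfolding simplicial_tree_def simplicial_graph_def by blast+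
  then show "u \<noteq> v" "u \<in> V" "v \<in> V" by auto
qed

text \<open>A walk from \<open>v\<close> back to \<open>u\<close> avoiding their edge would close up
  with it to a cycle. This is the one place where acyclicity enters.\<close>

lemma not_in_branch:
  assumes "{u, v} \<in> E" shows "u \<notin> branch E u v"
proof
  let ?r = "{(x, y). {x, y} \<in> E - {{u, v}}}"
  assume "u \<in> branch E u v"
  then obtain ps where ps: "ps \<noteq> []" "hd ps = v" "last ps = u" "distinct ps"
      "successively (\<lambda>a b. (a, b) \<in> ?r) ps"
    using rtrancl_distinct_list[of v u ?r] unfolding branch_def by blast
  have "u \<noteq> v" using edgeD[OF assms] by simp
  have "3 \<le> length ps"
  proof (rule ccontr)
    assume "\<not> 3 \<le> length ps"
    then consider a where "ps = [a]" | a b where "ps = [a, b]"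
      using ps(1) by (cases ps; cases "tl ps") (auto simp: Suc_le_eq numeral_3_eq_3)
    then show False using ps \<open>u \<noteq> v\<close> by cases (auto simp: insert_commute)
  qed
  moreover have "successively (\<lambda>x y. {x, y} \<in> E) ps"
    by (rule successively_mono[OF ps(5)]) auto
  ultimately have "graph_cycle E ps" unfolding graph_cycle_def using ps assms by simp
  then show False using simplicial_tree unfolding simplicial_tree_def by blast
qed

lemma in_branch: "v \<in> branch E u v"
  unfolding branch_def by simp

lemma branch_step:
  assumes "t \<in> branch E u v" "{t, t'} \<in> E" "{t, t'} \<noteq> {u, v}"
  shows "t' \<in> branch E u v"
  using assms unfolding branch_def by (auto intro: rtrancl_into_rtrancl)

text \<open>A walk in the half-tree beyond \<open>w\<close> never crosses the edge between
  \<open>u\<close> and \<open>v\<close>: it cannot leave from \<open>v\<close>, which is cut off,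
  nor from \<open>u\<close>, which is not in \<open>branch E u v\<close>.\<close>

lemma branch_nest:
  assumes "{u, v} \<in> E" "{v, w} \<in> E" "w \<noteq> u"
  shows "branch E v w \<subseteq> branch E u v"
proof
  fix t assume t: "t \<in> branch E v w"
  let ?r = "{(x, y). {x, y} \<in> E - {{v, w}}}"
  from t have "(w, t) \<in> ?r\<^sup>*" unfolding branch_def by simp
  then show "t \<in> branch E u v"
  proof (induction rule: rtrancl_induct)
    case base
    have "{v, w} \<noteq> {u, v}" using assms edgeD[OF assms(1)] edgeD[OF assms(2)]
      by (auto simp: doubleton_eq_iff)
    then show ?case using branch_step[OF in_branch assms(2), of u] by simp
  next
    case (step y z)
    have y: "y \<in> branch E v w" using step.hyps unfolding branch_def by simp
    show ?case
    proof (cases "{y, z} = {u, v}")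
      case True
      then have "y = u \<or> y = v" by (auto simp: doubleton_eq_iff)
      then show ?thesis using y not_in_branch[OF assms(2)] not_in_branch[OF assms(1)] step.IH by auto
    next
      case False
      then show ?thesis using branch_step[OF step.IH, of z] step.hyps by auto
    qed
  qed
qed

lemma branch_opposite:
  assumes "{u, v} \<in> E" shows "branch E u v \<inter> branch E v u = {}"
proof (rule ccontr)
  let ?r = "{(x, y). {x, y} \<in> E - {{u, v}}}"
  assume "branch E u v \<inter> branch E v u \<noteq> {}"
  then obtain t where t: "(v, t) \<in> ?r\<^sup>*" "(u, t) \<in> ?r\<^sup>*"
    unfolding branch_def by (auto simp: insert_commute)
  have "sym ?r" by (auto simp: sym_def insert_commute)
  then have "sym (?r\<^sup>*)" by (rule sym_rtrancl)
  then have "(t, u) \<in> ?r\<^sup>*" using t(2) by (auto dest: symD)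
  then have "u \<in> branch E u v" using t(1) unfolding branch_def by simp
  then show False using not_in_branch[OF assms] by simp
qed

lemma branch_siblings:
  assumes "{u, w} \<in> E" "{u, w'} \<in> E" "w \<noteq> w'"
  shows "branch E u w \<inter> branch E u w' = {}"
  using branch_nest[of w u w'] branch_opposite[of u w] assms by (auto simp: insert_commute)

text \<open>In a tree, absence of backtracking already makes a path geodesic, so no metric condition
  is imposed.\<close>

definition ray :: "(nat \<Rightarrow> 'v) \<Rightarrow> bool" where
  "ray \<pi> \<longleftrightarrow> (\<forall>i. {\<pi> i, \<pi> (Suc i)} \<in> E) \<and> (\<forall>i. \<pi> (Suc (Suc i)) \<noteq> \<pi> i)"

abbreviation ray_branch :: "(nat \<Rightarrow> 'v) \<Rightarrow> nat \<Rightarrow> 'v set" where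
  "ray_branch \<pi> i \<equiv> branch E (\<pi> i) (\<pi> (Suc i))"

lemma ray_branch_antimono:
  assumes "ray \<pi>" "i \<le> j" shows "ray_branch \<pi> j \<subseteq> ray_branch \<pi> i"
  using assms(2)
proof (induction rule: dec_induct)
  case (step k)
  then show ?case using branch_nest[of "\<pi> k" "\<pi> (Suc k)" "\<pi> (Suc (Suc k))"] assms(1)
    unfolding ray_def by blast
qed simp

lemma ray_in_branch_iff:
  assumes "ray \<pi>" shows "\<pi> j \<in> ray_branch \<pi> i \<longleftrightarrow> i < j"
proof
  assume j: "\<pi> j \<in> ray_branch \<pi> i"
  show "i < j"
  proof (rule ccontr)
    assume "\<not> i < j"
    then have "\<pi> j \<in> ray_branch \<pi> j" using ray_branch_antimono[OF assms, of j i] j by auto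
    then show False using not_in_branch assms unfolding ray_def by blast
  qed
next
  assume "i < j"
  then obtain k where k: "j = Suc k" "i \<le> k" by (cases j) auto
  then show "\<pi> j \<in> ray_branch \<pi> i" using in_branch ray_branch_antimono[OF assms k(2)] by auto
qed

text \<open>A 1-Lipschitz function on the tree that grows along the ray; it bounds the metric from below.\<close>

definition potential :: "(nat \<Rightarrow> 'v) \<Rightarrow> nat \<Rightarrow> nat \<Rightarrow> 'v \<Rightarrow> real" where
  "potential \<pi> m K t = real (card {i. m \<le> i \<and> i < K \<and> t \<in> ray_branch \<pi> i})"

lemma finite_potential_set: "finite {i. m \<le> i \<and> i < (K::nat) \<and> P i}"
  by (rule finite_subset[of _ "{..<K}"]) auto

text \<open>Membership in a half-tree of the ray changes only across the corresponding edge of the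
  ray, and the ray traverses no edge twice. The bound \<open>K\<close> keeps the counted set
  finite.\<close>

lemma potential_edge:
  assumes "ray \<pi>" "{t, t'} \<in> E"
  shows "\<bar>potential \<pi> m K t - potential \<pi> m K t'\<bar> \<le> 1"
proof -
  have le: "potential \<pi> m K a \<le> potential \<pi> m K b + 1" if e: "{a, b} \<in> E" for a b
  proof -
    let ?A = "{i. m \<le> i \<and> i < K \<and> a \<in> ray_branch \<pi> i}"
    let ?B = "{i. m \<le> i \<and> i < K \<and> b \<in> ray_branch \<pi> i}"
    let ?C = "{i. {a, b} = {\<pi> i, \<pi> (Suc i)}}"
    have C: "i = l" if "i \<in> ?C" "l \<in> ?C" "i \<le> l" for i l
    proof (rule ccontr)
      assume "i \<noteq> l"
      then have "i < l" using that by simp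
      have "{\<pi> i, \<pi> (Suc i)} = {\<pi> l, \<pi> (Suc l)}" using that by auto
      then have "\<pi> i = \<pi> l \<or> \<pi> i = \<pi> (Suc l)" by (auto simp: doubleton_eq_iff)
      moreover have "\<pi> l \<in> ray_branch \<pi> i" "\<pi> (Suc l) \<in> ray_branch \<pi> i" "\<pi> i \<notin> ray_branch \<pi> i"
        using ray_in_branch_iff[OF assms(1)] \<open>i < l\<close> by auto
      ultimately show False by auto
    qed
    then have "\<exists>c. ?C \<subseteq> {c}" by (metis (no_types, lifting) insertI1 linear subsetI)
    then obtain c where "?C \<subseteq> {c}" by blast
    moreover have "?A \<subseteq> ?B \<union> ?C" using branch_step[OF _ e] by auto
    ultimately have "?A \<subseteq> insert c ?B" by auto
    then have "card ?A \<le> card (insert c ?B)" by (rule card_mono[rotated]) (simp add: finite_potential_set)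
    also have "\<dots> \<le> card ?B + 1" by (simp add: card_insert_le_m1 finite_potential_set card_insert_if)
    finally show ?thesis unfolding potential_def by simp
  qed
  show ?thesis using le[OF assms(2)] le[of t' t] assms(2) by (auto simp: insert_commute)
qed

lemma potential_ray:
  assumes "ray \<pi>" "j \<le> K" shows "potential \<pi> m K (\<pi> j) = real (j - m)"
proof -
  have "{i. m \<le> i \<and> i < K \<and> \<pi> j \<in> ray_branch \<pi> i} = {m..<j}"
    using assms by (auto simp: ray_in_branch_iff)
  then show ?thesis unfolding potential_def by simp
qed

lemma potential_other_ray_le:
  assumes "ray \<pi>" "ray \<pi>'" "\<pi> 0 = \<pi>' 0"
  shows "potential \<pi> 0 K (\<pi>' j) \<le> real j"
proof (induction j)
  case 0
  show ?case using potential_ray[OF assms(1), of 0 K 0] assms(3) by simp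
next
  case (Suc j)
  have "{\<pi>' j, \<pi>' (Suc j)} \<in> E" using assms(2) unfolding ray_def by blast
  then show ?case using potential_edge[OF assms(1), of "\<pi>' j" "\<pi>' (Suc j)" 0 K] Suc by simp
qed

text \<open>Beyond the fork the two rays run in disjoint half-trees, so the second ray never enters
  a half-tree that is counted.\<close>

lemma potential_other_ray_0:
  assumes "ray \<pi>" "ray \<pi>'" "\<And>i. i \<le> m \<Longrightarrow> \<pi> i = \<pi>' i" "\<pi> (Suc m) \<noteq> \<pi>' (Suc m)"
  shows "potential \<pi> m K (\<pi>' j) = 0"
proof -
  have "\<pi>' j \<notin> ray_branch \<pi> i" if "m \<le> i" for i
  proof (cases "j \<le> m")
    case True
    then show ?thesis using ray_in_branch_iff[OF assms(1), of j i] assms(3)[of j] that by simp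
  next
    case False
    then have 1: "\<pi>' j \<in> ray_branch \<pi>' m" using ray_in_branch_iff[OF assms(2)] by simp
    have "ray_branch \<pi> m \<inter> ray_branch \<pi>' m = {}"
      using branch_siblings[of "\<pi> m" "\<pi> (Suc m)" "\<pi>' (Suc m)"] assms unfolding ray_def by fastforce
    then show ?thesis using 1 ray_branch_antimono[OF assms(1) that] by blast
  qed
  then have "{i. m \<le> i \<and> i < K \<and> \<pi>' j \<in> ray_branch \<pi> i} = {}" by blast
  then show ?thesis unfolding potential_def by (metis card.empty of_nat_0)
qed

end

section \<open>The simplicial metric\<close>

lemma string_length_Cons [simp]:
  "string_length (a # b # ps) = cell_dist a b + string_length (b # ps)"
proof -
  have "{..<Suc (length ps)} = insert 0 (Suc ` {..<length ps})" by (rule lessThan_Suc_eq_insert_0)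
  then show ?thesis unfolding string_length_def by (simp add: sum.reindex)
qed

lemma string_length_single [simp]: "string_length [a] = 0" "string_length [] = 0"
  unfolding string_length_def by auto

lemma cell_dist_nonneg: "0 \<le> cell_dist p q"
  unfolding cell_dist_def by (simp add: sum_nonneg)

lemma cell_dist_commute: "cell_dist p q = cell_dist q p"
  unfolding cell_dist_def by (simp add: abs_minus_commute disj_commute)

lemma string_length_nonneg: "0 \<le> string_length ps"
  unfolding string_length_def by (simp add: sum_nonneg cell_dist_nonneg)

lemma string_length_append:
  "ps \<noteq> [] \<Longrightarrow> qs \<noteq> [] \<Longrightarrow> last ps = hd qs \<Longrightarrow>
    string_length (ps @ tl qs) = string_length ps + string_length qs"
proof (induction ps rule: induct_list012)
  case (2 x)
  then show ?case by (cases qs) auto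
next
  case (3 x y zs)
  then show ?case by simp
qed simp

lemma string_length_rev: "string_length (rev ps) = string_length ps"
proof (induction ps rule: induct_list012)
  case (3 x y zs)
  have "string_length ((rev zs @ [y]) @ tl [y, x]) = string_length (rev zs @ [y]) + string_length [y, x]"
    by (rule string_length_append) auto
  then show ?case using 3 by (simp add: cell_dist_commute)
qed auto

text \<open>Affine extension of a vertex function to the realization. Functions that vary by at most
  1 along edges extend to 1-Lipschitz functions, the source of the lower bounds on the
  metric.\<close>

definition lin_ext :: "('v \<Rightarrow> real) \<Rightarrow> ('v \<Rightarrow> real) \<Rightarrow> real" where
  "lin_ext G p = (\<Sum>v | p v \<noteq> 0. p v * G v)"

lemma lin_ext_eq:
  assumes "{v. p v \<noteq> 0} \<subseteq> S" "finite S"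
  shows "lin_ext G p = (\<Sum>v\<in>S. p v * G v)"
  unfolding lin_ext_def by (rule sum.mono_neutral_left) (use assms in auto)

lemma cell_dist_eq:
  assumes "{v. p v \<noteq> 0} \<subseteq> S" "{v. q v \<noteq> 0} \<subseteq> S" "finite S"
  shows "cell_dist p q = (\<Sum>v\<in>S. \<bar>p v - q v\<bar>) / 2"
  unfolding cell_dist_def
  by (rule arg_cong[of _ _ "\<lambda>x. x / 2"], rule sum.mono_neutral_left) (use assms in auto)

lemma closed_cell_single: "p \<in> closed_cell {v} \<Longrightarrow> p = vertex_point v"
  unfolding closed_cell_def vertex_point_def by (auto simp: indicator_def fun_eq_iff)

context tree begin

abbreviation sd :: "('v \<Rightarrow> real) \<Rightarrow> ('v \<Rightarrow> real) \<Rightarrow> real" where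
  "sd \<equiv> simplicial_dist V E"

abbreviation realization :: "('v \<Rightarrow> real) set" where
  "realization \<equiv> geometric_realization V E"

lemma lin_ext_cell:
  assumes G: "\<And>u v. {u, v} \<in> E \<Longrightarrow> \<bar>G u - G v\<bar> \<le> 1"
    and S: "S \<in> graph_simplices V E" and p: "p \<in> closed_cell S" and q: "q \<in> closed_cell S"
  shows "\<bar>lin_ext G p - lin_ext G q\<bar> \<le> cell_dist p q"
proof -
  from S consider v where "S = {v}" | "S \<in> E" unfolding graph_simplices_def by auto
  then show ?thesis
  proof cases
    case 1
    then have "p = q" using p q closed_cell_single by metis
    then show ?thesis by (simp add: cell_dist_nonneg)
  next
    case 2
    then obtain u v where uv: "S = {u, v}" "u \<noteq> v" by (rule edge_cases)
    have p': "{w. p w \<noteq> 0} \<subseteq> {u, v}" "p u + p v = 1" using p uv unfolding closed_cell_def by auto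
    have q': "{w. q w \<noteq> 0} \<subseteq> {u, v}" "q u + q v = 1" using q uv unfolding closed_cell_def by auto
    have "lin_ext G p = p u * G u + p v * G v" using lin_ext_eq[OF p'(1)] uv by simp
    moreover have "lin_ext G q = q u * G u + q v * G v" using lin_ext_eq[OF q'(1)] uv by simp
    moreover have pv: "p v = 1 - p u" "q v = 1 - q u" using p' q' by auto
    ultimately have "lin_ext G p - lin_ext G q = (p u - q u) * (G u - G v)"
      by (simp add: algebra_simps)
    then have "\<bar>lin_ext G p - lin_ext G q\<bar> \<le> \<bar>p u - q u\<bar> * 1"
      using G[of u v] 2 uv by (simp add: abs_mult mult_left_le)
    moreover have "cell_dist p q = \<bar>p u - q u\<bar>"
      using cell_dist_eq[OF p'(1) q'(1)] uv pv by simp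
    ultimately show ?thesis by simp
  qed
qed

lemma lin_ext_string:
  assumes G: "\<And>u v. {u, v} \<in> E \<Longrightarrow> \<bar>G u - G v\<bar> \<le> 1"
  shows "ps \<noteq> [] \<Longrightarrow>
    successively (\<lambda>a b. \<exists>S\<in>graph_simplices V E. a \<in> closed_cell S \<and> b \<in> closed_cell S) ps \<Longrightarrow>
    \<bar>lin_ext G (hd ps) - lin_ext G (last ps)\<bar> \<le> string_length ps"
proof (induction ps rule: induct_list012)
  case (3 x y zs)
  then have "\<bar>lin_ext G x - lin_ext G y\<bar> \<le> cell_dist x y" using lin_ext_cell[OF G] by auto
  then show ?case using 3 by auto
qed auto

lemma strings_append:
  assumes "ps \<in> strings_between V E p q" "qs \<in> strings_between V E q r"
  shows "ps @ tl qs \<in> strings_between V E p r"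
    "string_length (ps @ tl qs) = string_length ps + string_length qs"
proof -
  show "string_length (ps @ tl qs) = string_length ps + string_length qs"
    using assms by (intro string_length_append) (auto simp: strings_between_def)
  show "ps @ tl qs \<in> strings_between V E p r"
    using assms unfolding strings_between_def
    by (cases qs) (auto simp: successively_append_iff successively_Cons)
qed

lemma strings_rev:
  assumes "ps \<in> strings_between V E p q" shows "rev ps \<in> strings_between V E q p"
proof -
  have "successively (\<lambda>a b. \<exists>S\<in>graph_simplices V E. b \<in> closed_cell S \<and> a \<in> closed_cell S) ps"
    by (rule successively_mono[of "\<lambda>a b. \<exists>S\<in>graph_simplices V E. a \<in> closed_cell S \<and> b \<in> closed_cell S"])
      (use assms in \<open>auto simp: strings_between_def\<close>)
  then show ?thesis using assms unfolding strings_between_def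
    by (auto simp: successively_rev hd_rev last_rev)
qed

lemma strings_cell:
  assumes "S \<in> graph_simplices V E" "p \<in> closed_cell S" "q \<in> closed_cell S"
  shows "[p, q] \<in> strings_between V E p q"
  using assms unfolding strings_between_def by auto

lemma vertex_point_cell: "v \<in> S \<Longrightarrow> finite S \<Longrightarrow> vertex_point v \<in> closed_cell S"
  unfolding closed_cell_def vertex_point_def by (auto simp: indicator_def)

text \<open>Connectedness of the graph enters here; it makes the infimum in the metric one over a
  nonempty set.\<close>

lemma strings_nonempty:
  assumes "p \<in> realization" "q \<in> realization" shows "strings_between V E p q \<noteq> {}"
proof -
  have to_vertex: "\<exists>v\<in>V. strings_between V E p (vertex_point v) \<noteq> {}" if p: "p \<in> realization" for p
  proof -
    obtain S where S: "S \<in> graph_simplices V E" "p \<in> closed_cell S"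
      using p unfolding geometric_realization_def by auto
    have "\<exists>v\<in>V. v \<in> S \<and> finite S"
    proof (cases "S \<in> E")
      case True
      then show ?thesis by (rule edge_cases) auto
    next
      case False
      then show ?thesis using S(1) unfolding graph_simplices_def by auto
    qed
    then show ?thesis using strings_cell[OF S vertex_point_cell] by blast
  qed
  have verts: "strings_between V E (vertex_point u) (vertex_point v) \<noteq> {}" if "u \<in> V" "v \<in> V" for u v
  proof -
    have "(u, v) \<in> {(x, y). {x, y} \<in> E}\<^sup>*"
      using that simplicial_tree unfolding simplicial_tree_def graph_connected_def by blast
    then show ?thesis
    proof (induction rule: rtrancl_induct)
      case base
      show ?case unfolding strings_between_def by (auto intro!: exI[of _ "[vertex_point u]"])
    next
      case (step y z)
      then have "{y, z} \<in> graph_simplices V E" unfolding graph_simplices_def by simp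
      then have "[vertex_point y, vertex_point z] \<in> strings_between V E (vertex_point y) (vertex_point z)"
        by (intro strings_cell vertex_point_cell) auto
      then show ?case using step.IH strings_append(1) by blast
    qed
  qed
  obtain u where u: "u \<in> V" "strings_between V E p (vertex_point u) \<noteq> {}"
    using to_vertex assms by blast
  obtain v where v: "v \<in> V" "strings_between V E q (vertex_point v) \<noteq> {}"
    using to_vertex assms by blast
  obtain ps qs rs where "ps \<in> strings_between V E p (vertex_point u)"
    "qs \<in> strings_between V E q (vertex_point v)"
    "rs \<in> strings_between V E (vertex_point u) (vertex_point v)"
    using u v verts by blast
  then show ?thesis using strings_append(1) strings_rev by blast
qed

lemma sd_le_string:
  assumes "ps \<in> strings_between V E p q" shows "sd p q \<le> string_length ps"
  unfolding simplicial_dist_def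
  by (rule cINF_lower[OF bdd_belowI2[of _ 0] assms]) (rule string_length_nonneg)

lemma le_sd:
  assumes "p \<in> realization" "q \<in> realization"
    and "\<And>ps. ps \<in> strings_between V E p q \<Longrightarrow> c \<le> string_length ps"
  shows "c \<le> sd p q"
  unfolding simplicial_dist_def
  by (rule cINF_greatest[OF strings_nonempty[OF assms(1,2)]]) (rule assms(3))

lemma sd_nonneg: "p \<in> realization \<Longrightarrow> q \<in> realization \<Longrightarrow> 0 \<le> sd p q"
  by (rule le_sd) (auto simp: string_length_nonneg)

lemma sd_commute:
  assumes "p \<in> realization" "q \<in> realization" shows "sd p q = sd q p"
proof -
  have "sd p q \<le> sd q p" if "p \<in> realization" "q \<in> realization" for p q
    using that by (intro le_sd) (auto simp: string_length_rev dest!: sd_le_string[OF strings_rev])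
  then show ?thesis using assms by (meson antisym)
qed

lemma sd_triangle:
  assumes "p \<in> realization" "q \<in> realization" "r \<in> realization"
  shows "sd p r \<le> sd p q + sd q r"
proof -
  have "sd p r - string_length ps \<le> sd q r" if ps: "ps \<in> strings_between V E p q" for ps
  proof (rule le_sd[OF assms(2,3)])
    fix qs assume "qs \<in> strings_between V E q r"
    then show "sd p r - string_length ps \<le> string_length qs"
      using strings_append[OF ps] sd_le_string[of "ps @ tl qs" p r] by simp
  qed
  then have "sd p r - sd q r \<le> sd p q" by (intro le_sd[OF assms(1,2)]) (auto simp: algebra_simps)
  then show ?thesis by simp
qed

lemma sd_cell_le:
  assumes "S \<in> graph_simplices V E" "p \<in> closed_cell S" "q \<in> closed_cell S"
  shows "sd p q \<le> cell_dist p q"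
  using sd_le_string[OF strings_cell[OF assms]] by simp

lemma sd_ge_lin_ext:
  assumes "\<And>u v. {u, v} \<in> E \<Longrightarrow> \<bar>G u - G v\<bar> \<le> 1" "p \<in> realization" "q \<in> realization"
  shows "\<bar>lin_ext G p - lin_ext G q\<bar> \<le> sd p q"
proof (rule le_sd[OF assms(2,3)])
  fix ps assume "ps \<in> strings_between V E p q"
  then show "\<bar>lin_ext G p - lin_ext G q\<bar> \<le> string_length ps"
    using lin_ext_string[of G ps] assms(1) unfolding strings_between_def by auto
qed

end

text \<open>Used twice: for a ray of the tree, where the unit intervals are edges, and for a radial
  line of the plane, where they are rows.\<close>

lemma lipschitz_chain:
  fixes D :: "real \<Rightarrow> real \<Rightarrow> real"
  assumes tri: "\<And>r s t. 0 \<le> r \<Longrightarrow> 0 \<le> s \<Longrightarrow> 0 \<le> t \<Longrightarrow> D r t \<le> D r s + D s t"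
    and local: "\<And>(n::nat) s t. real n \<le> s \<Longrightarrow> s \<le> t \<Longrightarrow> t \<le> real n + 1 \<Longrightarrow> D s t \<le> K * (t - s)"
    and st: "0 \<le> s" "s \<le> t"
  shows "D s t \<le> K * (t - s)"
proof -
  have "D s t \<le> K * (t - s)" if "real n \<le> s" "s \<le> t" "t \<le> real (n + m) + 1" for n m t
    using that
  proof (induction m arbitrary: t)
    case 0
    then show ?case using local[of n s t] by simp
  next
    case (Suc m)
    show ?case
    proof (cases "t \<le> real (n + m) + 1")
      case True
      then show ?thesis using Suc by simp
    next
      case False
      let ?z = "max s (real (n + m) + 1)"
      show ?thesis
      proof (cases "s \<le> real (n + m) + 1")
        case True
        then have z: "?z = real (n + m) + 1" by simp
        have "D s ?z \<le> K * (?z - s)" using Suc.IH[of ?z] z Suc.prems by simp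
        moreover have "D ?z t \<le> K * (t - ?z)" using local[of "n + m + 1" ?z t] z False Suc.prems by simp
        moreover have "D s t \<le> D s ?z + D ?z t" using tri[of s ?z t] Suc.prems st by simp
        ultimately show ?thesis by (simp add: algebra_simps)
      next
        case False
        then show ?thesis using local[of "n + m + 1" s t] Suc.prems by simp
      qed
    qed
  qed
  from this[of "nat \<lfloor>s\<rfloor>" t "nat \<lceil>t\<rceil>"] show ?thesis using st by linarith
qed

section \<open>Encoding label sequences in an exponentially branching tree\<close>

text \<open>All that the later sections know of the target. \<open>pt \<omega> h\<close> is the
  point at height \<open>h\<close> on the path that follows \<open>\<omega> k\<close> between
  heights \<open>k\<close> and \<open>k + 1\<close>. Bounded labels are demanded only for
  separation, since excessive labels may be sent to the same child.\<close>

locale code_space =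
  fixes X :: "'p set" and d :: "'p \<Rightarrow> 'p \<Rightarrow> real" and \<Lambda> :: real
    and pt :: "(nat \<Rightarrow> nat) \<Rightarrow> real \<Rightarrow> 'p" and cap :: "nat \<Rightarrow> nat"
  assumes d_nonneg: "p \<in> X \<Longrightarrow> q \<in> X \<Longrightarrow> 0 \<le> d p q"
    and d_commute: "p \<in> X \<Longrightarrow> q \<in> X \<Longrightarrow> d p q = d q p"
    and d_triangle: "p \<in> X \<Longrightarrow> q \<in> X \<Longrightarrow> r \<in> X \<Longrightarrow> d p r \<le> d p q + d q r"
    and \<Lambda>: "0 < \<Lambda>"
    and pt_in: "0 \<le> h \<Longrightarrow> pt \<omega> h \<in> X"
    and pt_upper: "0 \<le> c \<Longrightarrow> c \<le> h \<Longrightarrow> c \<le> h' \<Longrightarrow> (\<And>k. real k < c \<Longrightarrow> \<omega> k = \<omega>' k) \<Longrightarrow>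
        d (pt \<omega> h) (pt \<omega>' h') \<le> \<Lambda> * ((h - c) + (h' - c))"
    and pt_height: "0 \<le> h \<Longrightarrow> 0 \<le> h' \<Longrightarrow> \<Lambda> * (h - h') \<le> d (pt \<omega> h) (pt \<omega>' h')"
    and pt_branch: "0 \<le> h \<Longrightarrow> 0 \<le> h' \<Longrightarrow> (\<And>i. \<omega> i < cap i) \<Longrightarrow> (\<And>i. \<omega>' i < cap i) \<Longrightarrow>
        \<omega> k \<noteq> \<omega>' k \<Longrightarrow> \<Lambda> * (h - real k) \<le> d (pt \<omega> h) (pt \<omega>' h')"

definition ray_point :: "(nat \<Rightarrow> 'v) \<Rightarrow> real \<Rightarrow> 'v \<Rightarrow> real" where
  "ray_point \<pi> s v = (1 - frac s) * of_bool (v = \<pi> (nat \<lfloor>s\<rfloor>)) + frac s * of_bool (v = \<pi> (Suc (nat \<lfloor>s\<rfloor>)))"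

lemma ray_point_eq:
  assumes "real i \<le> s" "s \<le> real i + 1"
  shows "ray_point \<pi> s = (\<lambda>v. (1 - (s - real i)) * of_bool (v = \<pi> i) + (s - real i) * of_bool (v = \<pi> (Suc i)))"
proof (cases "s = real i + 1")
  case True
  then have "nat \<lfloor>s\<rfloor> = Suc i" "frac s = 0" by (auto simp: frac_def nat_add_distrib)
  then show ?thesis using True by (auto simp: ray_point_def fun_eq_iff)
next
  case False
  then have "\<lfloor>s\<rfloor> = int i" using assms by (auto simp: floor_eq_iff)
  then show ?thesis by (auto simp: ray_point_def fun_eq_iff frac_def)
qed

lemma ray_point_cong:
  assumes "\<And>i. real i < s + 1 \<Longrightarrow> \<pi> i = \<pi>' i" "0 \<le> s"
  shows "ray_point \<pi> s = ray_point \<pi>' s"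
proof -
  have *: "\<pi> (nat \<lfloor>s\<rfloor>) = \<pi>' (nat \<lfloor>s\<rfloor>)" using assms by (intro assms(1)) linarith
  show ?thesis
  proof (cases "frac s = 0")
    case True
    then show ?thesis using * unfolding ray_point_def by auto
  next
    case False
    then have "real (Suc (nat \<lfloor>s\<rfloor>)) < s + 1" using assms(2) unfolding frac_def by linarith
    then show ?thesis using * assms(1) unfolding ray_point_def by auto
  qed
qed

lemma ray_point_nat: "ray_point \<pi> (real i) = vertex_point (\<pi> i)"
proof -
  have "ray_point \<pi> (real i) = (\<lambda>v. of_bool (v = \<pi> i))" by (simp add: ray_point_eq[of i])
  then show ?thesis by (simp add: vertex_point_def indicator_def fun_eq_iff)
qed

context tree begin

lemma ray_point_cell:
  assumes "ray \<pi>" "real i \<le> s" "s \<le> real i + 1"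
  shows "ray_point \<pi> s \<in> closed_cell {\<pi> i, \<pi> (Suc i)}" "{\<pi> i, \<pi> (Suc i)} \<in> graph_simplices V E"
    "\<pi> i \<noteq> \<pi> (Suc i)"
proof -
  have e: "{\<pi> i, \<pi> (Suc i)} \<in> E" using assms(1) unfolding ray_def by blast
  then show *: "\<pi> i \<noteq> \<pi> (Suc i)" using edgeD by blast
  show "{\<pi> i, \<pi> (Suc i)} \<in> graph_simplices V E" using e unfolding graph_simplices_def by simp
  show "ray_point \<pi> s \<in> closed_cell {\<pi> i, \<pi> (Suc i)}"
    using * assms unfolding ray_point_eq[OF assms(2,3)] closed_cell_def by auto
qed

lemma ray_point_in: "ray \<pi> \<Longrightarrow> 0 \<le> s \<Longrightarrow> ray_point \<pi> s \<in> realization"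
proof -
  assume "ray \<pi>" "0 \<le> s"
  then have "real (nat \<lfloor>s\<rfloor>) \<le> s" "s \<le> real (nat \<lfloor>s\<rfloor>) + 1" by linarith+
  from ray_point_cell[OF \<open>ray \<pi>\<close> this] show ?thesis unfolding geometric_realization_def by blast
qed

lemma ray_point_lin_ext:
  assumes "ray \<pi>" "real i \<le> s" "s \<le> real i + 1"
  shows "lin_ext G (ray_point \<pi> s) = (1 - (s - real i)) * G (\<pi> i) + (s - real i) * G (\<pi> (Suc i))"
proof -
  note c = ray_point_cell[OF assms]
  have "lin_ext G (ray_point \<pi> s) = (\<Sum>v\<in>{\<pi> i, \<pi> (Suc i)}. ray_point \<pi> s v * G v)"
    by (rule lin_ext_eq) (use c in \<open>auto simp: closed_cell_def\<close>)
  then show ?thesis using c(3) by (simp add: ray_point_eq[OF assms(2,3)])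
qed

lemma sd_ray_le:
  assumes "ray \<pi>" "0 \<le> s" "s \<le> t"
  shows "sd (ray_point \<pi> s) (ray_point \<pi> t) \<le> t - s"
proof -
  have "sd (ray_point \<pi> s) (ray_point \<pi> t) \<le> 1 * (t - s)"
  proof (rule lipschitz_chain[of "\<lambda>s t. sd (ray_point \<pi> s) (ray_point \<pi> t)", OF _ _ assms(2,3)])
    fix n :: nat and s t :: real
    assume st: "real n \<le> s" "s \<le> t" "t \<le> real n + 1"
    have s: "real n \<le> s" "s \<le> real n + 1" and t: "real n \<le> t" "t \<le> real n + 1" using st by auto
    note cs = ray_point_cell[OF assms(1) s] and ct = ray_point_cell[OF assms(1) t]
    have "cell_dist (ray_point \<pi> s) (ray_point \<pi> t) =
        (\<Sum>v\<in>{\<pi> n, \<pi> (Suc n)}. \<bar>ray_point \<pi> s v - ray_point \<pi> t v\<bar>) / 2"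
      by (rule cell_dist_eq) (use cs ct in \<open>auto simp: closed_cell_def\<close>)
    also have "\<dots> = t - s"
      using cs(3) st by (simp add: ray_point_eq[OF s] ray_point_eq[OF t])
    finally show "sd (ray_point \<pi> s) (ray_point \<pi> t) \<le> 1 * (t - s)"
      using sd_cell_le[OF cs(2,1) ct(1)] by simp
  next
    fix r s t :: real assume "0 \<le> r" "0 \<le> s" "0 \<le> t"
    then show "sd (ray_point \<pi> r) (ray_point \<pi> t) \<le>
        sd (ray_point \<pi> r) (ray_point \<pi> s) + sd (ray_point \<pi> s) (ray_point \<pi> t)"
      by (intro sd_triangle ray_point_in assms(1))
  qed
  then show ?thesis by simp
qed

lemma sd_two_rays_le:
  assumes "ray \<pi>" "ray \<pi>'" "0 \<le> c" "c \<le> s" "c \<le> t" "\<And>i. real i < c + 1 \<Longrightarrow> \<pi> i = \<pi>' i"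
  shows "sd (ray_point \<pi> s) (ray_point \<pi>' t) \<le> (s - c) + (t - c)"
proof -
  have "ray_point \<pi> c = ray_point \<pi>' c" using ray_point_cong[of c \<pi> \<pi>'] assms by blast
  moreover have "sd (ray_point \<pi> c) (ray_point \<pi> s) \<le> s - c"
    by (intro sd_ray_le assms)
  moreover have "sd (ray_point \<pi>' c) (ray_point \<pi>' t) \<le> t - c"
    by (intro sd_ray_le assms)
  moreover have in_r: "ray_point \<pi> c \<in> realization" "ray_point \<pi> s \<in> realization"
      "ray_point \<pi>' t \<in> realization"
    using assms by (auto intro!: ray_point_in)
  ultimately show ?thesis
    using sd_triangle[of "ray_point \<pi> s" "ray_point \<pi> c" "ray_point \<pi>' t"]
      sd_commute[of "ray_point \<pi> s" "ray_point \<pi> c"] by simp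
qed

lemma sd_two_rays_ge:
  assumes "ray \<pi>" "ray \<pi>'" "0 \<le> s" "0 \<le> t" "\<pi> 0 = \<pi>' 0"
  shows "s - t \<le> sd (ray_point \<pi> s) (ray_point \<pi>' t)"
proof -
  \<comment> \<open>The edge containing the point at \<open>s\<close> ends at index
    \<open>Suc (nat \<lfloor>s\<rfloor>)\<close>, so both of its ends are counted in full.\<close>
  define K where "K = Suc (nat \<lfloor>s\<rfloor>)"
  define G where "G = potential \<pi> 0 K"
  have s: "real (nat \<lfloor>s\<rfloor>) \<le> s" "s \<le> real (nat \<lfloor>s\<rfloor>) + 1" using assms by linarith+
  have t: "real (nat \<lfloor>t\<rfloor>) \<le> t" "t \<le> real (nat \<lfloor>t\<rfloor>) + 1" using assms by linarith+
  have "lin_ext G (ray_point \<pi> s) = (1 - (s - real (nat \<lfloor>s\<rfloor>))) * real (nat \<lfloor>s\<rfloor>) + (s - real (nat \<lfloor>s\<rfloor>)) * real (Suc (nat \<lfloor>s\<rfloor>))"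
    unfolding ray_point_lin_ext[OF assms(1) s] G_def K_def
    by (simp only: potential_ray[OF assms(1)] order_refl le_SucI diff_zero)
  also have "\<dots> = s" by (simp add: algebra_simps)
  finally have 1: "lin_ext G (ray_point \<pi> s) = s" .
  have "lin_ext G (ray_point \<pi>' t) \<le> (1 - (t - real (nat \<lfloor>t\<rfloor>))) * real (nat \<lfloor>t\<rfloor>) + (t - real (nat \<lfloor>t\<rfloor>)) * real (Suc (nat \<lfloor>t\<rfloor>))"
    unfolding ray_point_lin_ext[OF assms(2) t] G_def
    using mult_left_mono[OF potential_other_ray_le[OF assms(1,2,5)], of "1 - (t - real (nat \<lfloor>t\<rfloor>))" K "nat \<lfloor>t\<rfloor>"]
      mult_left_mono[OF potential_other_ray_le[OF assms(1,2,5)], of "t - real (nat \<lfloor>t\<rfloor>)" K "Suc (nat \<lfloor>t\<rfloor>)"] t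
    by linarith
  also have "\<dots> = t" by (simp add: algebra_simps)
  finally have 2: "lin_ext G (ray_point \<pi>' t) \<le> t" .
  have "\<bar>lin_ext G (ray_point \<pi> s) - lin_ext G (ray_point \<pi>' t)\<bar> \<le> sd (ray_point \<pi> s) (ray_point \<pi>' t)"
    by (rule sd_ge_lin_ext) (auto simp: G_def intro!: potential_edge ray_point_in assms)
  then show ?thesis using 1 2 by simp
qed

lemma sd_diverging_rays_ge:
  assumes "ray \<pi>" "ray \<pi>'" "0 \<le> s" "0 \<le> t"
    and "\<And>i. i \<le> m \<Longrightarrow> \<pi> i = \<pi>' i" "\<pi> (Suc m) \<noteq> \<pi>' (Suc m)"
  shows "s - real m \<le> sd (ray_point \<pi> s) (ray_point \<pi>' t)"
proof -
  define K where "K = Suc (nat \<lfloor>s\<rfloor>)"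
  define G where "G = potential \<pi> m K"
  have s: "real (nat \<lfloor>s\<rfloor>) \<le> s" "s \<le> real (nat \<lfloor>s\<rfloor>) + 1" using assms by linarith+
  have t: "real (nat \<lfloor>t\<rfloor>) \<le> t" "t \<le> real (nat \<lfloor>t\<rfloor>) + 1" using assms by linarith+
  have "s - real m = (1 - (s - real (nat \<lfloor>s\<rfloor>))) * (real (nat \<lfloor>s\<rfloor>) - real m) +
      (s - real (nat \<lfloor>s\<rfloor>)) * (real (Suc (nat \<lfloor>s\<rfloor>)) - real m)" by (simp add: algebra_simps)
  also have "\<dots> \<le> (1 - (s - real (nat \<lfloor>s\<rfloor>))) * real (nat \<lfloor>s\<rfloor> - m) + (s - real (nat \<lfloor>s\<rfloor>)) * real (Suc (nat \<lfloor>s\<rfloor>) - m)"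
    using s by (intro add_mono mult_left_mono) linarith+
  also have "\<dots> = lin_ext G (ray_point \<pi> s)"
    unfolding ray_point_lin_ext[OF assms(1) s] G_def K_def
    by (simp only: potential_ray[OF assms(1)] order_refl le_SucI)
  finally have 1: "s - real m \<le> lin_ext G (ray_point \<pi> s)" .
  have 2: "lin_ext G (ray_point \<pi>' t) = 0"
    unfolding ray_point_lin_ext[OF assms(2) t] G_def
    using potential_other_ray_0[OF assms(1,2,5,6), where K = K] by simp
  have "\<bar>lin_ext G (ray_point \<pi> s) - lin_ext G (ray_point \<pi>' t)\<bar> \<le> sd (ray_point \<pi> s) (ray_point \<pi>' t)"
    by (rule sd_ge_lin_ext) (auto simp: G_def intro!: potential_edge ray_point_in assms)
  then show ?thesis using 1 2 by simp
qed

abbreviation nbrs :: "'v \<Rightarrow> 'v set" where "nbrs \<equiv> graph_neighbours E"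

text \<open>A numbering of the ways on from \<open>t\<close> that do not lead back to
  \<open>a\<close>; the \<open>+ 1\<close> accounts for \<open>a\<close>. It is total, with large
  numbers reusing a child, so that every label sequence defines a walk.\<close>

definition child :: "'v \<Rightarrow> 'v \<Rightarrow> nat \<Rightarrow> 'v" where
  "child a t = (SOME f. range f \<subseteq> nbrs t - {a} \<and>
     inj_on f {c. infinite (nbrs t) \<or> c + 1 < card (nbrs t)})"

lemma child:
  assumes "infinite (nbrs t) \<or> 1 < card (nbrs t)"
  shows "child a t c \<in> nbrs t - {a}"
    "inj_on (child a t) {c. infinite (nbrs t) \<or> c + 1 < card (nbrs t)}"
proof -
  let ?N = "nbrs t - {a}" and ?C = "{c. infinite (nbrs t) \<or> c + 1 < card (nbrs t)}"
  have "\<exists>f. range f \<subseteq> ?N \<and> inj_on f ?C"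
  proof (cases "finite (nbrs t)")
    case True
    define M where "M = card ?N"
    have M: "card (nbrs t) - 1 \<le> M"
      unfolding M_def by (simp add: card_Diff_singleton_if)
    have "0 < M" using M assms True by simp
    have "finite ?N" using True by simp
    then obtain g :: "nat \<Rightarrow> 'v" where g: "bij_betw g {0..<M} ?N"
      unfolding M_def using ex_bij_betw_nat_finite by blast
    let ?f = "\<lambda>c. if c < M then g c else g 0"
    have gN: "g c \<in> ?N" if "c < M" for c using bij_betwE[OF g] that by simp
    have "range ?f \<subseteq> ?N" using gN \<open>0 < M\<close> by (simp add: image_subset_iff)
    moreover have "inj_on ?f ?C"
    proof (rule inj_onI)
      fix c d assume "c \<in> ?C" "d \<in> ?C" "?f c = ?f d"
      moreover from this have "c < M" "d < M" using True M by auto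
      ultimately show "c = d" using bij_betw_imp_inj_on[OF g] by (simp add: inj_on_def)
    qed
    ultimately show ?thesis by blast
  next
    case False
    then have "infinite ?N" by simp
    then obtain g :: "nat \<Rightarrow> 'v" where "inj g" "range g \<subseteq> ?N"
      using infinite_countable_subset by blast
    then show ?thesis by (intro exI[of _ g]) (auto intro: inj_on_subset)
  qed
  then have "range (child a t) \<subseteq> ?N \<and> inj_on (child a t) ?C"
    unfolding child_def by (rule someI_ex)
  then show "child a t c \<in> ?N" "inj_on (child a t) ?C" by auto
qed

text \<open>The state consists of the previous and the current vertex. The root is its own
  predecessor, which excludes no neighbour because there are no loops.\<close>

primrec walk :: "'v \<Rightarrow> (nat \<Rightarrow> nat) \<Rightarrow> nat \<Rightarrow> 'v \<times> 'v" where
  "walk t0 \<Omega> 0 = (t0, t0)"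
| "walk t0 \<Omega> (Suc i) = (snd (walk t0 \<Omega> i), child (fst (walk t0 \<Omega> i)) (snd (walk t0 \<Omega> i)) (\<Omega> i))"

lemma walk_cong: "(\<And>j. j < i \<Longrightarrow> \<Omega> j = \<Omega>' j) \<Longrightarrow> walk t0 \<Omega> i = walk t0 \<Omega>' i"
  by (induction i) auto

end

section \<open>Walks in an exponentially branching tree as codes of label sequences\<close>

locale exponential_tree = tree V E for V :: "'v set" and E +
  fixes t0 :: 'v and \<sigma> :: real
  assumes t0: "t0 \<in> V" and \<sigma>: "0 < \<sigma>"
    and branching: "t \<in> V \<Longrightarrow> infinite (graph_neighbours E t) \<or>
        exp (\<sigma> * simplicial_dist V E (vertex_point t) (vertex_point t0)) < real (card (graph_neighbours E t))"
begin

abbreviation walk_ray :: "(nat \<Rightarrow> nat) \<Rightarrow> nat \<Rightarrow> 'v" where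
  "walk_ray \<Omega> i \<equiv> snd (walk t0 \<Omega> i)"

lemma vertex_point_in: "v \<in> V \<Longrightarrow> vertex_point v \<in> realization"
  using vertex_point_cell[of v "{v}"] unfolding geometric_realization_def graph_simplices_def by auto

lemma nbrs_card: assumes "t \<in> V" shows "infinite (nbrs t) \<or> 1 < card (nbrs t)"
proof -
  have "1 \<le> exp (\<sigma> * sd (vertex_point t) (vertex_point t0))"
    using sd_nonneg[OF vertex_point_in[OF assms] vertex_point_in[OF t0]] \<sigma> by simp
  then show ?thesis using branching[OF assms] by linarith
qed

lemma walk_ray_in: "walk_ray \<Omega> i \<in> V \<and> {walk_ray \<Omega> i, walk_ray \<Omega> (Suc i)} \<in> E"
proof (induction i)
  case 0
  then show ?case using t0 child(1)[OF nbrs_card[OF t0], of t0 "\<Omega> 0"] by (auto simp: graph_neighbours_def)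
next
  case (Suc i)
  then have v: "walk_ray \<Omega> (Suc i) \<in> V" using edgeD by blast
  then show ?case
    using child(1)[OF nbrs_card[OF v], of "walk_ray \<Omega> i" "\<Omega> (Suc i)"] by (auto simp: graph_neighbours_def)
qed

lemma ray_walk: "ray (walk_ray \<Omega>)"
  unfolding ray_def
proof (intro conjI allI)
  fix i
  show "{walk_ray \<Omega> i, walk_ray \<Omega> (Suc i)} \<in> E" using walk_ray_in by blast
  have "walk_ray \<Omega> (Suc i) \<in> V" using walk_ray_in by blast
  from child(1)[OF nbrs_card[OF this], of "walk_ray \<Omega> i" "\<Omega> (Suc i)"]
  show "walk_ray \<Omega> (Suc (Suc i)) \<noteq> walk_ray \<Omega> i" by simp
qed

lemma walk_ray_depth: "real i \<le> sd (vertex_point (walk_ray \<Omega> i)) (vertex_point t0)"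
  using sd_two_rays_ge[OF ray_walk[of \<Omega>] ray_walk[of \<Omega>], of "real i" "real 0"]
  unfolding ray_point_nat by simp

text \<open>Without backtracking the walk is at distance at least \<open>i\<close> from
  \<open>t0\<close> after \<open>i\<close> steps, so the valence there exceeds
  \<open>exp (\<sigma> * real i)\<close> and admissible labels choose distinct children.\<close>

lemma walk_diverge:
  assumes "\<And>j. j < i \<Longrightarrow> \<Omega> j = \<Omega>' j" "\<Omega> i \<noteq> \<Omega>' i"
    and "real (\<Omega> i) + 1 \<le> exp (\<sigma> * real i)" "real (\<Omega>' i) + 1 \<le> exp (\<sigma> * real i)"
  shows "walk_ray \<Omega> (Suc i) \<noteq> walk_ray \<Omega>' (Suc i)"
proof -
  have w: "walk t0 \<Omega> i = walk t0 \<Omega>' i" using walk_cong assms(1) by blast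
  define t where "t = walk_ray \<Omega> i"
  define a where "a = fst (walk t0 \<Omega> i)"
  have t: "t \<in> V" unfolding t_def using walk_ray_in by blast
  have "exp (\<sigma> * real i) \<le> exp (\<sigma> * sd (vertex_point t) (vertex_point t0))"
    using walk_ray_depth[of i \<Omega>] \<sigma> unfolding t_def by simp
  then have "infinite (nbrs t) \<or> exp (\<sigma> * real i) < real (card (nbrs t))" using branching[OF t] by linarith
  then have "\<Omega> i \<in> {c. infinite (nbrs t) \<or> c + 1 < card (nbrs t)}"
    "\<Omega>' i \<in> {c. infinite (nbrs t) \<or> c + 1 < card (nbrs t)}"
    using assms(3,4) by auto
  then have "child a t (\<Omega> i) \<noteq> child a t (\<Omega>' i)"
    using child(2)[OF nbrs_card[OF t], of a] assms(2) by (auto simp: inj_on_def)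
  then show ?thesis using w unfolding a_def t_def by simp
qed

text \<open>Labels are placed at every \<open>\<Lambda>\<close>-th vertex beyond depth \<open>D\<close>, where the valence exceeds the
  number of labels.\<close>

definition spread :: "nat \<Rightarrow> nat \<Rightarrow> (nat \<Rightarrow> nat) \<Rightarrow> nat \<Rightarrow> nat" where
  "spread D \<Lambda> \<omega> i = (if D \<le> i \<and> \<Lambda> dvd (i - D) then \<omega> ((i - D) div \<Lambda>) else 0)"

text \<open>An unlabelled initial segment of length \<open>D\<close> with
  \<open>\<sigma> * D \<ge> ln C\<close> absorbs the factor \<open>C\<close>, and spacing
  \<open>L\<close> with \<open>\<sigma> * L \<ge> ln B\<close> absorbs \<open>B ^ k\<close>. The
  spacing becomes the factor \<open>\<Lambda>\<close>.\<close>

theorem code_points: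
  fixes cap :: "nat \<Rightarrow> nat"
  assumes cap: "\<And>k. real (cap k) \<le> C * B ^ k" and B: "0 < B" and C: "0 < C"
  shows "\<exists>\<Lambda> pt. code_space realization sd \<Lambda> pt cap"
proof -
  obtain D :: nat where D: "ln C / \<sigma> \<le> real D" using real_arch_simple by blast
  obtain L' :: nat where L': "ln B / \<sigma> \<le> real L'" using real_arch_simple by blast
  \<comment> \<open>The successor keeps \<open>L\<close> positive even if
    \<open>B \<le> 1\<close>.\<close>
  define L where "L = Suc L'"
  have L: "ln B / \<sigma> \<le> real L" "0 < L" using L' unfolding L_def by auto
  have capL: "real (cap k) \<le> exp (\<sigma> * real (D + L * k))" for k
  proof -
    have "ln C \<le> \<sigma> * real D" "ln B \<le> \<sigma> * real L" using D L \<sigma> by (simp_all add: field_simps)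
    then have "C \<le> exp (\<sigma> * real D)" "B \<le> exp (\<sigma> * real L)"
      using C B by (metis exp_le_cancel_iff exp_ln)+
    then have "C * B ^ k \<le> exp (\<sigma> * real D) * exp (\<sigma> * real L) ^ k"
      using B C by (intro mult_mono power_mono) auto
    also have "\<dots> = exp (\<sigma> * real (D + L * k))"
      by (simp add: exp_add[symmetric] exp_of_nat_mult[symmetric] algebra_simps)
    finally show ?thesis using cap[of k] by simp
  qed
  define pt where "pt \<omega> h = ray_point (walk_ray (spread D L \<omega>)) (real D + real L * h)" for \<omega> h
  show ?thesis
  proof (intro exI[of _ "real L"] exI[of _ pt] code_space.intro sd_nonneg sd_commute sd_triangle)
    show "0 < real L" using L by simp
    show "pt \<omega> h \<in> realization" if "0 \<le> h" for \<omega> h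
      unfolding pt_def using that by (intro ray_point_in ray_walk) simp
  next
    fix \<omega> \<omega>' :: "nat \<Rightarrow> nat" and h h' c :: real
    assume c: "0 \<le> c" "c \<le> h" "c \<le> h'" and eq: "\<And>k. real k < c \<Longrightarrow> \<omega> k = \<omega>' k"
    have "walk_ray (spread D L \<omega>) i = walk_ray (spread D L \<omega>') i" if i: "real i < real D + real L * c + 1" for i
    proof -
      have "spread D L \<omega> j = spread D L \<omega>' j" if "j < i" for j
      proof (cases "D \<le> j \<and> L dvd (j - D)")
        case True
        then obtain k where k: "j = D + L * k" by (auto elim!: dvdE) (metis le_add_diff_inverse)
        have "real j < real D + real L * c" using that i by linarith
        then have "real k < c" using k L(2) by simp
        then show ?thesis using eq k L(2) unfolding spread_def by simp
      next
        case False
        then show ?thesis unfolding spread_def by auto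
      qed
      then show ?thesis using walk_cong by metis
    qed
    then have "sd (pt \<omega> h) (pt \<omega>' h') \<le> (real D + real L * h - (real D + real L * c)) + (real D + real L * h' - (real D + real L * c))"
      unfolding pt_def using c L by (intro sd_two_rays_le ray_walk) (auto intro: mult_left_mono)
    then show "sd (pt \<omega> h) (pt \<omega>' h') \<le> real L * ((h - c) + (h' - c))" by (simp add: algebra_simps)
  next
    fix \<omega> \<omega>' :: "nat \<Rightarrow> nat" and h h' :: real
    assume h: "0 \<le> h" "0 \<le> h'"
    have "(real D + real L * h) - (real D + real L * h') \<le> sd (pt \<omega> h) (pt \<omega>' h')"
      unfolding pt_def using h by (intro sd_two_rays_ge ray_walk) auto
    then show "real L * (h - h') \<le> sd (pt \<omega> h) (pt \<omega>' h')" by (simp add: algebra_simps)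
  next
    fix \<omega> \<omega>' :: "nat \<Rightarrow> nat" and h h' :: real and k
    assume h: "0 \<le> h" "0 \<le> h'" and cap': "\<And>i. \<omega> i < cap i" "\<And>i. \<omega>' i < cap i" and k: "\<omega> k \<noteq> \<omega>' k"
    \<comment> \<open>The walks fork at the first difference, which may come before
      \<open>k\<close>; an earlier fork only improves the bound.\<close>
    define l where "l = (LEAST l. \<omega> l \<noteq> \<omega>' l)"
    have l: "\<omega> l \<noteq> \<omega>' l" unfolding l_def using k by (rule LeastI)
    have lk: "l \<le> k" unfolding l_def using k by (rule Least_le)
    have small: "\<omega> i = \<omega>' i" if "i < l" for i using that not_less_Least unfolding l_def by blast
    let ?m = "D + L * l"
    have ne: "spread D L \<omega> ?m \<noteq> spread D L \<omega>' ?m" using l L(2) unfolding spread_def by simp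
    have sp: "spread D L \<omega> ?m = \<omega> l" "spread D L \<omega>' ?m = \<omega>' l" using L(2) unfolding spread_def by auto
    have eq: "spread D L \<omega> j = spread D L \<omega>' j" if "j < ?m" for j
    proof (cases "D \<le> j \<and> L dvd (j - D)")
      case True
      then obtain i where i: "j = D + L * i" by (auto elim!: dvdE) (metis le_add_diff_inverse)
      then show ?thesis using that small L(2) unfolding spread_def by simp
    next
      case False
      then show ?thesis unfolding spread_def by auto
    qed
    have capl: "real (\<omega> l) + 1 \<le> exp (\<sigma> * real ?m)" "real (\<omega>' l) + 1 \<le> exp (\<sigma> * real ?m)"
    proof -
      have "real (\<omega> l) + 1 \<le> real (cap l)" "real (\<omega>' l) + 1 \<le> real (cap l)"
        using cap'(1)[of l] cap'(2)[of l] by linarith+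
      then show "real (\<omega> l) + 1 \<le> exp (\<sigma> * real ?m)" "real (\<omega>' l) + 1 \<le> exp (\<sigma> * real ?m)"
        using capL[of l] by linarith+
    qed
    have div: "walk_ray (spread D L \<omega>) (Suc ?m) \<noteq> walk_ray (spread D L \<omega>') (Suc ?m)"
      by (rule walk_diverge) (use eq ne capl sp in auto)
    have same: "walk_ray (spread D L \<omega>) i = walk_ray (spread D L \<omega>') i" if "i \<le> ?m" for i
      using walk_cong[of i "spread D L \<omega>" "spread D L \<omega>'"] eq that by auto
    have "(real D + real L * h) - real ?m \<le> sd (pt \<omega> h) (pt \<omega>' h')"
      unfolding pt_def using h same div by (intro sd_diverging_rays_ge ray_walk) auto
    moreover have "real L * real l \<le> real L * real k" using lk by (simp add: mult_left_mono)
    ultimately show "real L * (h - real k) \<le> sd (pt \<omega> h) (pt \<omega>' h')" by (simp add: algebra_simps)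
  qed
qed

end

section \<open>The triadic height function\<close>

text \<open>\<open>base n j\<close> is the height at which the fold line ending at the vertex \<open>j\<close> of row \<open>n\<close> enters the
  last strip, and \<open>phi n j\<close> the height at which it ends. The vertices \<open>3 * i + 1\<close> and \<open>3 * i + 2\<close> are new;
  their fold lines start in the middle of the gap \<open>i\<close> if its height difference is \<open>2\<close>, and at its left
  end if the difference is \<open>1\<close>. Other differences do not occur.\<close>

primrec base :: "nat \<Rightarrow> int \<Rightarrow> int" where
  "base 0 j = 0"
| "base (Suc n) j =
    (let a = base n (j div 3) + of_bool (odd (j div 3));
         b = base n (j div 3 + 1) + of_bool (even (j div 3))
     in if 3 dvd j then a else if b - a = 2 then a + 1 else if b - a = -2 then a - 1 else a)"

definition phi :: "nat \<Rightarrow> int \<Rightarrow> int" where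
  "phi n j = base n j + of_bool (odd j)"

definition wide :: "nat \<Rightarrow> int \<Rightarrow> bool" where
  "wide n i \<longleftrightarrow> \<bar>phi n (i + 1) - phi n i\<bar> = 2"

definition mid :: "nat \<Rightarrow> int \<Rightarrow> int" where
  "mid n i = (if phi n (i + 1) - phi n i = 2 then phi n i + 1
    else if phi n (i + 1) - phi n i = -2 then phi n i - 1 else phi n i)"

lemma base_Suc: "base (Suc n) j = (if 3 dvd j then phi n (j div 3) else mid n (j div 3))"
  by (simp add: phi_def mid_def Let_def)

lemmas [simp del] = base.simps(2)

lemma base_triple:
  "base (Suc n) (3 * i) = phi n i"
  "base (Suc n) (3 * i + 1) = mid n i"
  "base (Suc n) (3 * i + 2) = mid n i"
  "base (Suc n) (3 * i + 3) = phi n (i + 1)"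
proof -
  have *: "\<not> 3 dvd 3 * i + 1" "\<not> 3 dvd 3 * i + 2" "(3::int) dvd 3 * i + 3"
    "(3 * i + 1) div 3 = i" "(3 * i + 2) div 3 = i" "(3 * i + 3) div 3 = i + 1" by presburger+
  show "base (Suc n) (3 * i) = phi n i" "base (Suc n) (3 * i + 1) = mid n i"
    "base (Suc n) (3 * i + 2) = mid n i" "base (Suc n) (3 * i + 3) = phi n (i + 1)"
    unfolding base_Suc using * by auto
qed

lemma int_triple_cases:
  obtains i :: int where "j = 3 * i" | i where "j = 3 * i + 1" | i where "j = 3 * i + 2"
proof -
  have "j = 3 * (j div 3) \<or> j = 3 * (j div 3) + 1 \<or> j = 3 * (j div 3) + 2" by presburger
  then show thesis using that by blast
qed

text \<open>Differences refine by a fixed rule: a rise 2 becomes 2, -1, 2 and a rise 1 becomes 1,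
  -1, 2; falls follow the same rule with all signs reversed.\<close>

lemma gap: "if even i then phi n (i + 1) - phi n i \<in> {1, 2} else phi n (i + 1) - phi n i \<in> {-1, -2}"
proof (induction n arbitrary: i)
  case 0
  show ?case by (simp add: phi_def)
next
  case (Suc n)
  show ?case
  proof (cases i rule: int_triple_cases)
    case (1 l)
    show ?thesis using Suc[of l] unfolding 1 phi_def[of "Suc n"] base_triple
      by (auto simp: mid_def split: if_splits)
  next
    case (2 l)
    have *: "3 * l + 1 + 1 = 3 * l + 2" by simp
    show ?thesis unfolding 2 * phi_def[of "Suc n"] base_triple by auto
  next
    case (3 l)
    have *: "3 * l + 2 + 1 = 3 * l + 3" by simp
    show ?thesis using Suc[of l] unfolding 3 * phi_def[of "Suc n"] base_triple
      by (auto simp: mid_def split: if_splits)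
  qed
qed

lemma gap_even: "even i \<Longrightarrow> phi n (i + 1) = phi n i + 1 \<or> phi n (i + 1) = phi n i + 2"
  using gap[of i n] by auto

lemma gap_odd: "odd i \<Longrightarrow> phi n (i + 1) = phi n i - 1 \<or> phi n (i + 1) = phi n i - 2"
  using gap[of i n] by auto

lemma mid_eq:
  "mid n i = (if wide n i then (if even i then phi n i + 1 else phi n i - 1) else phi n i)"
  using gap[of i n] unfolding mid_def wide_def by (auto split: if_splits)

lemma mid_bounds: "min (phi n i) (phi n (i + 1)) \<le> mid n i"
  "even i \<Longrightarrow> phi n i \<le> mid n i \<and> mid n i \<le> phi n (i + 1) - 1"
  "odd i \<Longrightarrow> phi n (i + 1) \<le> mid n i \<and> mid n i \<le> phi n i"
  using gap[of i n] unfolding mid_def by (auto split: if_splits)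

lemma base_nonneg: "0 \<le> base n j" and phi_nonneg: "0 \<le> phi n j"
proof -
  have *: "0 \<le> base n j" for j
  proof (induction n arbitrary: j)
    case (Suc n)
    then have p: "0 \<le> phi n i" for i unfolding phi_def by simp
    show ?case unfolding base_Suc using mid_bounds(1)[of n "j div 3"] p[of "j div 3"] p[of "j div 3 + 1"] by auto
  qed simp
  then show "0 \<le> base n j" "0 \<le> phi n j" unfolding phi_def by (simp_all add: *)
qed

text \<open>The source of the second coordinate. The symmetry survives each step because the
  splitting rule commutes with reversing signs: a gap of size 1 splits at its left end whether it
  rises or falls.\<close>

lemma base_shift: "base n (j + 3 ^ n) = int n - base n j"
proof (induction n arbitrary: j)
  case (Suc n)
  have p: "phi n (i + 3 ^ n) = int n + 1 - phi n i" for i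
    unfolding phi_def Suc by (simp add: algebra_simps of_bool_def)
  have m: "mid n (i + 3 ^ n) = int n + 1 - mid n i" for i
  proof -
    have q: "phi n (i + 3 ^ n + 1) = int n + 1 - phi n (i + 1)"
      using p[of "i + 1"] by (simp add: algebra_simps)
    show ?thesis unfolding mid_def q p by auto
  qed
  have "(3::int) dvd j + 3 * a \<longleftrightarrow> 3 dvd j" "(j + 3 * a) div 3 = j div 3 + a" for a
    by presburger+
  from this[of "3 ^ n"] have "(3::int) dvd j + 3 ^ Suc n \<longleftrightarrow> 3 dvd j"
    "(j + 3 ^ Suc n) div 3 = j div 3 + 3 ^ n" by simp_all
  then show ?case unfolding base_Suc by (simp only: p m if_distrib) (simp add: algebra_simps)
qed simp

lemma phi_shift: "phi n (j + 3 ^ n) = int n + 1 - phi n j"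
  unfolding phi_def base_shift by (simp add: of_bool_def)

lemma base_period: "base n (j + 2 * c * 3 ^ n) = base n j"
proof -
  have 1: "base n (j + 2 * 3 ^ n) = base n j" for j
    using base_shift[of n "j + 3 ^ n"] base_shift[of n j] by (simp add: algebra_simps)
  have 2: "base n (j + 2 * int m * 3 ^ n) = base n j" for m j
  proof (induction m)
    case (Suc m)
    then show ?case using 1[of "j + 2 * int m * 3 ^ n"] by (simp add: algebra_simps)
  qed simp
  show ?thesis
  proof (cases "0 \<le> c")
    case True
    then show ?thesis using 2[of j "nat c"] by simp
  next
    case False
    then show ?thesis using 2[of "j + 2 * c * 3 ^ n" "nat (- c)"] by simp
  qed
qed

lemma phi_period: "phi n (j + 2 * c * 3 ^ n) = phi n j"
  unfolding phi_def base_period by simp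

lemma phi_descend: "phi (m + k) (3 ^ k * i) = phi m i + (if odd i then int k else 0)"
proof (induction k)
  case (Suc k)
  have "phi (m + Suc k) (3 ^ Suc k * i) = base (Suc (m + k)) (3 * (3 ^ k * i)) + of_bool (odd i)"
    unfolding phi_def by (simp add: algebra_simps)
  then show ?case unfolding base_triple using Suc by simp
qed simp

text \<open>A long segment of a row contains the descendants of a whole gap of an earlier row, between
  which the height difference has grown by one in each step.\<close>

lemma segment_spread:
  assumes "2 * 3 ^ k \<le> b - a" "k \<le> n"
  obtains y z where "a \<le> y" "y \<le> b" "even y" "a \<le> z" "z \<le> b" "odd z" "phi n z - phi n y \<ge> 1 + int k"
proof -
  define m where "m = n - k"
  have n: "n = m + k" using assms(2) unfolding m_def by simp
  \<comment> \<open>The ceiling of \<open>a / 3 ^ k\<close>; the length \<open>2 * 3 ^ k\<close>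
    leaves room for the multiple with \<open>i + 1\<close> as well.\<close>
  define i where "i = (a + 3 ^ k - 1) div 3 ^ k"
  have "3 ^ k * i = a + 3 ^ k - 1 - (a + 3 ^ k - 1) mod 3 ^ k" unfolding i_def by (simp add: minus_mod_eq_mult_div)
  moreover have "0 \<le> (a + 3 ^ k - 1) mod 3 ^ k" "(a + 3 ^ k - 1) mod 3 ^ k < 3 ^ k" by simp_all
  ultimately have i: "a \<le> 3 ^ k * i" "3 ^ k * i \<le> a + 3 ^ k - 1" by linarith+
  have i1: "3 ^ k * (i + 1) = 3 ^ k * i + 3 ^ k" by (simp add: algebra_simps)
  have bounds: "a \<le> 3 ^ k * i" "3 ^ k * i \<le> b" "a \<le> 3 ^ k * (i + 1)" "3 ^ k * (i + 1) \<le> b"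
    unfolding i1 using i assms(1) by linarith+
  show thesis
  proof (cases "even i")
    case True
    then have "phi n (3 ^ k * (i + 1)) - phi n (3 ^ k * i) \<ge> 1 + int k"
      unfolding n phi_descend using gap_even[of i m] by auto
    then show ?thesis using that[of "3 ^ k * i" "3 ^ k * (i + 1)"] bounds True by simp
  next
    case False
    then have "phi n (3 ^ k * i) - phi n (3 ^ k * (i + 1)) \<ge> 1 + int k"
      unfolding n phi_descend using gap_odd[of i m] by auto
    then show ?thesis using that[of "3 ^ k * (i + 1)" "3 ^ k * i"] bounds False by simp
  qed
qed

section \<open>Edge labels\<close>

text \<open>\<open>anc j\<close> is a vertex of the previous row whose path from the root contains the starting point of
  the fold line of \<open>j\<close>; for a new fold line it is the maximum of the gap.\<close>

definition anc :: "int \<Rightarrow> int" where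
  "anc j = (if 3 dvd j \<or> odd (j div 3) then j div 3 else j div 3 + 1)"

lemma anc_triple: "anc (3 * i) = i" "anc (3 * i + 1) = (if odd i then i else i + 1)"
  "anc (3 * i + 2) = (if odd i then i else i + 1)" "anc (3 * i + 3) = i + 1"
proof -
  have *: "(3::int) dvd 3 * i" "\<not> 3 dvd 3 * i + 1" "\<not> 3 dvd 3 * i + 2" "(3::int) dvd 3 * i + 3"
    "(3 * i) div 3 = i" "(3 * i + 1) div 3 = i" "(3 * i + 2) div 3 = i" "(3 * i + 3) div 3 = i + 1"
    by presburger+
  show "anc (3 * i) = i" "anc (3 * i + 1) = (if odd i then i else i + 1)"
    "anc (3 * i + 2) = (if odd i then i else i + 1)" "anc (3 * i + 3) = i + 1"
    unfolding anc_def using * by auto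
qed

lemma anc_dist: "\<bar>3 * anc j - j\<bar> \<le> 2"
  by (cases j rule: int_triple_cases) (auto simp: anc_triple)

lemma anc_mono: assumes "i \<le> j" shows "anc i \<le> anc j"
  using assms
proof (induction rule: int_ge_induct)
  case (step j)
  have "anc j \<le> anc (j + 1)"
  proof (cases j rule: int_triple_cases)
    case (2 i)
    have *: "3 * i + 1 + 1 = 3 * i + 2" by simp
    show ?thesis unfolding 2 * by (simp add: anc_triple)
  next
    case (3 i)
    have *: "3 * i + 2 + 1 = 3 * i + 3" by simp
    show ?thesis unfolding 3 * by (simp add: anc_triple)
  qed (simp add: anc_triple)
  then show ?case using step by simp
qed simp

lemma anc_shift: assumes "even c" shows "anc (j + 3 * c) = anc j + c"
proof -
  have "(3::int) dvd j + 3 * c \<longleftrightarrow> 3 dvd j" "(j + 3 * c) div 3 = j div 3 + c" by presburger+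
  then show ?thesis using assms unfolding anc_def by simp
qed

lemma anc_pow_mono: "i \<le> j \<Longrightarrow> (anc ^^ k) i \<le> (anc ^^ k) j"
  by (induction k) (auto intro: anc_mono)

lemma anc_pow_multiple: "(anc ^^ k) (3 ^ k * i) = i"
proof (induction k)
  case (Suc k)
  have "(anc ^^ Suc k) (3 ^ Suc k * i) = (anc ^^ k) (anc (3 * (3 ^ k * i)))"
    by (simp add: funpow_swap1 algebra_simps)
  then show ?case using Suc by (simp add: anc_triple)
qed simp

text \<open>The errors form a geometric series:
  \<open>2 * (1 + 3 + ... + 3 ^ (k - 1)) = 3 ^ k - 1\<close>.\<close>

lemma anc_pow_dist: "\<bar>3 ^ k * (anc ^^ k) j - j\<bar> \<le> 3 ^ k - 1"
proof (induction k)
  case (Suc k)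
  have "\<bar>3 * anc ((anc ^^ k) j) - (anc ^^ k) j\<bar> \<le> 2" by (rule anc_dist)
  then have "3 ^ k * \<bar>3 * anc ((anc ^^ k) j) - (anc ^^ k) j\<bar> \<le> 3 ^ k * 2" by (intro mult_left_mono) auto
  moreover have "3 ^ Suc k * (anc ^^ Suc k) j - 3 ^ k * (anc ^^ k) j = 3 ^ k * (3 * anc ((anc ^^ k) j) - (anc ^^ k) j)"
    by (simp add: algebra_simps)
  ultimately have "\<bar>3 ^ Suc k * (anc ^^ Suc k) j - 3 ^ k * (anc ^^ k) j\<bar> \<le> 2 * 3 ^ k"
    by (simp add: abs_mult)
  then show ?case using Suc unfolding abs_le_iff power_Suc by linarith
qed simp

text \<open>\<open>edge n j k\<close> names the edge of the tree of heights that joins height \<open>k\<close> to height \<open>k + 1\<close>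
  on the way to the vertex \<open>j\<close> of row \<open>n\<close>; it is named after the vertex at which it ends for
  the first time. It is meaningful only for \<open>k < phi n j\<close>.\<close>

primrec edge :: "nat \<Rightarrow> int \<Rightarrow> nat \<Rightarrow> nat \<times> int" where
  "edge 0 j k = (0, j)"
| "edge (Suc n) j k = (if base (Suc n) j \<le> int k then (Suc n, j) else edge n (anc j) k)"

text \<open>Hence an edge not created in the last row lies below the ancestor, and the recursion of
  \<open>edge\<close> stays in its meaningful range.\<close>

lemma base_le_phi_anc: "base (Suc n) j \<le> phi n (anc j)"
proof (cases j rule: int_triple_cases)
  case (1 i) then show ?thesis by (simp add: base_triple anc_triple)
next
  case (2 i) then show ?thesis using mid_bounds(2,3)[of i n] by (cases "even i") (auto simp: base_triple anc_triple)
next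
  case (3 i) then show ?thesis using mid_bounds(2,3)[of i n] by (cases "even i") (auto simp: base_triple anc_triple)
qed

lemma phi_Suc_le: "phi (Suc n) j \<le> phi n (anc j) + 1"
  using base_le_phi_anc[of n j] unfolding phi_def[of "Suc n"] by simp

lemma phi_anc_pow_le: "phi (m + k) j \<le> phi m ((anc ^^ k) j) + int k"
proof (induction k arbitrary: j)
  case (Suc k)
  have "phi (m + Suc k) j \<le> phi (m + k) (anc j) + 1" using phi_Suc_le[of "m + k" j] by simp
  also have "\<dots> \<le> phi m ((anc ^^ k) (anc j)) + int k + 1" using Suc[of "anc j"] by simp
  finally show ?case by (simp add: funpow_swap1)
qed simp

text \<open>The zigzag is monotone between neighbours, so nothing below both heights separates them.
  Newborn vertices inherit from the upper end of their gap, and the induction hypothesis links it to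
  the lower end.\<close>

lemma edge_adjacent:
  "int k < phi n j \<Longrightarrow> int k < phi n (j + 1) \<Longrightarrow> edge n j k = edge n (j + 1) k"
proof (induction n arbitrary: j)
  case 0
  then show ?case by (cases "even j") (auto simp: phi_def)
next
  case (Suc n)
  show ?case
  proof (cases j rule: int_triple_cases)
    case (1 i)
    have k: "int k < phi n i" "int k < mid n i"
    proof -
      have "int k < phi n i + of_bool (odd i)" "int k < mid n i + of_bool (even i)"
        using Suc.prems unfolding 1 phi_def[of "Suc n"] base_triple by simp_all
      then show "int k < phi n i" "int k < mid n i"
        using mid_bounds(2,3)[of i n] by (cases "even i"; simp)+
    qed
    have "edge (Suc n) j k = edge n i k" using k unfolding 1 by (simp add: base_triple anc_triple)
    moreover have "edge (Suc n) (j + 1) k = edge n (if odd i then i else i + 1) k"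
      using k unfolding 1 by (simp add: base_triple anc_triple)
    moreover have "even i \<Longrightarrow> edge n i k = edge n (i + 1) k"
      using Suc.IH[of i] k gap_even[of i n] by auto
    ultimately show ?thesis by simp
  next
    case (2 i)
    have *: "3 * i + 1 + 1 = 3 * i + 2" by simp
    have "int k < mid n i" using Suc.prems unfolding 2 * phi_def[of "Suc n"] base_triple
      by (cases "even i") simp_all
    then show ?thesis unfolding 2 * by (simp add: base_triple anc_triple)
  next
    case (3 i)
    have *: "3 * i + 2 + 1 = 3 * i + 3" by simp
    have k: "int k < phi n (i + 1)" "int k < mid n i"
    proof -
      have "int k < mid n i + of_bool (odd i)" "int k < phi n (i + 1) + of_bool (even i)"
        using Suc.prems unfolding 3 * phi_def[of "Suc n"] base_triple by simp_all
      then show "int k < phi n (i + 1)" "int k < mid n i"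
        using mid_bounds(2,3)[of i n] by (cases "even i"; simp)+
    qed
    have "edge (Suc n) (j + 1) k = edge n (i + 1) k" using k unfolding 3 * by (simp add: base_triple anc_triple)
    moreover have "edge (Suc n) j k = edge n (if odd i then i else i + 1) k"
      using k unfolding 3 by (simp add: base_triple anc_triple)
    moreover have "odd i \<Longrightarrow> edge n i k = edge n (i + 1) k"
      using Suc.IH[of i] k mid_bounds(3)[of i n] by auto
    ultimately show ?thesis by simp
  qed
qed

text \<open>With \<open>edge_adjacent\<close> this identifies the names at height \<open>k\<close>
  with the components of the vertices above height \<open>k\<close>. Distinct vertices can share a
  name only from an earlier row; a vertex between them then comes from a vertex or a gap between
  their ancestors.\<close>

lemma edge_connected:
  "j \<le> l \<Longrightarrow> l \<le> j' \<Longrightarrow> int k < phi n j \<Longrightarrow> int k < phi n j' \<Longrightarrow> edge n j k = edge n j' k \<Longrightarrow> int k < phi n l"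
proof (induction n arbitrary: j l j')
  case 0
  then show ?case by simp
next
  case (Suc n)
  show ?case
  proof (cases "l = j \<or> l = j'")
    case True
    then show ?thesis using Suc.prems by auto
  next
    case False
    then have l: "j < l" "l < j'" using Suc.prems by auto
    have neq: "fst (edge n i k) \<noteq> Suc n" for i
    proof -
      have "fst (edge n i k) \<le> n" by (induction n arbitrary: i) (auto simp: le_Suc_eq)
      then show ?thesis by simp
    qed
    have k: "int k < base (Suc n) j" "int k < base (Suc n) j'"
      using Suc.prems(5) l neq by (auto split: if_splits) (metis fst_conv neq)+
    then have e: "edge n (anc j) k = edge n (anc j') k" using Suc.prems(5) by simp
    have a: "int k < phi n (anc j)" "int k < phi n (anc j')" using k base_le_phi_anc by (meson less_le_trans)+
    have IH: "int k < phi n i" if "anc j \<le> i" "i \<le> anc j'" for i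
      using Suc.IH[OF that a e] .
    have base: "int k < base (Suc n) l"
    proof (cases l rule: int_triple_cases)
      case (1 i)
      have "anc j \<le> i" "i \<le> anc j'" using anc_mono[of j l] anc_mono[of l j'] l unfolding 1 by (auto simp: anc_triple)
      then show ?thesis using IH unfolding 1 by (simp add: base_triple)
    next
      case (2 i)
      \<comment> \<open>If \<open>j'\<close> is the twin born together with \<open>l\<close>, the
        right end of the gap may lie outside the segment of ancestors; but twins have equal
        \<open>base\<close>.\<close>
      show ?thesis
      proof (cases "j' = 3 * i + 2")
        case True
        then show ?thesis using k unfolding 2 by (simp add: base_triple)
      next
        case False
        then have "j \<le> 3 * i" "3 * i + 3 \<le> j'" using l 2 by auto
        then have "anc j \<le> i" "i + 1 \<le> anc j'" using anc_mono[of j "3 * i"] anc_mono[of "3 * i + 3" j'] by (auto simp: anc_triple)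
        then show ?thesis using IH[of i] IH[of "i + 1"] mid_bounds(1)[of n i] unfolding 2 by (simp add: base_triple)
      qed
    next
      case (3 i)
      show ?thesis
      proof (cases "j = 3 * i + 1")
        case True
        then show ?thesis using k unfolding 3 by (simp add: base_triple)
      next
        case False
        then have "j \<le> 3 * i" "3 * i + 3 \<le> j'" using l 3 by auto
        then have "anc j \<le> i" "i + 1 \<le> anc j'" using anc_mono[of j "3 * i"] anc_mono[of "3 * i + 3" j'] by (auto simp: anc_triple)
        then show ?thesis using IH[of i] IH[of "i + 1"] mid_bounds(1)[of n i] unfolding 3 by (simp add: base_triple)
      qed
    qed
    then show ?thesis unfolding phi_def[of "Suc n"] by simp
  qed
qed

lemma fst_edge_le: "fst (edge n j k) \<le> n"
  by (induction n arbitrary: j) (auto simp: le_Suc_eq)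

lemma edge_new: "base n j \<le> int k \<Longrightarrow> edge n j k = (n, j)"
  by (cases n) auto

text \<open>A fold line climbs only at a maximum and by one unit per row, so it completes a single
  new edge, the one starting at \<open>base n j\<close>.\<close>

lemma edge_self:
  assumes "int k < phi n j" "edge n j k = (n, l)"
  shows "l = j" "odd j" "base n j = int k"
proof -
  have "base n j \<le> int k"
  proof (rule ccontr)
    assume *: "\<not> base n j \<le> int k"
    then obtain n' where n: "n = Suc n'" by (cases n) auto
    then have "edge n j k = edge n' (anc j) k" using * by simp
    then have "fst (edge n j k) \<le> n'" using fst_edge_le by metis
    then show False using assms(2) n by simp
  qed
  then show "l = j" using assms(2) edge_new by auto
  show "odd j" "base n j = int k" using \<open>base n j \<le> int k\<close> assms(1) unfolding phi_def
    by (cases "odd j"; simp)+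
qed

lemma edge_up:
  assumes "int k < phi (m + d) j" "fst (edge (m + d) j k) \<le> m"
  shows "int k < phi m ((anc ^^ d) j)" "edge m ((anc ^^ d) j) k = edge (m + d) j k"
  using assms
proof (induction d arbitrary: j)
  case (Suc d)
  {
    case 1
    then have "int k < base (Suc (m + d)) j" by (auto split: if_splits)
    then have "int k < phi (m + d) (anc j)" "edge (m + Suc d) j k = edge (m + d) (anc j) k"
      using base_le_phi_anc[of "m + d" j] by auto
    then show ?case using Suc(1)[of "anc j"] 1 by (simp add: funpow_swap1)
  next
    case 2
    then have "int k < base (Suc (m + d)) j" by (auto split: if_splits)
    then have "int k < phi (m + d) (anc j)" "edge (m + Suc d) j k = edge (m + d) (anc j) k"
      using base_le_phi_anc[of "m + d" j] by auto
    then show ?case using Suc(2)[of "anc j"] 2 by (simp add: funpow_swap1)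
  }
qed simp_all

lemma edge_period:
  "edge n (j + 2 * c * 3 ^ n) k = (fst (edge n j k), snd (edge n j k) + 2 * c * 3 ^ fst (edge n j k))"
proof (induction n arbitrary: j)
  case (Suc n)
  have "anc (j + 2 * c * 3 ^ Suc n) = anc j + 2 * c * 3 ^ n"
    using anc_shift[of "2 * c * 3 ^ n" j] by (simp add: algebra_simps)
  moreover have "base (Suc n) (j + 2 * c * 3 ^ Suc n) = base (Suc n) j" by (rule base_period)
  ultimately show ?case using Suc[of "anc j"] by simp
qed simp

section \<open>A colouring of the edges\<close>

text \<open>Well-founded recursion with the least colour absent among the forbidden predecessors;
  one of \<open>card (P v) + 1\<close> colours is always free.\<close>

lemma greedy_colouring:
  fixes P :: "'a \<Rightarrow> 'a set"
  assumes wf: "wf r" and fin: "\<And>v. finite (P v)" and less: "\<And>u v. u \<in> P v \<Longrightarrow> (u, v) \<in> r"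
  shows "\<exists>c :: 'a \<Rightarrow> nat. \<forall>v. c v \<le> card (P v) \<and> (\<forall>u\<in>P v. c u \<noteq> c v)"
proof -
  define c :: "'a \<Rightarrow> nat" where "c = wfrec r (\<lambda>f v. LEAST k. k \<notin> f ` P v)"
  have c: "c v = (LEAST k. k \<notin> c ` P v)" for v
  proof -
    have "cut c r v ` P v = c ` P v" by (rule image_cong) (auto simp: cut_apply less)
    then show ?thesis unfolding c_def by (subst wfrec[OF wf]) simp
  qed
  show ?thesis
  proof (intro exI[of _ c] allI conjI ballI)
    fix v
    have "\<exists>k\<le>card (P v). k \<notin> c ` P v"
    proof (rule ccontr)
      assume "\<not> ?thesis"
      then have "{..card (P v)} \<subseteq> c ` P v" by auto
      then have "card {..card (P v)} \<le> card (c ` P v)" using fin by (intro card_mono) auto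
      also have "\<dots> \<le> card (P v)" using fin by (rule card_image_le)
      finally show False by simp
    qed
    then obtain k where k: "k \<le> card (P v)" "k \<notin> c ` P v" by blast
    then show "c v \<le> card (P v)" unfolding c[of v] using Least_le[of "\<lambda>k. k \<notin> c ` P v" k] by linarith
    have "c v \<notin> c ` P v" unfolding c[of v] using k(2) by (rule LeastI)
    then show "c u \<noteq> c v" if "u \<in> P v" for u using that by (metis image_eqI)
  qed
qed

text \<open>The rows live on the universal cover of a circle of circumference \<open>12\<close>.\<close>

definition reduce :: "nat \<times> int \<Rightarrow> nat \<times> int" where
  "reduce e = (fst e, snd e mod (12 * 3 ^ fst e))"

text \<open>Edges outside this radius are so far apart that a ridge whose relative height is at least
  \<open>2 * (k + 1)\<close> lies between them.\<close>

definition radius :: "nat \<Rightarrow> int" where "radius k = 3 ^ (3 * k + 4)"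

text \<open>At most \<open>2 * radius k + 1\<close> edges are forbidden for an edge at height
  \<open>k\<close>, so greedy colours stay below this number. It is exponential in \<open>k\<close>,
  as the coding requires.\<close>

definition cap :: "nat \<Rightarrow> nat" where "cap k = 2 * 3 ^ (3 * k + 4) + 2"

text \<open>Of two edges at the same height the one completed later carries the constraint, and
  distance is measured in the grid of its row; the other edge is named through a vertex
  \<open>u\<close> of that row.\<close>

definition edge_colouring :: "(nat \<times> int \<Rightarrow> nat) \<Rightarrow> bool" where
  "edge_colouring \<chi> \<longleftrightarrow> (\<forall>e. \<chi> (reduce e) = \<chi> e) \<and>
    (\<forall>m l k. base m l = int k \<longrightarrow> \<chi> (m, l) < cap k) \<and>
    (\<forall>m l k u. odd l \<and> base m l = int k \<and> \<bar>u - l\<bar> \<le> radius k \<and> int k < phi m u \<and>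
        reduce (edge m u k) \<noteq> reduce (m, l) \<longrightarrow> \<chi> (edge m u k) \<noteq> \<chi> (m, l))"

text \<open>Edges are ordered by row and then by position on the circle. Forbidden edges of earlier
  rows come first; within one row the relation of being within the radius is symmetric, so the later
  edge avoids the colour of the earlier.\<close>

lemma exists_colouring: "\<exists>\<chi>. edge_colouring \<chi>"
proof -
  let ?r = "inv_image (less_than <*lex*> less_than) (\<lambda>e :: nat \<times> int. (fst e, nat (snd e)))"
  define raw where "raw e = (let k = nat (base (fst e) (snd e)) in
      (\<lambda>u. reduce (edge (fst e) u k)) ` {u. \<bar>u - snd e\<bar> \<le> radius k \<and> int k < phi (fst e) u})"
    for e :: "nat \<times> int"
  have raw_sub: "raw e \<subseteq> (\<lambda>u. reduce (edge (fst e) u (nat (base (fst e) (snd e))))) `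
      {snd e - radius (nat (base (fst e) (snd e))) .. snd e + radius (nat (base (fst e) (snd e)))}" for e
    unfolding raw_def Let_def by (rule image_mono) (auto simp: abs_le_iff)
  have raw_fin: "finite (raw e)" for e by (rule finite_subset[OF raw_sub]) simp
  have raw_card: "card (raw e) < cap (nat (base (fst e) (snd e)))" for e
  proof -
    define k where "k = nat (base (fst e) (snd e))"
    have "card (raw e) \<le> card {snd e - radius k .. snd e + radius k}"
      using raw_sub[of e] unfolding k_def by (rule surj_card_le[rotated]) simp
    also have "\<dots> = nat (2 * radius k + 1)" by (simp add: algebra_simps)
    also have "\<dots> < cap k" unfolding radius_def cap_def by (simp add: nat_less_iff)
    finally show ?thesis unfolding k_def .
  qed
  define P where "P e = raw e \<inter> {e'. (e', e) \<in> ?r}" for e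
  have "\<exists>c :: nat \<times> int \<Rightarrow> nat. \<forall>v. c v \<le> card (P v) \<and> (\<forall>u\<in>P v. c u \<noteq> c v)"
    by (rule greedy_colouring[where r = ?r]) (auto simp: P_def raw_fin)
  then obtain c :: "nat \<times> int \<Rightarrow> nat" where c: "\<And>v. c v \<le> card (P v)" "\<And>u v. u \<in> P v \<Longrightarrow> c u \<noteq> c v"
    by blast
  have base_mod: "base m (l mod (12 * 3 ^ m)) = base m l" for m l
  proof -
    have "l mod (12 * 3 ^ m) = l + 2 * (- 6 * (l div (12 * 3 ^ m))) * 3 ^ m"
      by (simp add: minus_div_mult_eq_mod[symmetric] algebra_simps)
    then show ?thesis by (simp only: base_period)
  qed
  have reduce_shift: "reduce (m, l + 2 * (6 * q) * 3 ^ m) = reduce (m, l)" for m l q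
  proof -
    have "l + 2 * (6 * q) * 3 ^ m = l + q * (12 * 3 ^ m)" by simp
    then show ?thesis unfolding reduce_def by (simp only: fst_conv snd_conv mod_mult_self1)
  qed
  have raw: "reduce (edge m u k) \<in> raw (reduce (m, l))"
    if "base m l = int k" "\<bar>u - l\<bar> \<le> radius k" "int k < phi m u" for m l u k
  proof -
    define q where "q = - (l div (12 * 3 ^ m))"
    define u0 where "u0 = u + 2 * (6 * q) * 3 ^ m"
    have l0: "l mod (12 * 3 ^ m) = l + 2 * (6 * q) * 3 ^ m"
      unfolding q_def by (simp add: minus_div_mult_eq_mod[symmetric] algebra_simps)
    have "reduce (edge m u0 k) = reduce (edge m u k)"
      unfolding u0_def edge_period using reduce_shift[of "fst (edge m u k)" "snd (edge m u k)" q] by simp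
    moreover have "\<bar>u0 - l mod (12 * 3 ^ m)\<bar> \<le> radius k" unfolding l0 u0_def using that(2) by simp
    moreover have "int k < phi m u0" unfolding u0_def phi_period using that(3) .
    moreover have "nat (base m (l mod (12 * 3 ^ m))) = k" using base_mod that(1) by simp
    ultimately show ?thesis unfolding raw_def
      by (simp add: reduce_def) (metis (mono_tags, lifting) image_eqI mem_Collect_eq)
  qed
  show ?thesis unfolding edge_colouring_def
  proof (intro exI[of _ "\<lambda>e. c (reduce e)"] conjI allI impI)
    fix e show "c (reduce (reduce e)) = c (reduce e)" by (simp add: reduce_def)
  next
    fix m l k assume "base m l = int k"
    then have "nat (base (fst (reduce (m, l))) (snd (reduce (m, l)))) = k" by (simp add: reduce_def base_mod)
    then have "card (raw (reduce (m, l))) < cap k" using raw_card[of "reduce (m, l)"] by simp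
    moreover have "card (P (reduce (m, l))) \<le> card (raw (reduce (m, l)))"
      by (rule card_mono[OF raw_fin]) (auto simp: P_def)
    ultimately show "c (reduce (m, l)) < cap k" using c(1)[of "reduce (m, l)"] by linarith
  next
    fix m l k u
    assume a: "odd l \<and> base m l = int k \<and> \<bar>u - l\<bar> \<le> radius k \<and> int k < phi m u \<and>
        reduce (edge m u k) \<noteq> reduce (m, l)"
    then have in_raw: "reduce (edge m u k) \<in> raw (reduce (m, l))" using raw by blast
    show "c (reduce (edge m u k)) \<noteq> c (reduce (m, l))"
    proof (cases "(reduce (edge m u k), reduce (m, l)) \<in> ?r")
      case True
      then show ?thesis using c(2) in_raw unfolding P_def by blast
    next
      case False
      then have "fst (edge m u k) = m" using fst_edge_le[of m u k] by (auto simp: reduce_def)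
      then have "edge m u k = (m, snd (edge m u k))" by (metis prod.collapse)
      from edge_self[OF _ this] a have e: "edge m u k = (m, u)" "base m u = int k" using \<open>edge m u k = _\<close> by auto
      define U L where "U = u mod (12 * 3 ^ m)" and "L = l mod (12 * 3 ^ m)"
      have red: "reduce (m, u) = (m, U)" "reduce (m, l) = (m, L)" by (simp_all add: reduce_def U_def L_def)
      have "0 \<le> U" "0 \<le> L" "U \<noteq> L" using a e red unfolding U_def L_def by auto
      then have r: "(reduce (m, l), reduce (m, u)) \<in> ?r" using False unfolding e red by auto
      have "int k < phi m l" using a unfolding phi_def by simp
      then have "reduce (edge m l k) \<in> raw (reduce (m, u))"
        using raw[of m u k l] e a by (simp add: abs_minus_commute)
      moreover have "edge m l k = (m, l)" using a by (intro edge_new) simp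
      ultimately show ?thesis using c(2) r unfolding P_def e by fastforce
    qed
  qed
qed

definition colour :: "nat \<times> int \<Rightarrow> nat" where "colour = (SOME \<chi>. edge_colouring \<chi>)"

lemma colour_reduce: "colour (reduce e) = colour e"
  and colour_less: "base m l = int k \<Longrightarrow> colour (m, l) < cap k"
  and colour_neq: "odd l \<Longrightarrow> base m l = int k \<Longrightarrow> \<bar>u - l\<bar> \<le> radius k \<Longrightarrow> int k < phi m u \<Longrightarrow>
    reduce (edge m u k) \<noteq> reduce (m, l) \<Longrightarrow> colour (edge m u k) \<noteq> colour (m, l)"
proof -
  have "edge_colouring colour" unfolding colour_def using exists_colouring by (rule someI_ex)
  then show "colour (reduce e) = colour e" "base m l = int k \<Longrightarrow> colour (m, l) < cap k"
    "odd l \<Longrightarrow> base m l = int k \<Longrightarrow> \<bar>u - l\<bar> \<le> radius k \<Longrightarrow> int k < phi m u \<Longrightarrow>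
      reduce (edge m u k) \<noteq> reduce (m, l) \<Longrightarrow> colour (edge m u k) \<noteq> colour (m, l)"
    unfolding edge_colouring_def by blast+
qed

lemma edge_vertex:
  assumes "int k < phi n j" "edge n j k = (m, l)"
  shows "m \<le> n" "odd l" "base m l = int k" "l = (anc ^^ (n - m)) j"
proof -
  show m: "m \<le> n" using fst_edge_le[of n j k] assms(2) by simp
  then have n: "n = m + (n - m)" by simp
  have u: "int k < phi m ((anc ^^ (n - m)) j)" "edge m ((anc ^^ (n - m)) j) k = (m, l)"
    using edge_up[of k m "n - m" j] assms m by auto
  from edge_self[OF u] show "odd l" "base m l = int k" "l = (anc ^^ (n - m)) j" by auto
qed

text \<open>Both edges are read in the row \<open>m\<close> where the later one is completed. The
  colouring puts \<open>u\<close> and \<open>l\<close> more than \<open>radius k\<close> apart, so a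
  maximum \<open>z\<close> of height at least \<open>3 * k + 3\<close> lies between them, while
  \<open>l\<close> has height \<open>k + 1\<close>: a surplus of \<open>2 * (k + 1)\<close>. Down to
  row \<open>n\<close>, \<open>z\<close> gains one unit per row and \<open>v'\<close> at most
  one.\<close>

lemma same_colour_aux:
  fixes v v' :: int
  assumes k: "int k < phi n v" "int k < phi n v'" and e: "edge n v k \<noteq> edge n v' k"
    and colour: "colour (edge n v k) = colour (edge n v' k)" and dist: "\<bar>v - v'\<bar> < 10 * 3 ^ n"
    and le: "fst (edge n v k) \<le> fst (edge n v' k)"
  shows "\<exists>z. odd z \<and> min v v' < z \<and> z < max v v' \<and> phi n v' + 2 * (int k + 1) \<le> phi n z"
proof -
  obtain m l where ml: "edge n v' k = (m, l)" by fastforce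
  define d where "d = n - m"
  note l = edge_vertex[OF k(2) ml]
  have n: "n = m + d" using l(1) unfolding d_def by simp
  define u where "u = (anc ^^ d) v"
  have u: "int k < phi m u" "edge m u k = edge n v k"
    using edge_up[of k m d v] k(1) le ml unfolding n u_def by auto
  have lv: "l = (anc ^^ d) v'" using l(4) unfolding d_def .
  have lphi: "phi m l = int k + 1" using l(2,3) unfolding phi_def by simp
  \<comment> \<open>Less than a full turn, so \<open>reduce\<close> cannot identify the two edges.
    Each ancestor drifts by less than \<open>3 ^ d\<close>, which accounts for the difference of 12
    and 10.\<close>
  have ul: "\<bar>u - l\<bar> < 12 * 3 ^ m"
  proof -
    have "\<bar>3 ^ d * u - 3 ^ d * l\<bar> < 10 * 3 ^ n + 2 * 3 ^ d"
      using anc_pow_dist[of d v] anc_pow_dist[of d v'] dist unfolding u_def lv by linarith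
    also have "\<dots> \<le> 3 ^ d * (12 * 3 ^ m)"
    proof -
      have "(1::int) \<le> 3 ^ m" by simp
      then have "3 ^ d * 1 \<le> (3::int) ^ d * 3 ^ m" by (intro mult_left_mono) auto
      then show ?thesis unfolding n power_add by simp
    qed
    finally have "3 ^ d * \<bar>u - l\<bar> < 3 ^ d * (12 * 3 ^ m)"
      by (simp add: abs_mult right_diff_distrib[symmetric])
    then show ?thesis by simp
  qed
  have "u \<noteq> l" using e u ml edge_new[of m l k] l(3) by auto
  have "reduce (edge m u k) \<noteq> reduce (m, l)"
  proof
    assume r: "reduce (edge m u k) = reduce (m, l)"
    then have "fst (edge m u k) = m" by (simp add: reduce_def)
    then have "edge m u k = (m, snd (edge m u k))" by (metis prod.collapse)
    with edge_self(1)[OF u(1) this] have "edge m u k = (m, u)" by simp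
    then have "u mod (12 * 3 ^ m) = l mod (12 * 3 ^ m)" using r by (simp add: reduce_def)
    then have "12 * 3 ^ m dvd u - l" by (simp add: mod_eq_dvd_iff)
    then have "12 * 3 ^ m \<le> \<bar>u - l\<bar>" using \<open>u \<noteq> l\<close> by (metis abs_ge_self dvd_imp_le_int eq_iff_diff_eq_0 order.trans)
    then show False using ul by simp
  qed
  then have far: "radius k < \<bar>u - l\<bar>"
    using colour_neq[OF l(2,3), of u] u colour ml by fastforce
  have "3 ^ (3 * k + 2) * (9::int) < 3 ^ m * 12"
    using far ul unfolding radius_def by (simp add: power_add)
  moreover have "(0::int) < 3 ^ m" by simp
  ultimately have "3 ^ (3 * k + 2) < (3::int) ^ Suc m" unfolding power_Suc by linarith
  then have km: "3 * k + 2 \<le> m" using power_strict_increasing_iff[of "3::int" "3 * k + 2" "Suc m"] by simp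
  \<comment> \<open>Only vertices strictly between \<open>u\<close> and \<open>l\<close> are wanted.
    Since \<open>radius k\<close> is nine times \<open>3 ^ (3 * k + 2)\<close>, a length of
    \<open>2 * 3 ^ (3 * k + 2)\<close> remains after trimming.\<close>
  define a b where "a = min u l + 1" and "b = max u l - 1"
  have "2 * 3 ^ (3 * k + 2) \<le> b - a"
  proof -
    have "(1::int) \<le> 3 ^ (3 * k + 2)" by (rule one_le_power) simp
    moreover have "radius k = 9 * 3 ^ (3 * k + 2)" unfolding radius_def by (simp add: power_add)
    ultimately show ?thesis using far unfolding a_def b_def by (simp add: min_def max_def split: if_splits) linarith+
  qed
  then obtain y z where yz: "a \<le> z" "z \<le> b" "odd z" "1 + int (3 * k + 2) \<le> phi m z - phi m y"
    by (rule segment_spread[OF _ km])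
  have "phi n (3 ^ d * z) = phi m z + int d" unfolding n using phi_descend[of m d z] yz(3) by simp
  moreover have "phi n v' \<le> phi m l + int d" unfolding n lv by (rule phi_anc_pow_le)
  moreover have "0 \<le> phi m y" by (rule phi_nonneg)
  ultimately have "phi n v' + 2 * (int k + 1) \<le> phi n (3 ^ d * z)" using yz(4) lphi by simp
  moreover have "odd (3 ^ d * z)" using yz(3) by simp
  moreover have "min v v' < 3 ^ d * z \<and> 3 ^ d * z < max v v'"
  proof -
    have z: "(anc ^^ d) (3 ^ d * z) = z" by (rule anc_pow_multiple)
    have lt: "x < y" if "(anc ^^ d) x < (anc ^^ d) y" for x y
      using anc_pow_mono[of y x d] that by linarith
    have "min u l < z" "z < max u l" using yz unfolding a_def b_def by auto
    then consider "u < z" "z < l" | "l < z" "z < u" using \<open>u \<noteq> l\<close> by (cases "u < l") (auto simp: min_def max_def)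
    then show ?thesis
      using lt[of v "3 ^ d * z"] lt[of "3 ^ d * z" v'] lt[of v' "3 ^ d * z"] lt[of "3 ^ d * z" v]
      unfolding z u_def lv by cases auto
  qed
  ultimately show ?thesis by blast
qed

text \<open>The valley at \<open>l\<close> puts the two edges in different components, so they
  differ. The minimum appears because either edge may be the one completed later.\<close>

lemma same_colour_separated:
  fixes v v' l :: int
  assumes "v < l" "l < v'" "phi n l \<le> int k" "int k < phi n v" "int k < phi n v'"
    and "colour (edge n v k) = colour (edge n v' k)" "v' - v < 10 * 3 ^ n"
  obtains z where "odd z" "v < z" "z < v'" "min (phi n v) (phi n v') + 2 * (int k + 1) \<le> phi n z"
proof -
  have ne: "edge n v k \<noteq> edge n v' k" using edge_connected[of v l v' k n] assms by auto
  have "\<exists>z. odd z \<and> v < z \<and> z < v' \<and> min (phi n v) (phi n v') + 2 * (int k + 1) \<le> phi n z"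
  proof (cases "fst (edge n v k) \<le> fst (edge n v' k)")
    case True
    then obtain z where "odd z" "min v v' < z" "z < max v v'" "phi n v' + 2 * (int k + 1) \<le> phi n z"
      using same_colour_aux[OF assms(4,5) ne assms(6)] assms by auto
    then show ?thesis using assms by (intro exI[of _ z]) auto
  next
    case False
    then obtain z where "odd z" "min v' v < z" "z < max v' v" "phi n v + 2 * (int k + 1) \<le> phi n z"
      using same_colour_aux[OF assms(5,4) ne[symmetric] assms(6)[symmetric]] assms by auto
    then show ?thesis using assms by (intro exI[of _ z]) auto
  qed
  then show thesis using that by blast
qed

section \<open>Interpolation between the rows\<close>

primrec start :: "nat \<Rightarrow> int \<Rightarrow> real" where
  "start 0 j = of_int j"
| "start (Suc n) j = (if 3 dvd j then of_int (j div 3)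
     else of_int (j div 3) + (if wide n (j div 3) then 1 / 2 else 0)) / 3 ^ n"

definition node :: "nat \<Rightarrow> real \<Rightarrow> int \<Rightarrow> real" where
  "node n u j = (1 - u) * start n j + u * (of_int j / 3 ^ n)"

definition val :: "nat \<Rightarrow> real \<Rightarrow> int \<Rightarrow> real" where
  "val n u j = of_int (base n j) + u * of_bool (odd j)"

definition pos :: "nat \<Rightarrow> real \<Rightarrow> int \<Rightarrow> real \<Rightarrow> real" where
  "pos n u j r = (1 - r) * node n u j + r * node n u (j + 1)"

definition hgt :: "nat \<Rightarrow> real \<Rightarrow> int \<Rightarrow> real \<Rightarrow> real" where
  "hgt n u j r = (1 - r) * val n u j + r * val n u (j + 1)"

text \<open>The factor from position to arc length, comparable with \<open>sinh\<close> of the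
  radius. In row 0 it is \<open>u\<close> because the circle shrinks to the origin.\<close>

definition scale :: "nat \<Rightarrow> real \<Rightarrow> real" where
  "scale n u = (if n = 0 then u else 3 ^ n)"

text \<open>The upper end of the gap \<open>j\<close>. The path to it passes through all heights of
  the gap, so it can code every point there.\<close>

definition crest :: "int \<Rightarrow> int" where
  "crest j = (if odd j then j else j + 1)"

text \<open>Above the height of \<open>v\<close> no edge is defined; the filler 0 respects the label
  bound because \<open>cap\<close> is positive.\<close>

definition label :: "nat \<Rightarrow> int \<Rightarrow> nat \<Rightarrow> nat" where
  "label n v k = (if int k < phi n v then colour (edge n v k) else 0)"

definition split_offset :: "nat \<Rightarrow> int \<Rightarrow> real" where
  "split_offset n i = (if wide n i then 1 / 2 else 0)"

lemma start_triple:
  "start (Suc n) (3 * i) = of_int i / 3 ^ n"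
  "start (Suc n) (3 * i + 1) = (of_int i + split_offset n i) / 3 ^ n"
  "start (Suc n) (3 * i + 2) = (of_int i + split_offset n i) / 3 ^ n"
  "start (Suc n) (3 * i + 3) = (of_int i + 1) / 3 ^ n"
proof -
  have *: "\<not> 3 dvd 3 * i + 1" "\<not> 3 dvd 3 * i + 2" "(3::int) dvd 3 * i + 3"
    "(3 * i + 1) div 3 = i" "(3 * i + 2) div 3 = i" "(3 * i + 3) div 3 = i + 1" by presburger+
  show "start (Suc n) (3 * i) = of_int i / 3 ^ n"
    "start (Suc n) (3 * i + 1) = (of_int i + split_offset n i) / 3 ^ n"
    "start (Suc n) (3 * i + 2) = (of_int i + split_offset n i) / 3 ^ n"
    "start (Suc n) (3 * i + 3) = (of_int i + 1) / 3 ^ n"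
    unfolding split_offset_def using * by simp_all
qed

lemmas [simp del] = start.simps(2)

lemma node_0: "node 0 u j = of_int j"
  by (simp add: node_def algebra_simps)

lemma node_triple:
  "3 ^ n * node (Suc n) u (3 * i) = of_int i"
  "3 ^ n * node (Suc n) u (3 * i + 1) = of_int i + (1 - u) * split_offset n i + u / 3"
  "3 ^ n * node (Suc n) u (3 * i + 2) = of_int i + (1 - u) * split_offset n i + 2 * u / 3"
  "3 ^ n * node (Suc n) u (3 * i + 3) = of_int i + 1"
  unfolding node_def start_triple by (simp_all add: field_simps)

lemma val_triple:
  "val (Suc n) u (3 * i) = of_int (phi n i) + u * of_bool (odd i)"
  "val (Suc n) u (3 * i + 1) = of_int (mid n i) + u * of_bool (even i)"
  "val (Suc n) u (3 * i + 2) = of_int (mid n i) + u * of_bool (odd i)"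
  "val (Suc n) u (3 * i + 3) = of_int (phi n (i + 1)) + u * of_bool (even i)"
  unfolding val_def base_triple by simp_all

lemma split_offset_bounds: "0 \<le> split_offset n i" "split_offset n i \<le> 1 / 2"
  unfolding split_offset_def by auto

text \<open>The slopes of the zigzag are bounded above and below uniformly in \<open>u\<close>:
  width and height difference are explicit in each third of an old gap, and both vanish together
  where a new gap is just opening.\<close>

lemma piece_Suc:
  fixes n j u
  assumes u: "0 \<le> u" "u \<le> 1"
  defines "W \<equiv> 3 ^ n * (node (Suc n) u (j + 1) - node (Suc n) u j)"
  defines "d \<equiv> (if even j then val (Suc n) u (j + 1) - val (Suc n) u j else val (Suc n) u j - val (Suc n) u (j + 1))"
  shows "0 \<le> W" "W \<le> d" "d \<le> 6 * W"
proof -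
  have "0 \<le> W \<and> W \<le> d \<and> d \<le> 6 * W"
  proof (cases j rule: int_triple_cases)
    case (1 i)
    have W: "W = (1 - u) * split_offset n i + u / 3"
      unfolding W_def 1 right_diff_distrib node_triple by simp
    have d: "d = (if wide n i then 1 + u else u)"
      unfolding d_def 1 val_triple mid_eq by (cases "even i") (auto simp: algebra_simps)
    show ?thesis using u unfolding W d split_offset_def by (auto simp: field_simps)
  next
    case (2 i)
    have *: "3 * i + 1 + 1 = 3 * i + 2" by simp
    have W: "W = u / 3" unfolding W_def 2 * right_diff_distrib node_triple by simp
    have d: "d = u" unfolding d_def 2 * val_triple by (cases "even i") auto
    show ?thesis using u unfolding W d by auto
  next
    case (3 i)
    have *: "3 * i + 2 + 1 = 3 * i + 3" by simp
    have W: "W = 1 - (1 - u) * split_offset n i - 2 * u / 3"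
      unfolding W_def 3 * right_diff_distrib node_triple by simp
    have d: "d = 1 + u"
      using gap_even[of i n] gap_odd[of i n] unfolding d_def 3 * val_triple mid_eq wide_def
      by (cases "even i") (auto simp: algebra_simps)
    show ?thesis using u unfolding W d split_offset_def by (auto simp: field_simps)
  qed
  then show "0 \<le> W" "W \<le> d" "d \<le> 6 * W" by auto
qed

lemma nonneg_if_power_mult_nonneg: "0 \<le> 3 ^ m * (x::real) \<Longrightarrow> 0 \<le> x"
  using zero_le_mult_iff[of "3 ^ m" x] zero_less_power[of "3::real" m] by linarith

lemma piece:
  assumes u: "0 \<le> u" "u \<le> 1"
  shows node_mono_step: "node n u j \<le> node n u (j + 1)"
    and val_even: "even j \<Longrightarrow> val n u j \<le> val n u (j + 1)"
    and val_odd: "odd j \<Longrightarrow> val n u (j + 1) \<le> val n u j"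
    and slope_ge: "scale n u * (node n u (j + 1) - node n u j) \<le> 3 * \<bar>val n u (j + 1) - val n u j\<bar>"
    and slope_le: "\<bar>val n u (j + 1) - val n u j\<bar> \<le> 2 * (scale n u * (node n u (j + 1) - node n u j))"
proof -
  let ?w = "node n u (j + 1) - node n u j" and ?d = "\<bar>val n u (j + 1) - val n u j\<bar>"
  have "0 \<le> ?w \<and> (even j \<longrightarrow> val n u j \<le> val n u (j + 1)) \<and>
    (odd j \<longrightarrow> val n u (j + 1) \<le> val n u j) \<and> scale n u * ?w \<le> 3 * ?d \<and> ?d \<le> 2 * (scale n u * ?w)"
  proof (cases n)
    case 0
    then show ?thesis using u by (auto simp: node_0 val_def scale_def)
  next
    case (Suc m)
    note p = piece_Suc[OF u, where n = m and j = j]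
    define W where "W = 3 ^ m * ?w"
    have W: "scale n u * ?w = 3 * W" unfolding W_def scale_def Suc by simp
    have "0 \<le> W" "W \<le> ?d" "?d \<le> 6 * W" "even j \<longrightarrow> val n u j \<le> val n u (j + 1)"
        "odd j \<longrightarrow> val n u (j + 1) \<le> val n u j"
      using p unfolding W_def Suc by (auto split: if_splits)
    moreover have "0 \<le> ?w" using \<open>0 \<le> W\<close> unfolding W_def by (rule nonneg_if_power_mult_nonneg)
    ultimately show ?thesis unfolding W by auto
  qed
  then show "node n u j \<le> node n u (j + 1)" "even j \<Longrightarrow> val n u j \<le> val n u (j + 1)"
    "odd j \<Longrightarrow> val n u (j + 1) \<le> val n u j" "scale n u * ?w \<le> 3 * ?d" "?d \<le> 2 * (scale n u * ?w)"
    by auto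
qed

lemma node_mono:
  assumes u: "0 \<le> u" "u \<le> 1" and "i \<le> j"
  shows "node n u i \<le> node n u j"
  using assms(3)
proof (induction rule: int_ge_induct)
  case (step k)
  then show ?case using node_mono_step[OF u, of n k] by linarith
qed simp

lemma start_dist: "3 ^ n * \<bar>start n j - of_int j / 3 ^ n\<bar> \<le> (if n = 0 then 0 else 2)"
proof (cases n)
  case 0
  then show ?thesis by simp
next
  case (Suc m)
  have "3 ^ n * \<bar>start n j - of_int j / 3 ^ n\<bar> = \<bar>3 * (3 ^ m * start n j) - of_int j\<bar>"
    unfolding Suc by (simp add: abs_mult_pos' [symmetric] field_simps)
  also have "\<dots> \<le> 2"
  proof -
    obtain i c where "j = 3 * i + c" "c = 0 \<or> c = 1 \<or> c = 2"
      by (metis add.right_neutral int_triple_cases)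
    then have "3 ^ m * start (Suc m) j = of_int i + (if c = 0 then 0 else split_offset m i)"
      by (auto simp: start_triple)
    then show ?thesis using split_offset_bounds[of m i] \<open>j = 3 * i + c\<close> \<open>c = 0 \<or> c = 1 \<or> c = 2\<close>
      unfolding Suc by auto
  qed
  finally show ?thesis using Suc by simp
qed

lemma node_move: "3 ^ n * \<bar>node n u j - node n u' j\<bar> \<le> (if n = 0 then 0 else 2) * \<bar>u - u'\<bar>"
proof -
  have "node n u j - node n u' j = (u' - u) * (start n j - of_int j / 3 ^ n)"
    unfolding node_def by (simp add: field_simps)
  then have "3 ^ n * \<bar>node n u j - node n u' j\<bar> = \<bar>u - u'\<bar> * (3 ^ n * \<bar>start n j - of_int j / 3 ^ n\<bar>)"
    by (simp add: abs_mult abs_minus_commute)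
  also have "\<dots> \<le> \<bar>u - u'\<bar> * (if n = 0 then 0 else 2)" by (intro mult_left_mono start_dist) simp
  finally show ?thesis by (simp add: mult.commute)
qed

lemma node_dist:
  assumes "0 \<le> u" "u \<le> 1" shows "3 ^ n * \<bar>node n u j - of_int j / 3 ^ n\<bar> \<le> 2"
proof -
  have "(if n = 0 then 0 else 2) * \<bar>u - 1\<bar> \<le> (2::real)" using assms by auto
  then show ?thesis using node_move[of n u j 1] unfolding node_def[of n 1] by simp
qed

lemma node_near: assumes "0 \<le> u" "u \<le> 1" shows "\<bar>3 ^ n * node n u j - of_int j\<bar> \<le> 2"
proof -
  have "3 ^ n * \<bar>node n u j - of_int j / 3 ^ n\<bar> = \<bar>3 ^ n * node n u j - of_int j\<bar>"
    by (simp add: abs_mult_pos'[symmetric] field_simps)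
  then show ?thesis using node_dist[OF assms, of n j] by simp
qed

lemma val_shift: "val n u (j + 3 ^ n) = real n + u - val n u j"
  unfolding val_def base_shift by (auto simp: algebra_simps)

lemma start_shift: "start n (j + 3 ^ n) = start n j + 1"
proof (cases n)
  case (Suc m)
  have w: "wide m (i + 3 ^ m) \<longleftrightarrow> wide m i" for i
    using phi_shift[of m i] phi_shift[of m "i + 1"] unfolding wide_def by (auto simp: algebra_simps)
  have so: "split_offset m (i + 3 ^ m) = split_offset m i" for i unfolding split_offset_def w ..
  show ?thesis
  proof (cases j rule: int_triple_cases)
    case (1 i)
    have *: "3 * i + 3 ^ Suc m = 3 * (i + 3 ^ m)" by simp
    show ?thesis unfolding 1 Suc * start_triple by (simp add: field_simps)
  next
    case (2 i)
    have *: "3 * i + 1 + 3 ^ Suc m = 3 * (i + 3 ^ m) + 1" by simp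
    show ?thesis unfolding 2 Suc * start_triple so by (simp add: field_simps)
  next
    case (3 i)
    have *: "3 * i + 2 + 3 ^ Suc m = 3 * (i + 3 ^ m) + 2" by simp
    show ?thesis unfolding 3 Suc * start_triple so by (simp add: field_simps)
  qed
qed simp

lemma node_shift: "node n u (j + 3 ^ n) = node n u j + 1"
  unfolding node_def start_shift by (simp add: field_simps)

lemma pos_shift: "pos n u (j + 3 ^ n) r = pos n u j r + 1"
proof -
  have "j + 3 ^ n + 1 = (j + 1) + 3 ^ n" by simp
  then show ?thesis unfolding pos_def by (simp only: node_shift) (simp add: algebra_simps)
qed

lemma hgt_shift: "hgt n u (j + 3 ^ n) r = real n + u - hgt n u j r"
proof -
  have "j + 3 ^ n + 1 = (j + 1) + 3 ^ n" by simp
  then show ?thesis unfolding hgt_def by (simp only: val_shift) (simp add: algebra_simps)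
qed

lemma pos_shift_mult: "pos n u (j + int m * 3 ^ n) r = pos n u j r + real m"
proof (induction m)
  case (Suc m)
  have *: "j + int (Suc m) * 3 ^ n = (j + int m * 3 ^ n) + 3 ^ n" by (simp add: algebra_simps)
  show ?case unfolding * pos_shift Suc by simp
qed simp

lemma pos_bounds:
  assumes "0 \<le> u" "u \<le> 1" "0 \<le> r" "r \<le> 1"
  shows "node n u j \<le> pos n u j r" "pos n u j r \<le> node n u (j + 1)"
proof -
  have w: "0 \<le> node n u (j + 1) - node n u j" using node_mono_step[OF assms(1,2), of n j] by simp
  have "pos n u j r = node n u j + r * (node n u (j + 1) - node n u j)"
    unfolding pos_def by (simp add: algebra_simps)
  then show "node n u j \<le> pos n u j r" using mult_nonneg_nonneg[OF assms(3) w] by linarith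
  have "pos n u j r = node n u (j + 1) - (1 - r) * (node n u (j + 1) - node n u j)"
    unfolding pos_def by (simp add: algebra_simps)
  moreover have "0 \<le> (1 - r) * (node n u (j + 1) - node n u j)" using assms(4) w by (intro mult_nonneg_nonneg) auto
  ultimately show "pos n u j r \<le> node n u (j + 1)" by linarith
qed

lemma pos_exists:
  assumes u: "0 \<le> u" "u \<le> 1"
  obtains j r where "0 \<le> r" "r \<le> 1" "pos n u j r = x"
proof -
  have between: "\<exists>r. 0 \<le> r \<and> r \<le> 1 \<and> pos n u j r = x" if "node n u j \<le> x" "x \<le> node n u (j + 1)" for j
  proof (cases "node n u j = node n u (j + 1)")
    case True
    then show ?thesis using that by (intro exI[of _ 0]) (auto simp: pos_def)
  next
    case False
    then have w: "0 < node n u (j + 1) - node n u j" using that by simp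
    define r where "r = (x - node n u j) / (node n u (j + 1) - node n u j)"
    have "r * (node n u (j + 1) - node n u j) = x - node n u j" using w unfolding r_def by simp
    then have "pos n u j r = x" unfolding pos_def by (simp add: algebra_simps)
    moreover have "0 \<le> r" "r \<le> 1" using that w unfolding r_def by auto
    ultimately show ?thesis by blast
  qed
  have "\<exists>j. node n u j \<le> x \<and> x \<le> node n u (j + 1)"
  proof (cases n)
    case 0
    have "of_int \<lfloor>x\<rfloor> \<le> x" "x \<le> of_int (\<lfloor>x\<rfloor> + 1)" by linarith+
    then show ?thesis unfolding 0 node_0 by blast
  next
    case (Suc m)
    define i where "i = \<lfloor>3 ^ m * x\<rfloor>"
    have "of_int i \<le> 3 ^ m * x" "3 ^ m * x \<le> of_int i + 1" unfolding i_def by linarith+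
    then have "3 ^ m * node n u (3 * i) \<le> 3 ^ m * x" "3 ^ m * x \<le> 3 ^ m * node n u (3 * i + 3)"
      unfolding Suc node_triple by auto
    then have "node n u (3 * i) \<le> x" "x \<le> node n u (3 * i + 3)" by simp_all
    then consider "node n u (3 * i) \<le> x" "x \<le> node n u (3 * i + 1)"
      | "node n u (3 * i + 1) \<le> x" "x \<le> node n u (3 * i + 2)"
      | "node n u (3 * i + 2) \<le> x" "x \<le> node n u (3 * i + 3)" by linarith
    then show ?thesis
    proof cases
      case 2
      then show ?thesis by (intro exI[of _ "3 * i + 1"]) (simp add: add.assoc)
    next
      case 3
      then show ?thesis by (intro exI[of _ "3 * i + 2"]) (simp add: add.assoc)
    qed blast
  qed
  then show thesis using between that by blast
qed

lemma crest_bounds: "j \<le> crest j" "crest j \<le> j + 1" "odd (crest j)" "i \<le> j \<Longrightarrow> crest i \<le> crest j"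
  unfolding crest_def by auto presburger+

lemma hgt_le_crest:
  assumes "0 \<le> u" "u \<le> 1" "0 \<le> r" "r \<le> 1"
  shows "hgt n u j r \<le> val n u (crest j)"
proof (cases "odd j")
  case True
  have "hgt n u j r = val n u j - r * (val n u j - val n u (j + 1))" unfolding hgt_def by (simp add: algebra_simps)
  then show ?thesis using val_odd[OF assms(1,2) True] assms True unfolding crest_def by simp
next
  case False
  have "hgt n u j r = val n u (j + 1) - (1 - r) * (val n u (j + 1) - val n u j)"
    unfolding hgt_def by (simp add: algebra_simps)
  then show ?thesis using val_even[OF assms(1,2)] assms False unfolding crest_def by simp
qed

lemma trough_le_hgt:
  assumes "0 \<le> u" "u \<le> 1" "0 \<le> r" "r \<le> 1"
  shows "even j \<Longrightarrow> val n u j \<le> hgt n u j r" "odd j \<Longrightarrow> val n u (j + 1) \<le> hgt n u j r"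
proof -
  have "hgt n u j r = val n u j + r * (val n u (j + 1) - val n u j)"
    unfolding hgt_def by (simp add: algebra_simps)
  then show "even j \<Longrightarrow> val n u j \<le> hgt n u j r" using val_even[OF assms(1,2), of j n] assms(3) by simp
  have "hgt n u j r = val n u (j + 1) + (1 - r) * (val n u j - val n u (j + 1))"
    unfolding hgt_def by (simp add: algebra_simps)
  then show "odd j \<Longrightarrow> val n u (j + 1) \<le> hgt n u j r" using val_odd[OF assms(1,2), of j n] assms(4) by simp
qed

lemma pos_le_hgt:
  assumes u: "0 \<le> u" "u \<le> 1" and "a \<le> b"
  shows "scale n u * (pos n u i b - pos n u i a) \<le> 3 * \<bar>hgt n u i b - hgt n u i a\<bar>"
proof -
  have "pos n u i b - pos n u i a = (b - a) * (node n u (i + 1) - node n u i)"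
    "hgt n u i b - hgt n u i a = (b - a) * (val n u (i + 1) - val n u i)"
    unfolding pos_def hgt_def by (simp_all add: algebra_simps)
  moreover have "(b - a) * (scale n u * (node n u (i + 1) - node n u i)) \<le> (b - a) * (3 * \<bar>val n u (i + 1) - val n u i\<bar>)"
    using assms(3) by (intro mult_left_mono slope_ge u) auto
  ultimately show ?thesis using assms(3) by (simp add: abs_mult mult.left_commute)
qed

lemma val_nonneg: "0 \<le> u \<Longrightarrow> 0 \<le> val n u j"
  unfolding val_def using base_nonneg[of n j] by simp

lemma hgt_nonneg: "0 \<le> u \<Longrightarrow> 0 \<le> r \<Longrightarrow> r \<le> 1 \<Longrightarrow> 0 \<le> hgt n u j r"
  unfolding hgt_def using val_nonneg by simp

lemma label_less: "label n v k < cap k"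
proof (cases "int k < phi n v")
  case True
  obtain m l where "edge n v k = (m, l)" by fastforce
  then show ?thesis using edge_vertex(3)[OF True] colour_less True unfolding label_def by simp
next
  case False
  then show ?thesis unfolding label_def cap_def by simp
qed

lemma label_period: "label n (v + 12 * 3 ^ n) = label n v"
proof
  fix k
  have "reduce (edge n (v + 2 * 6 * 3 ^ n) k) = reduce (edge n v k)"
    unfolding edge_period reduce_def by (simp add: mult.assoc[symmetric])
  then have "colour (edge n (v + 2 * 6 * 3 ^ n) k) = colour (edge n v k)" by (metis colour_reduce)
  then show "label n (v + 12 * 3 ^ n) k = label n v k"
    unfolding label_def using phi_period[of n v 6] by simp
qed

section \<open>The coded map\<close>

locale coded_plane = code_space X d \<Lambda> pt cap
  for X :: "'p set" and d :: "'p \<Rightarrow> 'p \<Rightarrow> real" and \<Lambda> :: real and pt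
begin

definition point :: "nat \<Rightarrow> real \<Rightarrow> int \<Rightarrow> real \<Rightarrow> 'p" where
  "point n u j r = pt (label n (crest j)) (hgt n u j r)"

lemma point_in: "0 \<le> u \<Longrightarrow> 0 \<le> r \<Longrightarrow> r \<le> 1 \<Longrightarrow> point n u j r \<in> X"
  unfolding point_def by (intro pt_in hgt_nonneg)

lemma pt_same: assumes "0 \<le> h" "0 \<le> h'" shows "d (pt \<omega> h) (pt \<omega> h') \<le> \<Lambda> * \<bar>h - h'\<bar>"
proof (cases "h \<le> h'")
  case True
  then show ?thesis using pt_upper[of h h h' \<omega> \<omega>] assms by simp
next
  case False
  then show ?thesis using pt_upper[of h' h h' \<omega> \<omega>] assms by simp
qed

lemma pt_eq: assumes "0 \<le> h" "\<And>k. real k < h \<Longrightarrow> \<omega> k = \<omega>' k" shows "d (pt \<omega> h) (pt \<omega>' h) = 0"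
  using pt_upper[of h h h \<omega> \<omega>'] d_nonneg[OF pt_in pt_in, of h h \<omega> \<omega>'] assms by simp

lemma point_same_piece:
  assumes u: "0 \<le> u" "u \<le> 1" and r: "0 \<le> r" "r \<le> r'" "r' \<le> 1"
  shows "d (point n u j r) (point n u j r') \<le> 2 * \<Lambda> * scale n u * (pos n u j r' - pos n u j r)"
proof -
  have "d (point n u j r) (point n u j r') \<le> \<Lambda> * \<bar>hgt n u j r - hgt n u j r'\<bar>"
    unfolding point_def using u r by (intro pt_same hgt_nonneg) auto
  also have "hgt n u j r - hgt n u j r' = (r - r') * (val n u (j + 1) - val n u j)"
    unfolding hgt_def by (simp add: algebra_simps)
  also have "\<bar>\<dots>\<bar> = (r' - r) * \<bar>val n u (j + 1) - val n u j\<bar>" using r by (simp add: abs_mult)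
  also have "\<dots> \<le> (r' - r) * (2 * (scale n u * (node n u (j + 1) - node n u j)))"
    using r by (intro mult_left_mono slope_le u) auto
  also have "\<dots> = 2 * scale n u * (pos n u j r' - pos n u j r)" unfolding pos_def by (simp add: algebra_simps)
  finally show ?thesis using \<Lambda> by (simp add: mult_left_mono mult.assoc mult.left_commute)
qed

text \<open>The code is switched only at a minimum, where the crest jumps from \<open>j\<close> to
  \<open>j + 2\<close>. Below the height of the minimum the labels agree, by
  \<open>edge_adjacent\<close> on both sides.\<close>

lemma point_node:
  assumes u: "0 \<le> u" "u \<le> 1"
  shows "d (point n u j 1) (point n u (j + 1) 0) = 0"
proof (cases "even j")
  case True
  then show ?thesis unfolding point_def hgt_def crest_def using val_nonneg[OF u(1)] by (simp add: pt_eq)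
next
  case False
  have h: "hgt n u j 1 = val n u (j + 1)" "hgt n u (j + 1) 0 = val n u (j + 1)" unfolding hgt_def by auto
  have v: "val n u (j + 1) = of_int (phi n (j + 1))" using False unfolding val_def phi_def by simp
  have "label n j k = label n (j + 2) k" if "real k < val n u (j + 1)" for k
  proof -
    have k: "int k < phi n (j + 1)" using that unfolding v by linarith
    then have k': "int k < phi n j" "int k < phi n (j + 1 + 1)"
      using gap_odd[OF False, of n] gap_even[of "j + 1" n] False by auto
    have "edge n j k = edge n (j + 1) k" using edge_adjacent k k' by blast
    also have "\<dots> = edge n (j + 1 + 1) k" using edge_adjacent k k' by blast
    finally show ?thesis using k' unfolding label_def by (simp add: add.assoc)
  qed
  then show ?thesis using False val_nonneg[OF u(1)]
    unfolding point_def h crest_def by (auto intro!: pt_eq simp: add.assoc)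
qed

lemma point_horizontal_less:
  assumes u: "0 \<le> u" "u \<le> 1" and r: "0 \<le> r" "r \<le> 1" "0 \<le> r'" "r' \<le> 1" and "j < j'"
  shows "d (point n u j r) (point n u j' r') \<le> 2 * \<Lambda> * scale n u * (pos n u j' r' - pos n u j r)"
proof -
  have next_node: "d (point n u j r) (point n u (j + 1) 0) \<le> 2 * \<Lambda> * scale n u * (node n u (j + 1) - pos n u j r)"
    if r: "0 \<le> r" "r \<le> 1" for j r
    using point_same_piece[OF u, of r 1 n j] point_node[OF u, of n j] r u
      d_triangle[of "point n u j r" "point n u j 1" "point n u (j + 1) 0"] point_in
    by (simp add: pos_def[of n u j 1])
  have "d (point n u j r) (point n u j' 0) \<le> 2 * \<Lambda> * scale n u * (node n u j' - pos n u j r)"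
    using \<open>j < j'\<close>[unfolded zless_iff_Suc_zadd]
  proof (elim exE)
    fix m assume "j' = j + int (Suc m)"
    then show ?thesis
    proof (induction m arbitrary: j')
      case 0
      then show ?case using next_node[OF r(1,2), of j] by simp
    next
      case (Suc m)
      define l where "l = j + int (Suc m)"
      have l: "j' = l + 1" using Suc.prems unfolding l_def by simp
      have "d (point n u j r) (point n u l 0) \<le> 2 * \<Lambda> * scale n u * (node n u l - pos n u j r)"
        by (rule Suc.IH) (simp add: l_def)
      moreover have "d (point n u l 0) (point n u j' 0) \<le> 2 * \<Lambda> * scale n u * (node n u j' - node n u l)"
        using next_node[of 0 l] unfolding l by (simp add: pos_def)
      moreover have "d (point n u j r) (point n u j' 0) \<le>
          d (point n u j r) (point n u l 0) + d (point n u l 0) (point n u j' 0)"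
        using u r by (intro d_triangle point_in) auto
      ultimately show ?case by (simp add: algebra_simps)
    qed
  qed
  moreover have "d (point n u j' 0) (point n u j' r') \<le> 2 * \<Lambda> * scale n u * (pos n u j' r' - node n u j')"
    using point_same_piece[OF u, of 0 r' n j'] r by (simp add: pos_def[of n u j' 0])
  moreover have "d (point n u j r) (point n u j' r') \<le>
      d (point n u j r) (point n u j' 0) + d (point n u j' 0) (point n u j' r')"
    using u r by (intro d_triangle point_in) auto
  ultimately show ?thesis by (simp add: algebra_simps)
qed

lemma scale_nonneg: "0 \<le> u \<Longrightarrow> 0 \<le> scale n u"
  unfolding scale_def by simp

lemma point_horizontal:
  assumes u: "0 \<le> u" "u \<le> 1" and r: "0 \<le> r" "r \<le> 1" "0 \<le> r'" "r' \<le> 1"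
  shows "d (point n u j r) (point n u j' r') \<le> 2 * \<Lambda> * scale n u * \<bar>pos n u j' r' - pos n u j r\<bar>"
proof -
  have c: "0 \<le> 2 * \<Lambda> * scale n u" using \<Lambda> scale_nonneg[OF u(1)] by simp
  have sym: "d (point n u j r) (point n u j' r') = d (point n u j' r') (point n u j r)"
    using u r by (intro d_commute point_in) auto
  have "d (point n u j r) (point n u j' r') \<le> 2 * \<Lambda> * scale n u * (pos n u j' r' - pos n u j r) \<or>
    d (point n u j r) (point n u j' r') \<le> 2 * \<Lambda> * scale n u * (pos n u j r - pos n u j' r')"
  proof (cases j j' rule: linorder_cases)
    case less
    then show ?thesis using point_horizontal_less[OF u r] by blast
  next
    case equal
    then show ?thesis using point_same_piece[OF u, of r r' n j] point_same_piece[OF u, of r' r n j] r sym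
      by (cases "r \<le> r'") auto
  next
    case greater
    then show ?thesis using point_horizontal_less[OF u r(3,4,1,2)] sym by simp
  qed
  moreover have "2 * \<Lambda> * scale n u * (pos n u j' r' - pos n u j r) \<le> 2 * \<Lambda> * scale n u * \<bar>pos n u j' r' - pos n u j r\<bar>"
    using c by (rule mult_left_mono[rotated]) simp
  moreover have "2 * \<Lambda> * scale n u * (pos n u j r - pos n u j' r') \<le> 2 * \<Lambda> * scale n u * \<bar>pos n u j' r' - pos n u j r\<bar>"
    using c by (rule mult_left_mono[rotated]) simp
  ultimately show ?thesis by linarith
qed

text \<open>With the piece coordinates fixed, the code is unchanged and the height moves by at most
  \<open>\<bar>u - u'\<bar>\<close>. The nodes have moved meanwhile, and a horizontal correction
  costing at most four times this amount restores the position.\<close>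

lemma point_vertical:
  assumes u: "0 \<le> u" "u \<le> 1" "0 \<le> u'" "u' \<le> 1" and r: "0 \<le> r" "r \<le> 1" "0 \<le> r'" "r' \<le> 1"
    and eq: "pos n u j r = pos n u' j' r'"
  shows "d (point n u j r) (point n u' j' r') \<le> 5 * \<Lambda> * \<bar>u - u'\<bar>"
proof -
  have h: "hgt n u j r - hgt n u' j r = (u - u') * ((1 - r) * of_bool (odd j) + r * of_bool (even j))"
    unfolding hgt_def val_def by (cases "even j") (simp_all add: algebra_simps)
  have "\<bar>(1 - r) * of_bool (odd j) + r * of_bool (even j)\<bar> \<le> 1" using r by (cases "even j") auto
  then have "\<bar>hgt n u j r - hgt n u' j r\<bar> \<le> \<bar>u - u'\<bar>" unfolding h abs_mult by (simp add: mult_left_le)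
  then have "\<Lambda> * \<bar>hgt n u j r - hgt n u' j r\<bar> \<le> \<Lambda> * \<bar>u - u'\<bar>" using \<Lambda> by simp
  moreover have "d (point n u j r) (point n u' j r) \<le> \<Lambda> * \<bar>hgt n u j r - hgt n u' j r\<bar>"
    unfolding point_def using u r by (intro pt_same hgt_nonneg) auto
  ultimately have 1: "d (point n u j r) (point n u' j r) \<le> \<Lambda> * \<bar>u - u'\<bar>" by linarith
  have "scale n u' * \<bar>pos n u' j' r' - pos n u' j r\<bar> \<le> 2 * \<bar>u - u'\<bar>"
  proof -
    have "pos n u' j' r' - pos n u' j r = (1 - r) * (node n u j - node n u' j) + r * (node n u (j + 1) - node n u' (j + 1))"
      unfolding eq[symmetric] unfolding pos_def by (simp add: algebra_simps)
    then have "\<bar>pos n u' j' r' - pos n u' j r\<bar> \<le> \<bar>(1 - r) * (node n u j - node n u' j)\<bar> + \<bar>r * (node n u (j + 1) - node n u' (j + 1))\<bar>"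
      by (simp only: abs_triangle_ineq)
    then have "\<bar>pos n u' j' r' - pos n u' j r\<bar> \<le> (1 - r) * \<bar>node n u j - node n u' j\<bar> + r * \<bar>node n u (j + 1) - node n u' (j + 1)\<bar>"
      using r by (simp add: abs_mult)
    then have "3 ^ n * \<bar>pos n u' j' r' - pos n u' j r\<bar> \<le> 3 ^ n * ((1 - r) * \<bar>node n u j - node n u' j\<bar> + r * \<bar>node n u (j + 1) - node n u' (j + 1)\<bar>)"
      by (intro mult_left_mono) auto
    also have "\<dots> = (1 - r) * (3 ^ n * \<bar>node n u j - node n u' j\<bar>) + r * (3 ^ n * \<bar>node n u (j + 1) - node n u' (j + 1)\<bar>)"
      by (simp add: algebra_simps)
    also have "\<dots> \<le> (1 - r) * ((if n = 0 then 0 else 2) * \<bar>u - u'\<bar>) + r * ((if n = 0 then 0 else 2) * \<bar>u - u'\<bar>)"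
      using r by (intro add_mono mult_left_mono node_move) auto
    also have "\<dots> = (if n = 0 then 0 else 2) * \<bar>u - u'\<bar>" by (simp add: algebra_simps)
    finally have *: "3 ^ n * \<bar>pos n u' j' r' - pos n u' j r\<bar> \<le> (if n = 0 then 0 else 2) * \<bar>u - u'\<bar>" .
    show ?thesis
    proof (cases "n = 0")
      case True
      then show ?thesis using * by simp
    next
      case False
      then show ?thesis using * by (simp add: scale_def)
    qed
  qed
  then have "2 * \<Lambda> * (scale n u' * \<bar>pos n u' j' r' - pos n u' j r\<bar>) \<le> 2 * \<Lambda> * (2 * \<bar>u - u'\<bar>)"
    using \<Lambda> by (intro mult_left_mono) auto
  then have 2: "d (point n u' j r) (point n u' j' r') \<le> 4 * \<Lambda> * \<bar>u - u'\<bar>"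
    using point_horizontal[OF u(3,4) r, of n j j'] by (simp add: mult.assoc)
  have "d (point n u j r) (point n u' j' r') \<le> d (point n u j r) (point n u' j r) + d (point n u' j r) (point n u' j' r')"
    using u r by (intro d_triangle point_in) auto
  then show ?thesis using 1 2 by (simp add: algebra_simps)
qed

lemma crest_anc: "anc (crest (3 * i)) = crest i" "anc (crest (3 * i + 2)) = crest i"
proof -
  have "crest (3 * i) = (if odd i then 3 * i else 3 * i + 1)" "crest (3 * i + 2) = (if odd i then 3 * i + 2 else 3 * i + 3)"
    unfolding crest_def by auto
  then show "anc (crest (3 * i)) = crest i" "anc (crest (3 * i + 2)) = crest i"
    by (auto simp: anc_triple crest_def)
qed

lemma hgt_Suc_0:
  "hgt (Suc n) 0 (3 * i) r = (1 - r) * of_int (phi n i) + r * of_int (mid n i)"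
  "hgt (Suc n) 0 (3 * i + 2) r = (1 - r) * of_int (mid n i) + r * of_int (phi n (i + 1))"
proof -
  have *: "3 * i + 2 + 1 = 3 * i + 3" by simp
  show "hgt (Suc n) 0 (3 * i) r = (1 - r) * of_int (phi n i) + r * of_int (mid n i)"
    unfolding hgt_def val_triple by simp
  show "hgt (Suc n) 0 (3 * i + 2) r = (1 - r) * of_int (mid n i) + r * of_int (phi n (i + 1))"
    unfolding hgt_def * val_triple by simp
qed

lemma pos_Suc_0:
  "3 ^ n * pos (Suc n) 0 (3 * i) r = of_int i + r * split_offset n i"
  "3 ^ n * pos (Suc n) 0 (3 * i + 2) r = of_int i + split_offset n i + r * (1 - split_offset n i)"
proof -
  have *: "3 * i + 2 + 1 = 3 * i + 3" by simp
  have d: "3 ^ n * ((1 - r) * a + r * b) = (1 - r) * (3 ^ n * a) + r * (3 ^ n * b)" for a b :: real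
    by (simp add: algebra_simps)
  show "3 ^ n * pos (Suc n) 0 (3 * i) r = of_int i + r * split_offset n i"
    unfolding pos_def d node_triple by (simp add: algebra_simps)
  show "3 ^ n * pos (Suc n) 0 (3 * i + 2) r = of_int i + split_offset n i + r * (1 - split_offset n i)"
    unfolding pos_def d * node_triple by (simp add: algebra_simps)
qed

text \<open>The zigzag is the same curve before and after the subdivision, as \<open>mid\<close>
  interpolates linearly at \<open>split_offset\<close>. The middle third has length zero at birth,
  so the thirds \<open>3 * i\<close> and \<open>3 * i + 2\<close> cover the old gap, and
  \<open>anc\<close> sends their crests to its crest.\<close>

lemma point_boundary:
  assumes r: "0 \<le> r" "r \<le> 1"
  obtains j' r' where "0 \<le> r'" "r' \<le> 1" "pos (Suc n) 0 j' r' = pos n 1 i r"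
    "d (point n 1 i r) (point (Suc n) 0 j' r') = 0"
proof -
  have P: "3 ^ n * pos n 1 i r = of_int i + r" unfolding pos_def node_def by (simp add: field_simps)
  have H: "hgt n 1 i r = (1 - r) * of_int (phi n i) + r * of_int (phi n (i + 1))"
    unfolding hgt_def val_def phi_def by simp
  define \<xi> where "\<xi> = split_offset n i"
  have mid: "of_int (mid n i) = (1 - \<xi>) * of_int (phi n i) + \<xi> * (of_int (phi n (i + 1)) :: real)"
    using gap_even[of i n] gap_odd[of i n] unfolding \<xi>_def split_offset_def mid_eq wide_def
    by (cases "even i") (auto simp: field_simps)
  have "\<exists>j' r'. 0 \<le> r' \<and> r' \<le> 1 \<and> pos (Suc n) 0 j' r' = pos n 1 i r \<and> hgt (Suc n) 0 j' r' = hgt n 1 i r \<and>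
      anc (crest j') = crest i"
  proof (cases "r \<le> \<xi> \<and> \<xi> \<noteq> 0")
    case True
    then have "0 < \<xi>" using r by auto
    define r' where "r' = r / \<xi>"
    have r': "r = r' * \<xi>" "0 \<le> r'" "r' \<le> 1" using True r \<open>0 < \<xi>\<close> unfolding r'_def by auto
    have "3 ^ n * pos (Suc n) 0 (3 * i) r' = 3 ^ n * pos n 1 i r" unfolding P pos_Suc_0 using r'(1) unfolding \<xi>_def by simp
    then have "pos (Suc n) 0 (3 * i) r' = pos n 1 i r" by simp
    moreover have "hgt (Suc n) 0 (3 * i) r' = hgt n 1 i r" unfolding H hgt_Suc_0 mid by (subst r'(1), subst r'(1)) (simp add: algebra_simps)
    ultimately show ?thesis using r' crest_anc(1) by blast
  next
    case False
    then have xi: "\<xi> \<le> r" "0 < 1 - \<xi>" using r split_offset_bounds[of n i] unfolding \<xi>_def by auto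
    define r' where "r' = (r - \<xi>) / (1 - \<xi>)"
    have "r' * (1 - \<xi>) = r - \<xi>" using xi unfolding r'_def by simp
    then have r': "r = \<xi> + r' * (1 - \<xi>)" "0 \<le> r'" "r' \<le> 1" using r xi unfolding r'_def by auto
    have "3 ^ n * pos (Suc n) 0 (3 * i + 2) r' = 3 ^ n * pos n 1 i r" unfolding P pos_Suc_0 using r'(1) unfolding \<xi>_def by simp
    then have "pos (Suc n) 0 (3 * i + 2) r' = pos n 1 i r" by simp
    moreover have "hgt (Suc n) 0 (3 * i + 2) r' = hgt n 1 i r" unfolding H hgt_Suc_0 mid by (subst r'(1), subst r'(1)) (simp add: algebra_simps)
    ultimately show ?thesis using r' crest_anc(2) by blast
  qed
  then obtain j' r' where r': "0 \<le> r'" "r' \<le> 1" "pos (Suc n) 0 j' r' = pos n 1 i r"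
    "hgt (Suc n) 0 j' r' = hgt n 1 i r" "anc (crest j') = crest i" by blast
  have "d (point n 1 i r) (point (Suc n) 0 j' r') = 0"
    unfolding point_def r'(4)
  proof (rule pt_eq)
    show "0 \<le> hgt n 1 i r" using r by (intro hgt_nonneg) auto
    fix k assume k: "real k < hgt n 1 i r"
    then have "real k < val (Suc n) 0 (crest j')" using hgt_le_crest[of 0 r' "Suc n" j'] r' by simp
    then have "int k < base (Suc n) (crest j')" unfolding val_def by simp
    moreover from this have "int k < phi n (crest i)" using base_le_phi_anc[of n "crest j'"] r'(5) by simp
    ultimately show "label n (crest i) k = label (Suc n) (crest j') k"
      unfolding label_def phi_def[of "Suc n"] using r'(5) by simp
  qed
  then show thesis using that r' by blast
qed

text \<open>A positive integer \<open>H\<close> belongs to the row that ends there, with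
  \<open>u = 1\<close>; \<open>H = 0\<close> belongs to row 0.\<close>

definition row :: "real \<Rightarrow> nat" where "row H = nat (\<lceil>H\<rceil> - 1)"

lemma row: assumes "0 \<le> H" shows "0 \<le> H - real (row H)" "H - real (row H) \<le> 1"
proof -
  have "real (row H) = of_int (\<lceil>H\<rceil> - 1) \<or> H = 0 \<and> row H = 0"
    using assms unfolding row_def by (cases "1 \<le> \<lceil>H\<rceil>") auto
  moreover have "of_int \<lceil>H\<rceil> - 1 < H" "H \<le> of_int \<lceil>H\<rceil>" by linarith+
  ultimately show "0 \<le> H - real (row H)" "H - real (row H) \<le> 1" by auto
qed

text \<open>Nodes and gaps of length zero have several piece coordinates, hence the choice;
  \<open>cover_point\<close> shows that it does not matter up to distance zero.\<close>

definition cover :: "real \<Rightarrow> real \<Rightarrow> 'p" where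
  "cover x H = (let n = row H; u = H - real n;
     (j, r) = (SOME (j, r). 0 \<le> r \<and> r \<le> 1 \<and> pos n u j r = x) in point n u j r)"

lemma cover_exists:
  assumes "0 \<le> H"
  obtains j r where "0 \<le> r" "r \<le> 1" "pos (row H) (H - real (row H)) j r = x"
    "cover x H = point (row H) (H - real (row H)) j r"
proof -
  let ?P = "\<lambda>(j, r). 0 \<le> r \<and> r \<le> 1 \<and> pos (row H) (H - real (row H)) j r = x"
  obtain j r where "0 \<le> r" "r \<le> 1" "pos (row H) (H - real (row H)) j r = x"
    using pos_exists[OF row[OF assms]] by blast
  then have "\<exists>q. ?P q" by (intro exI[of _ "(j, r)"]) simp
  then have "?P (SOME q. ?P q)" by (rule someI_ex)
  then show thesis using that unfolding cover_def Let_def by (auto split: prod.splits)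
qed

lemma cover_in: assumes "0 \<le> H" shows "cover x H \<in> X"
proof -
  obtain j r where "0 \<le> r" "r \<le> 1" "cover x H = point (row H) (H - real (row H)) j r"
    using cover_exists[OF assms] by blast
  then show ?thesis using point_in row(1)[OF assms] by simp
qed

lemma cover_point:
  assumes "real n \<le> H" "H \<le> real n + 1" "0 \<le> r" "r \<le> 1" "pos n (H - real n) j r = x"
  shows "d (cover x H) (point n (H - real n) j r) = 0"
proof -
  have H: "0 \<le> H" using assms by simp
  obtain j0 r0 where 0: "0 \<le> r0" "r0 \<le> 1" "pos (row H) (H - real (row H)) j0 r0 = x"
    "cover x H = point (row H) (H - real (row H)) j0 r0" using cover_exists[OF H] by blast
  have u: "0 \<le> H - real n" "H - real n \<le> 1" using assms by auto
  have zero: "d (point n u j r) (point n u j' r') = 0"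
    if "0 \<le> u" "u \<le> 1" "0 \<le> r" "r \<le> 1" "0 \<le> r'" "r' \<le> 1" "pos n u j r = pos n u j' r'" for n u j r j' r'
    using point_horizontal[OF that(1-6), of n j j'] that d_nonneg[of "point n u j r" "point n u j' r'"] point_in by simp
  show ?thesis
  proof (cases "row H = n")
    case True
    then show ?thesis using zero[OF u 0(1,2) assms(3,4), of n j0 j] 0 assms by simp
  next
    case False
    have rH: "real (row H) \<le> H" "H \<le> real (row H) + 1" using row[OF H] by auto
    have "row H < n"
    proof (rule ccontr)
      assume "\<not> row H < n"
      then have "n + 1 \<le> row H" using False by simp
      then have "H = real (row H)" "0 < H" using rH assms by linarith+
      then show False unfolding row_def by (auto simp: nat_eq_iff2) linarith
    qed
    then have "real (row H) + 1 \<le> real n" by linarith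
    then have Hn: "H = real n" "n = Suc (row H)" using assms rH by linarith+
    have "H - real (row H) = 1" using Hn by linarith
    then have c: "cover x H = point (row H) 1 j0 r0" "pos (row H) 1 j0 r0 = x" using 0 by auto
    obtain j' r' where *: "0 \<le> r'" "r' \<le> 1" "pos (Suc (row H)) 0 j' r' = x"
      "d (point (row H) 1 j0 r0) (point (Suc (row H)) 0 j' r') = 0"
      using point_boundary[OF 0(1,2), of "row H" j0] c(2) by metis
    note * = *[folded Hn(2)]
    have u0: "H - real n = 0" using Hn(1) by simp
    have jr: "pos n 0 j r = x" using assms(5) unfolding u0 .
    have "d (point n 0 j' r') (point n 0 j r) = 0"
      by (rule zero[OF _ _ *(1,2) assms(3,4)]) (simp_all add: *(3) jr)
    moreover have "point (row H) 1 j0 r0 \<in> X" "point n 0 j' r' \<in> X" "point n 0 j r \<in> X"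
      by (intro point_in 0 * assms; simp)+
    moreover from this have "d (point (row H) 1 j0 r0) (point n 0 j r) \<le>
        d (point (row H) 1 j0 r0) (point n 0 j' r') + d (point n 0 j' r') (point n 0 j r)"
      by (intro d_triangle)
    ultimately show ?thesis using *(4) d_nonneg[of "point (row H) 1 j0 r0" "point n 0 j r"]
      unfolding u0 c(1) by simp
  qed
qed

text \<open>\<open>d\<close> is only a pseudometric here; points at distance zero may be exchanged.\<close>

lemma d_replace:
  assumes "p \<in> X" "p' \<in> X" "q \<in> X" "q' \<in> X" "d p p' = 0" "d q q' = 0"
  shows "d p q = d p' q'"
proof -
  have "d p q \<le> d p p' + d p' q" "d p' q \<le> d p' q' + d q' q" "d p' q' \<le> d p' p + d p q'" "d p q' \<le> d p q + d q q'"
    by (intro d_triangle assms)+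
  then show ?thesis using d_commute[of p p'] d_commute[of q q'] assms by simp
qed

lemma cover_horizontal:
  assumes "0 \<le> H"
  shows "d (cover x H) (cover x' H) \<le> 2 * \<Lambda> * scale (row H) (H - real (row H)) * \<bar>x - x'\<bar>"
proof -
  obtain j r where 1: "0 \<le> r" "r \<le> 1" "pos (row H) (H - real (row H)) j r = x"
    "cover x H = point (row H) (H - real (row H)) j r" using cover_exists[OF assms] by blast
  obtain j' r' where 2: "0 \<le> r'" "r' \<le> 1" "pos (row H) (H - real (row H)) j' r' = x'"
    "cover x' H = point (row H) (H - real (row H)) j' r'" using cover_exists[OF assms] by blast
  show ?thesis
    using point_horizontal[OF row[OF assms] 1(1,2) 2(1,2), of "row H" j j'] 1 2 by (simp add: abs_minus_commute)
qed

lemma cover_vertical: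
  assumes "0 \<le> H" "0 \<le> H'"
  shows "d (cover x H) (cover x H') \<le> 5 * \<Lambda> * \<bar>H - H'\<bar>"
proof -
  have le: "d (cover x H) (cover x H') \<le> 5 * \<Lambda> * (H' - H)" if "0 \<le> H" "H \<le> H'" for H H'
  proof (rule lipschitz_chain[of "\<lambda>s t. d (cover x s) (cover x t)", OF _ _ that])
    fix r s t :: real assume "0 \<le> r" "0 \<le> s" "0 \<le> t"
    then show "d (cover x r) (cover x t) \<le> d (cover x r) (cover x s) + d (cover x s) (cover x t)"
      by (intro d_triangle cover_in)
  next
    fix n :: nat and s t :: real assume st: "real n \<le> s" "s \<le> t" "t \<le> real n + 1"
    have us: "0 \<le> s - real n" "s - real n \<le> 1" and ut: "0 \<le> t - real n" "t - real n \<le> 1" using st by auto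
    obtain j r where 1: "0 \<le> r" "r \<le> 1" "pos n (s - real n) j r = x" using pos_exists[OF us] by blast
    obtain j' r' where 2: "0 \<le> r'" "r' \<le> 1" "pos n (t - real n) j' r' = x" using pos_exists[OF ut] by blast
    have "d (cover x s) (cover x t) = d (point n (s - real n) j r) (point n (t - real n) j' r')"
      by (intro d_replace cover_in point_in cover_point) (use st 1 2 in auto)
    also have "\<dots> \<le> 5 * \<Lambda> * \<bar>(s - real n) - (t - real n)\<bar>"
      by (rule point_vertical) (use us ut 1 2 in auto)
    finally show "d (cover x s) (cover x t) \<le> 5 * \<Lambda> * (t - s)" using st by simp
  qed
  show ?thesis
  proof (cases "H \<le> H'")
    case True
    then show ?thesis using le assms by simp
  next
    case False
    then show ?thesis using le[of H' H] assms d_commute[OF cover_in cover_in, of H H' x x] by simp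
  qed
qed

lemma cover_period:
  assumes "0 \<le> H" shows "d (cover (x + 12) H) (cover x H) = 0"
proof -
  let ?n = "row H" and ?u = "H - real (row H)"
  obtain j r where 1: "0 \<le> r" "r \<le> 1" "pos ?n ?u j r = x" "cover x H = point ?n ?u j r"
    using cover_exists[OF assms] by blast
  have "pos ?n ?u (j + 12 * 3 ^ ?n) r = x + 12" using pos_shift_mult[of ?n ?u j 12 r] 1(3) by simp
  then have "d (cover (x + 12) H) (point ?n ?u (j + 12 * 3 ^ ?n) r) = 0"
    using row[OF assms] 1 by (intro cover_point) auto
  moreover have "point ?n ?u (j + 12 * 3 ^ ?n) r = point ?n ?u j r"
  proof -
    have c: "crest (j + 12 * 3 ^ ?n) = crest j + 12 * 3 ^ ?n" unfolding crest_def by auto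
    have b: "val ?n ?u (i + 12 * 3 ^ ?n) = val ?n ?u i" for i
      using base_period[of ?n i 6] unfolding val_def by simp
    have "j + 12 * 3 ^ ?n + 1 = (j + 1) + 12 * 3 ^ ?n" by simp
    then have "hgt ?n ?u (j + 12 * 3 ^ ?n) r = hgt ?n ?u j r" unfolding hgt_def by (simp only: b)
    then show ?thesis unfolding point_def c label_period by simp
  qed
  ultimately show ?thesis using 1 by simp
qed

end

section \<open>Lower bounds along a circle and in the radial direction\<close>

context coded_plane begin

text \<open>Supplies the bound that \<open>same_colour_separated\<close> needs. Half a circle has
  \<open>6 * 3 ^ n\<close> grid steps, and a node is at most two steps away from its grid
  point.\<close>

lemma crest_dist:
  assumes u: "0 \<le> u" "u \<le> 1" and r: "0 \<le> r" "r \<le> 1" "0 \<le> r'" "r' \<le> 1"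
    and close: "pos n u j' r' - pos n u j r \<le> 6"
  shows "crest j' - crest j < 10 * 3 ^ n"
proof -
  have p: "node n u j \<le> pos n u j r" "pos n u j r \<le> node n u (j + 1)"
    and p': "node n u j' \<le> pos n u j' r'" "pos n u j' r' \<le> node n u (j' + 1)"
    using pos_bounds[OF u] r by auto
  have c: "crest j' \<le> j' + 1" "j \<le> crest j" by (rule crest_bounds)+
  show ?thesis
  proof (cases n)
    case 0
    then have "of_int j' \<le> pos n u j' r'" "pos n u j r \<le> of_int j + (1::real)" using p p' by (auto simp: node_0)
    then have "of_int j' - of_int j \<le> (7::real)" using close by linarith
    then have "j' - j \<le> 7" by linarith
    then show ?thesis using c 0 by simp
  next
    case (Suc m)
    note * = node_near[OF u, of n]
    have "3 ^ n * node n u j' \<le> 3 ^ n * pos n u j' r'" "3 ^ n * pos n u j r \<le> 3 ^ n * node n u (j + 1)"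
      using p p' by simp_all
    moreover have "3 ^ n * (pos n u j' r' - pos n u j r) \<le> 3 ^ n * 6" using close by (rule mult_left_mono) simp
    ultimately have "of_int j' - of_int j \<le> 3 ^ n * 6 + (5 :: real)"
      using *[of j'] *[of "j + 1"] unfolding right_diff_distrib of_int_add of_int_1 by linarith
    then have "real_of_int (j' - j) \<le> real_of_int (6 * 3 ^ n + 5)" by simp
    then have "j' - j \<le> 6 * 3 ^ n + 5" by (simp only: of_int_le_iff)
    moreover have "(3::int) \<le> 3 ^ n" unfolding Suc by simp
    ultimately show ?thesis using c by linarith
  qed
qed

text \<open>The values among which the zigzag between two points has its minimum; the heights of the
  points themselves are included for the case of no extremum between them.\<close>

definition lows :: "nat \<Rightarrow> real \<Rightarrow> int \<Rightarrow> real \<Rightarrow> int \<Rightarrow> real \<Rightarrow> real set" where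
  "lows n u j r j' r' = {hgt n u j r, hgt n u j' r'} \<union> val n u ` {l. even l \<and> j < l \<and> l \<le> j'}"

definition highs :: "nat \<Rightarrow> real \<Rightarrow> int \<Rightarrow> real \<Rightarrow> int \<Rightarrow> real \<Rightarrow> real set" where
  "highs n u j r j' r' = {hgt n u j r, hgt n u j' r'} \<union> val n u ` {l. odd l \<and> j < l \<and> l \<le> j'}"

text \<open>Either the distance in the tree is what the barrier \<open>g\<close> between the two points demands, or
  labels were confused; the colouring then forces a high ridge between the points.\<close>

lemma separation:
  assumes u: "0 \<le> u" "u \<le> 1" and r: "0 \<le> r" "r \<le> 1" "0 \<le> r'" "r' \<le> 1"
    and close: "pos n u j' r' - pos n u j r \<le> 6" and g: "g \<in> lows n u j r j' r'"
  defines "h \<equiv> hgt n u j r" and "h' \<equiv> hgt n u j' r'" and "D \<equiv> d (point n u j r) (point n u j' r')"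
  shows "\<Lambda> * (max h h' - g) \<le> D \<or>
    (\<exists>m z. 0 \<le> m \<and> \<Lambda> * (max h h' - m) \<le> D \<and> odd z \<and> j < z \<and> z \<le> j' \<and> min h h' + 2 * m \<le> val n u z)"
proof -
  have h: "0 \<le> h" "0 \<le> h'" unfolding h_def h'_def using u r by (auto intro: hgt_nonneg)
  have D: "D = d (point n u j' r') (point n u j r)"
    unfolding D_def using u r by (intro d_commute point_in) auto
  have height: "\<Lambda> * (max h h' - min h h') \<le> D"
    using pt_height[OF h, of "label n (crest j)" "label n (crest j')"]
      pt_height[OF h(2,1), of "label n (crest j')" "label n (crest j)"] D
    unfolding D_def point_def h_def h'_def by (auto simp: max_def min_def)
  have branch: "\<Lambda> * (max h h' - real k) \<le> D" if "label n (crest j) k \<noteq> label n (crest j') k" for k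
    using pt_branch[OF h label_less label_less that] pt_branch[OF h(2,1) label_less label_less that[symmetric]] D
    unfolding D_def point_def h_def h'_def by (auto simp: max_def)
  from g consider "g \<in> {h, h'}" | l where "g = val n u l" "even l" "j < l" "l \<le> j'"
    unfolding lows_def h_def h'_def by auto
  then show ?thesis
  proof cases
    case 1
    then have "max h h' - g \<le> max h h' - min h h'" by auto
    then have "\<Lambda> * (max h h' - g) \<le> \<Lambda> * (max h h' - min h h')" using \<Lambda> by simp
    then show ?thesis using height by linarith
  next
    case 2
    let ?v = "crest j" and ?v' = "crest j'"
    have g: "g = of_int (phi n l)" using 2 unfolding val_def phi_def by simp
    define G where "G = nat (phi n l)"
    have G: "g = real G" unfolding g G_def using phi_nonneg[of n l] by simp
    have vl: "?v < l" "l < ?v'"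
      using crest_bounds(1,2)[of j] crest_bounds(1,2)[of j'] crest_bounds(3)[of j] crest_bounds(3)[of j'] 2
      by (smt (verit))+
    have vv: "?v' - ?v < 10 * 3 ^ n" by (rule crest_dist[OF u r close])
    have hv: "h \<le> of_int (phi n ?v) - 1 + u" "h' \<le> of_int (phi n ?v') - 1 + u"
      using hgt_le_crest[OF u r(1,2), of n j] hgt_le_crest[OF u r(3,4), of n j'] crest_bounds(3)[of j] crest_bounds(3)[of j']
      unfolding h_def h'_def val_def phi_def by auto
    have ridge: "\<exists>z. odd z \<and> j < z \<and> z \<le> j' \<and> min h h' + 2 * (real k + 1) \<le> val n u z"
      if k: "G \<le> k" "real k < min h h'" "label n ?v k = label n ?v' k" for k
    proof -
      have "real k < of_int (phi n ?v)" "real k < of_int (phi n ?v')" using k(2) hv u by auto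
      then have kv: "int k < phi n ?v" "int k < phi n ?v'" by linarith+
      then have "colour (edge n ?v k) = colour (edge n ?v' k)" using k(3) unfolding label_def by simp
      moreover have "phi n l \<le> int k" using k(1) unfolding G_def by simp
      ultimately obtain z where z: "odd z" "?v < z" "z < ?v'" "min (phi n ?v) (phi n ?v') + 2 * (int k + 1) \<le> phi n z"
        using same_colour_separated[OF vl _ kv _ vv] by blast
      have "val n u z = of_int (phi n z) - 1 + u" using z(1) unfolding val_def phi_def by simp
      moreover have "of_int (min (phi n ?v) (phi n ?v') + 2 * (int k + 1)) \<le> (of_int (phi n z) :: real)"
        using z(4) by (simp only: of_int_le_iff)
      then have "min (of_int (phi n ?v)) (of_int (phi n ?v')) + 2 * (real k + 1) \<le> (of_int (phi n z) :: real)"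
        by (simp add: of_int_min)
      moreover have "min h h' \<le> min (of_int (phi n ?v)) (of_int (phi n ?v')) - 1 + u" using hv by auto
      ultimately have "min h h' + 2 * (real k + 1) \<le> val n u z" by linarith
      moreover have "j < z" "z \<le> j'" using z crest_bounds(1)[of j] crest_bounds(2)[of j'] by auto
      ultimately show ?thesis using z(1) by blast
    qed
    show ?thesis
    proof (cases "min h h' \<le> g")
      case True
      then have "\<Lambda> * (max h h' - g) \<le> \<Lambda> * (max h h' - min h h')" using \<Lambda> by simp
      then show ?thesis using height by linarith
    next
      case False
      show ?thesis
      proof (cases "\<exists>k\<ge>G. real k < min h h' \<and> label n ?v k \<noteq> label n ?v' k")
        case False
        \<comment> \<open>No label distinguishes the points up to the height of the lower one. The
          ridge for the last level below it has surplus at least \<open>2 * min h h'\<close>, so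
          \<open>m = min h h'\<close> works with the height estimate alone.\<close>
        define k where "k = nat (\<lceil>min h h'\<rceil> - 1)"
        have "0 < min h h'" using \<open>\<not> min h h' \<le> g\<close> G by linarith
        then have "int k = \<lceil>min h h'\<rceil> - 1" unfolding k_def by simp
        then have k: "real k < min h h'" "min h h' \<le> real k + 1" by linarith+
        then have "G \<le> k" using \<open>\<not> min h h' \<le> g\<close> G by linarith
        then obtain z where z: "odd z" "j < z" "z \<le> j'" "min h h' + 2 * (real k + 1) \<le> val n u z"
          using ridge k False by blast
        moreover have "2 * min h h' \<le> 2 * (real k + 1)" using k(2) by simp
        ultimately have "min h h' + 2 * min h h' \<le> val n u z" by (meson add_left_mono order_trans)
        then show ?thesis using z height h by (intro disjI2 exI[of _ "min h h'"] exI[of _ z]) auto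
      next
        case True
        \<comment> \<open>The first level from the barrier on where the labels differ. If it is not
          \<open>G\<close>, the level below was confused, and its ridge has surplus
          \<open>2 * k\<close>, which pays for the loss \<open>m = k\<close>.\<close>
        define k where "k = (LEAST k. G \<le> k \<and> real k < min h h' \<and> label n ?v k \<noteq> label n ?v' k)"
        have k: "G \<le> k" "real k < min h h'" "label n ?v k \<noteq> label n ?v' k"
          using LeastI_ex[of "\<lambda>k. G \<le> k \<and> real k < min h h' \<and> label n ?v k \<noteq> label n ?v' k"] True
          unfolding k_def by auto
        show ?thesis
        proof (cases "k = G")
          case True
          then show ?thesis using branch[OF k(3)] G by simp
        next
          case False
          then obtain i where i: "k = Suc i" "G \<le> i" using k(1) by (cases k) auto
          have "\<not> (G \<le> i \<and> real i < min h h' \<and> label n ?v i \<noteq> label n ?v' i)"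
            using not_less_Least[of i "\<lambda>k. G \<le> k \<and> real k < min h h' \<and> label n ?v k \<noteq> label n ?v' k"] i(1)
            unfolding k_def[symmetric] by simp
          moreover have "real i < min h h'" using k(2) i by simp
          ultimately obtain z where "odd z" "j < z" "z \<le> j'" "min h h' + 2 * (real i + 1) \<le> val n u z"
            using ridge[of i] i by blast
          then show ?thesis using branch[OF k(3)] i by (intro disjI2 exI[of _ "real k"] exI[of _ z]) auto
        qed
      qed
    qed
  qed
qed

lemma finite_lows: "finite (lows n u j r j' r')" and finite_highs: "finite (highs n u j r j' r')"
proof -
  have "finite {l. even l \<and> j < l \<and> l \<le> j'}" "finite {l. odd l \<and> j < l \<and> l \<le> j'}"
    by (rule finite_subset[of _ "{j..j'}"]; auto)+
  then show "finite (lows n u j r j' r')" "finite (highs n u j r j' r')" unfolding lows_def highs_def by auto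
qed

text \<open>\<open>separation\<close> is applied to the deepest barrier \<open>\<alpha>\<close> in
  the first coordinate and to the highest ridge \<open>\<zeta>\<close> in the second, where the
  ridge appears as the barrier \<open>H - \<zeta>\<close>.\<close>

lemma high_low_le:
  assumes u: "0 \<le> u" "u \<le> 1" and r: "0 \<le> r" "r \<le> 1" "0 \<le> r'" "r' \<le> 1"
    and close: "pos n u j' r' - pos n u j r \<le> 6"
    and y: "y \<in> lows n u j r j' r'" and z: "z \<in> highs n u j r j' r'"
  shows "\<Lambda> * (z - y) \<le> 2 * (d (point n u j r) (point n u j' r') +
    d (point n u (j + 3 ^ n) r) (point n u (j' + 3 ^ n) r'))"
proof -
  define h h' where "h = hgt n u j r" and "h' = hgt n u j' r'"
  define H where "H = real n + u"
  define \<alpha> \<zeta> where "\<alpha> = Min (lows n u j r j' r')" and "\<zeta> = Max (highs n u j r j' r')"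
  define A where "A = d (point n u j r) (point n u j' r') / \<Lambda>"
  define B where "B = d (point n u (j + 3 ^ n) r) (point n u (j' + 3 ^ n) r') / \<Lambda>"
  have \<alpha>: "\<alpha> \<in> lows n u j r j' r'" "\<And>y. y \<in> lows n u j r j' r' \<Longrightarrow> \<alpha> \<le> y"
    unfolding \<alpha>_def by (rule Min_in[OF finite_lows], simp add: lows_def) (rule Min_le[OF finite_lows])
  have \<zeta>: "\<zeta> \<in> highs n u j r j' r'" "\<And>y. y \<in> highs n u j r j' r' \<Longrightarrow> y \<le> \<zeta>"
    unfolding \<zeta>_def by (rule Max_in[OF finite_highs], simp add: highs_def) (rule Max_ge[OF finite_highs])
  have vle: "val n u l \<le> H" for l using val_nonneg[OF u(1), of n "l + 3 ^ n"] unfolding val_shift H_def by simp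
  have hle: "hgt n u j r \<le> H" "hgt n u j' r' \<le> H"
    using hgt_le_crest[OF u r(1,2), of n j] hgt_le_crest[OF u r(3,4), of n j'] vle by (meson order_trans)+
  have \<alpha>0: "0 \<le> \<alpha>" using \<alpha>(1) val_nonneg[OF u(1)] hgt_nonneg[OF u(1)] r unfolding lows_def by auto
  have \<zeta>H: "\<zeta> \<le> H" using \<zeta>(1) vle hle unfolding highs_def by auto
  have AB0: "0 \<le> A" "0 \<le> B" unfolding A_def B_def using \<Lambda> u r by (auto intro!: divide_nonneg_pos d_nonneg point_in)
  have a: "max h h' - \<alpha> \<le> A \<or> (\<exists>m. 0 \<le> m \<and> max h h' - m \<le> A \<and> min h h' + 2 * m \<le> \<zeta>)"
  proof -
    have *: "\<Lambda> * x \<le> d (point n u j r) (point n u j' r') \<longleftrightarrow> x \<le> A" for x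
      unfolding A_def using \<Lambda> by (simp add: field_simps)
    have "val n u z \<le> \<zeta>" if "odd z" "j < z" "z \<le> j'" for z using that by (intro \<zeta>(2)) (auto simp: highs_def)
    then show ?thesis using separation[OF u r close \<alpha>(1)] unfolding * h_def h'_def by (meson order_trans)
  qed
  have b: "\<zeta> - min h h' \<le> B \<or> (\<exists>m. 0 \<le> m \<and> H - min h h' - m \<le> B \<and> \<alpha> \<le> max h h' - 2 * m)"
  proof -
    have *: "\<Lambda> * x \<le> d (point n u (j + 3 ^ n) r) (point n u (j' + 3 ^ n) r') \<longleftrightarrow> x \<le> B" for x
      unfolding B_def using \<Lambda> by (simp add: field_simps)
    have close': "pos n u (j' + 3 ^ n) r' - pos n u (j + 3 ^ n) r \<le> 6" unfolding pos_shift using close by simp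
    have mem: "H - \<zeta> \<in> lows n u (j + 3 ^ n) r (j' + 3 ^ n) r'"
    proof -
      from \<zeta>(1) consider "\<zeta> = h" | "\<zeta> = h'" | l where "\<zeta> = val n u l" "odd l" "j < l" "l \<le> j'"
        unfolding highs_def h_def h'_def by auto
      then show ?thesis
      proof cases
        case 3
        then have "H - \<zeta> = val n u (l + 3 ^ n)" unfolding val_shift H_def by simp
        moreover have "l + 3 ^ n \<in> {l. even l \<and> j + 3 ^ n < l \<and> l \<le> j' + 3 ^ n}" using 3 by simp
        ultimately show ?thesis unfolding lows_def by blast
      qed (auto simp: lows_def hgt_shift H_def h_def h'_def)
    qed
    have mm: "max (H - h) (H - h') = H - min h h'" "min (H - h) (H - h') = H - max h h'" by auto
    have low: "\<alpha> \<le> H - val n u z" if "odd z" "j + 3 ^ n < z" "z \<le> j' + 3 ^ n" for z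
    proof -
      have "H - val n u z = val n u (z - 3 ^ n)" using val_shift[of n u "z - 3 ^ n"] unfolding H_def by simp
      moreover have "z - 3 ^ n \<in> {l. even l \<and> j < l \<and> l \<le> j'}" using that by auto
      ultimately show ?thesis by (intro \<alpha>(2)) (auto simp: lows_def)
    qed
    from separation[OF u r close' mem] consider "H - min h h' - (H - \<zeta>) \<le> B"
      | m z where "0 \<le> m" "H - min h h' - m \<le> B" "odd z" "j + 3 ^ n < z" "z \<le> j' + 3 ^ n"
          "H - max h h' + 2 * m \<le> val n u z"
      unfolding hgt_shift H_def[symmetric] h_def[symmetric] h'_def[symmetric] mm * by blast
    then show ?thesis
    proof cases
      case 2
      then show ?thesis using low[of z] by (intro disjI2 exI[of _ m]) auto
    qed simp
  qed
  have "\<zeta> - \<alpha> \<le> 2 * (A + B)"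
  proof -
    have le: "min h h' \<le> max h h'" by simp
    define mn mx where "mn = min h h'" and "mx = max h h'"
    \<comment> \<open>If only the first coordinate is confused, \<open>2 * m \<le> B\<close> and so
      \<open>\<zeta> \<le> A + 3 / 2 * B\<close>; the mirror case is alike. If both are, the losses
      amount to at most half of \<open>(H - mn) + mx\<close>, which gives the factor 2.\<close>
    show ?thesis using a b \<alpha>0 \<zeta>H AB0 le unfolding mn_def[symmetric] mx_def[symmetric]
      by (elim disjE exE conjE) argo+
  qed
  then have "z - y \<le> 2 * (A + B)" using \<alpha>(2)[OF y] \<zeta>(2)[OF z] by linarith
  then have "\<Lambda> * (z - y) \<le> \<Lambda> * (2 * (A + B))" using \<Lambda> by simp
  also have "\<dots> = 2 * (d (point n u j r) (point n u j' r') +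
    d (point n u (j + 3 ^ n) r) (point n u (j' + 3 ^ n) r'))"
    unfolding A_def B_def using \<Lambda> by (simp add: field_simps)
  finally show ?thesis .
qed

text \<open>Across few gaps each width is bounded by its height difference, and
  \<open>126 = 6 * 21\<close> counts them. Across many gaps the oscillation grows only like the
  logarithm of the length, whence the exponential alternative.\<close>

lemma row_lower:
  assumes u: "0 \<le> u" "u \<le> 1" and r: "0 \<le> r" "r \<le> 1" "0 \<le> r'" "r' \<le> 1" and jj: "j \<le> j'"
    and close: "pos n u j' r' - pos n u j r \<le> 6"
  defines "D \<equiv> (d (point n u j r) (point n u j' r') +
    d (point n u (j + 3 ^ n) r) (point n u (j' + 3 ^ n) r')) / \<Lambda>"
  shows "scale n u * (pos n u j' r' - pos n u j r) \<le> 126 * D \<or>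
    (\<exists>K\<ge>1. real K \<le> 2 * D \<and> scale n u * (pos n u j' r' - pos n u j r) \<le> 24 * 3 ^ K)"
proof -
  have osc: "z - y \<le> 2 * D" if "y \<in> lows n u j r j' r'" "z \<in> highs n u j r j' r'" for y z
    using high_low_le[OF u r close that] \<Lambda> unfolding D_def by (simp add: field_simps)
  have D0: "0 \<le> D" unfolding D_def using \<Lambda> u r by (auto intro!: divide_nonneg_pos add_nonneg_nonneg d_nonneg point_in)
  have s0: "0 \<le> scale n u" by (rule scale_nonneg[OF u(1)])
  have hh: "\<bar>hgt n u j' r' - hgt n u j r\<bar> \<le> 2 * D"
    using osc[of "hgt n u j r" "hgt n u j' r'"] osc[of "hgt n u j' r'" "hgt n u j r"]
    unfolding lows_def highs_def by auto
  show ?thesis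
  proof (cases "j' - j \<le> 20")
    case True
    have near: "\<bar>z - y\<bar> \<le> 2 * D" if "y \<in> lows n u j r j' r'" "z \<in> highs n u j r j' r'" "y \<le> z" for y z
      using osc[OF that(1,2)] that(3) by simp
    have "scale n u * (pos n u j' r' - pos n u j r) \<le> 126 * D"
    proof (cases "j = j'")
      case True
      show ?thesis
      proof (cases "r \<le> r'")
        case True
        then show ?thesis using pos_le_hgt[OF u True, of n j] hh D0 \<open>j = j'\<close> by auto
      next
        case False
        have "pos n u j r - pos n u j' r' = (r - r') * (node n u (j + 1) - node n u j)"
          unfolding pos_def \<open>j = j'\<close> by (simp add: algebra_simps)
        moreover have "0 \<le> \<dots>" using False node_mono_step[OF u, of n j] by (intro mult_nonneg_nonneg) auto
        ultimately have "scale n u * (pos n u j' r' - pos n u j r) \<le> 0"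
          by (intro mult_nonneg_nonpos[OF s0]) simp
        then show ?thesis using D0 by linarith
      qed
    next
      case False
      then have lt: "j < j'" using jj by simp
      have "\<bar>hgt n u j 1 - hgt n u j r\<bar> \<le> 2 * D"
        using near[of "hgt n u j r" "val n u (j + 1)"] near[of "val n u (j + 1)" "hgt n u j r"] lt
          hgt_le_crest[OF u r(1,2), of n j] trough_le_hgt[OF u r(1,2), of j n]
        by (cases "even j") (auto simp: lows_def highs_def hgt_def[of n u j 1] crest_def abs_minus_commute)
      then have fst: "scale n u * (node n u (j + 1) - pos n u j r) \<le> 6 * D"
        using pos_le_hgt[OF u r(2), of n j] unfolding pos_def[of n u j 1] by simp
      have "\<bar>hgt n u j' r' - hgt n u j' 0\<bar> \<le> 2 * D"
        using near[of "hgt n u j' r'" "val n u j'"] near[of "val n u j'" "hgt n u j' r'"] lt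
          hgt_le_crest[OF u r(3,4), of n j'] trough_le_hgt[OF u r(3,4), of j' n]
        by (cases "even j'") (auto simp: lows_def highs_def hgt_def[of n u j' 0] crest_def abs_minus_commute)
      then have lst: "scale n u * (pos n u j' r' - node n u j') \<le> 6 * D"
        using pos_le_hgt[OF u r(3), of n j'] unfolding pos_def[of n u j' 0] by simp
      have mid: "scale n u * (node n u i - node n u (j + 1)) \<le> of_int (i - (j + 1)) * (6 * D)"
        if "j + 1 \<le> i" "i \<le> j'" for i
        using that
      proof (induction rule: int_ge_induct)
        case (step i)
        have "\<bar>val n u (i + 1) - val n u i\<bar> \<le> 2 * D"
          using near[of "val n u i" "val n u (i + 1)"] near[of "val n u (i + 1)" "val n u i"] step
            val_even[OF u, of i n] val_odd[OF u, of i n]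
          by (cases "even i") (auto simp: lows_def highs_def abs_minus_commute)
        then have "scale n u * (node n u (i + 1) - node n u i) \<le> 6 * D" using slope_ge[OF u, of n i] by argo
        then show ?case using step by (simp add: algebra_simps)
      qed simp
      have "of_int (j' - (j + 1)) * (6 * D) \<le> 19 * (6 * D)"
        using True D0 by (intro mult_right_mono) auto
      moreover have "scale n u * (node n u j' - node n u (j + 1)) \<le> of_int (j' - (j + 1)) * (6 * D)"
        using mid[of j'] lt by simp
      moreover have "scale n u * (pos n u j' r' - pos n u j r) = scale n u * (node n u (j + 1) - pos n u j r) +
          scale n u * (node n u j' - node n u (j + 1)) + scale n u * (pos n u j' r' - node n u j')"
        by (simp add: algebra_simps)
      ultimately show ?thesis using fst lst by argo
    qed
    then show ?thesis by blast
  next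
    case False
    define M where "M = j' - j - 1"
    have M: "20 \<le> M" using False unfolding M_def by simp
    have p: "node n u j \<le> pos n u j r" "pos n u j r \<le> node n u (j + 1)"
      and p': "node n u j' \<le> pos n u j' r'" "pos n u j' r' \<le> node n u (j' + 1)"
      using pos_bounds[OF u] r by auto
    have n: "1 \<le> n"
    proof (rule ccontr)
      assume "\<not> 1 \<le> n"
      then have n0: "n = 0" by simp
      have "of_int j' \<le> pos n u j' r'" "pos n u j r \<le> of_int j + (1::real)" using p p' unfolding n0 node_0 by auto
      then have "of_int j' - of_int j \<le> (7::real)" using close by linarith
      then show False using False by linarith
    qed
    \<comment> \<open>The largest \<open>k\<close> here is how many rows one can go back and still
      find a whole gap in the segment. If the limit is \<open>n\<close>, the length is bounded by
      half the circle instead.\<close>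
    define S where "S = {k. k \<le> n \<and> 2 * 3 ^ k \<le> M}"
    have "finite S" "1 \<in> S" unfolding S_def using n M by auto
    define K where "K = Max S"
    have K: "K \<le> n" "2 * 3 ^ K \<le> M" "1 \<le> K"
    proof -
      have "K \<in> S" unfolding K_def using \<open>finite S\<close> \<open>1 \<in> S\<close> by (intro Max_in) auto
      then show "K \<le> n" "2 * 3 ^ K \<le> M" unfolding S_def by auto
      show "1 \<le> K" unfolding K_def by (rule Max_ge[OF \<open>finite S\<close> \<open>1 \<in> S\<close>])
    qed
    have next_K: "K = n \<or> M < 2 * 3 ^ Suc K"
    proof (rule ccontr)
      assume "\<not> ?thesis"
      then have "Suc K \<in> S" using K unfolding S_def by auto
      then show False using Max_ge[OF \<open>finite S\<close>] unfolding K_def by fastforce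
    qed
    have "2 * 3 ^ K \<le> j' - (j + 1)" using K(2) unfolding M_def by simp
    then obtain y z where yz: "j + 1 \<le> y" "y \<le> j'" "even y" "j + 1 \<le> z" "z \<le> j'" "odd z" "1 + int K \<le> phi n z - phi n y"
      by (rule segment_spread[OF _ K(1)])
    \<comment> \<open>At time \<open>u\<close> the maximum \<open>z\<close> stands at
      \<open>phi n z - 1 + u\<close>, which uses up the 1 in \<open>1 + int K\<close>.\<close>
    have "real K \<le> val n u z - val n u y"
      using yz(3,6,7) u unfolding val_def phi_def by simp
    also have "\<dots> \<le> 2 * D" by (rule osc) (use yz in \<open>auto simp: lows_def highs_def\<close>)
    finally have KD: "real K \<le> 2 * D" .
    have "scale n u * (pos n u j' r' - pos n u j r) \<le> 24 * 3 ^ K"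
    proof (cases "K = n")
      case True
      have "3 ^ n * (pos n u j' r' - pos n u j r) \<le> 3 ^ n * 6" using close by (intro mult_left_mono) auto
      then show ?thesis using True n unfolding scale_def by simp
    next
      case False
    note * = node_near[OF u, of n]
      have "3 ^ n * pos n u j' r' \<le> 3 ^ n * node n u (j' + 1)" "3 ^ n * node n u j \<le> 3 ^ n * pos n u j r"
        using p p' by simp_all
      then have "3 ^ n * (pos n u j' r' - pos n u j r) \<le> of_int (M + 6)"
        using *[of "j' + 1"] *[of j] unfolding M_def right_diff_distrib of_int_add of_int_diff of_int_1 of_int_numeral by argo
      also have "M + 6 \<le> 24 * 3 ^ K"
      proof -
        have "(1::int) \<le> 3 ^ K" by (rule one_le_power) simp
        moreover have "M < 2 * (3 * 3 ^ K)" using next_K False by simp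
        ultimately show ?thesis by linarith
      qed
      finally have "3 ^ n * (pos n u j' r' - pos n u j r) \<le> of_int (24 * 3 ^ K)" by simp
      then show ?thesis using n unfolding scale_def by simp
    qed
    then show ?thesis using KD K(3) by blast
  qed
qed

lemma cover_lower:
  assumes H: "0 \<le> H" and x: "x \<le> x'" "x' \<le> x + 6"
  defines "D \<equiv> (d (cover x H) (cover x' H) + d (cover (x + 1) H) (cover (x' + 1) H)) / \<Lambda>"
  shows "scale (row H) (H - real (row H)) * (x' - x) \<le> 126 * D \<or>
    (\<exists>K\<ge>1. real K \<le> 2 * D \<and> scale (row H) (H - real (row H)) * (x' - x) \<le> 24 * 3 ^ K)"
proof (cases "x = x'")
  case True
  have "0 \<le> D" unfolding D_def using \<Lambda> H by (auto intro!: divide_nonneg_pos add_nonneg_nonneg d_nonneg cover_in)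
  then show ?thesis using True by simp
next
  case False
  let ?n = "row H" and ?u = "H - real (row H)"
  note u = row[OF H]
  obtain j r where 1: "0 \<le> r" "r \<le> 1" "pos ?n ?u j r = x" using pos_exists[OF u] by blast
  obtain j' r' where 2: "0 \<le> r'" "r' \<le> 1" "pos ?n ?u j' r' = x'" using pos_exists[OF u] by blast
  have "j \<le> j'"
  proof (rule ccontr)
    assume "\<not> j \<le> j'"
    then have "node ?n ?u (j' + 1) \<le> node ?n ?u j" by (intro node_mono u) simp
    then have "x' \<le> x" using pos_bounds(1)[OF u 1(1,2), of ?n j] pos_bounds(2)[OF u 2(1,2), of ?n j'] 1(3) 2(3) by linarith
    then show False using False x by simp
  qed
  have c: "d (cover y H) (point ?n ?u i s) = 0" if "0 \<le> s" "s \<le> 1" "pos ?n ?u i s = y" for y i s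
    using that u by (intro cover_point) auto
  have "d (cover x H) (cover x' H) = d (point ?n ?u j r) (point ?n ?u j' r')"
    by (intro d_replace cover_in point_in c 1 2 u H)
  moreover have "d (cover (x + 1) H) (cover (x' + 1) H) = d (point ?n ?u (j + 3 ^ ?n) r) (point ?n ?u (j' + 3 ^ ?n) r')"
    by (intro d_replace cover_in point_in c 1 2 u H) (simp_all add: pos_shift 1 2)
  ultimately show ?thesis
    using row_lower[OF u 1(1,2) 2(1,2) \<open>j \<le> j'\<close>, of ?n] x unfolding D_def 1 2 by simp
qed

text \<open>The two coordinates have heights \<open>h\<close> and \<open>H - h\<close>; their sum is
  the radius, so a radial difference shows in at least one of them.\<close>

lemma cover_height:
  assumes "0 \<le> H" "0 \<le> H'"
  shows "\<Lambda> * \<bar>H - H'\<bar> \<le> d (cover x H) (cover x' H') + d (cover (x + 1) H) (cover (x' + 1) H')"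
proof -
  have ex: "\<exists>\<omega> \<omega>' h. 0 \<le> h \<and> h \<le> H \<and> d (cover x H) (pt \<omega> h) = 0 \<and> d (cover (x + 1) H) (pt \<omega>' (H - h)) = 0"
    if H: "0 \<le> H" for x H
  proof -
    let ?n = "row H" and ?u = "H - real (row H)"
    note u = row[OF H]
    obtain j r where 1: "0 \<le> r" "r \<le> 1" "pos ?n ?u j r = x" using pos_exists[OF u] by blast
    have "d (cover x H) (point ?n ?u j r) = 0" "d (cover (x + 1) H) (point ?n ?u (j + 3 ^ ?n) r) = 0"
      using u 1 by (auto intro!: cover_point simp: pos_shift)
    moreover have "0 \<le> hgt ?n ?u j r" "0 \<le> hgt ?n ?u (j + 3 ^ ?n) r" using u 1 by (auto intro!: hgt_nonneg)
    ultimately show ?thesis unfolding point_def hgt_shift by (intro exI[of _ "hgt ?n ?u j r"] exI) auto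
  qed
  obtain \<omega> \<omega>' h where 1: "0 \<le> h" "h \<le> H" "d (cover x H) (pt \<omega> h) = 0" "d (cover (x + 1) H) (pt \<omega>' (H - h)) = 0"
    using ex[OF assms(1)] by blast
  obtain \<eta> \<eta>' k where 2: "0 \<le> k" "k \<le> H'" "d (cover x' H') (pt \<eta> k) = 0" "d (cover (x' + 1) H') (pt \<eta>' (H' - k)) = 0"
    using ex[OF assms(2)] by blast
  have in_X: "pt \<omega> h \<in> X" "pt \<eta> k \<in> X" "pt \<omega>' (H - h) \<in> X" "pt \<eta>' (H' - k) \<in> X"
    using 1 2 by (auto intro!: pt_in)
  have "d (cover x H) (cover x' H') = d (pt \<omega> h) (pt \<eta> k)"
    "d (cover (x + 1) H) (cover (x' + 1) H') = d (pt \<omega>' (H - h)) (pt \<eta>' (H' - k))"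
    using assms 1 2 in_X by (auto intro!: d_replace cover_in)
  moreover have "\<Lambda> * (h - k) \<le> d (pt \<omega> h) (pt \<eta> k)" "\<Lambda> * (k - h) \<le> d (pt \<omega> h) (pt \<eta> k)"
    using pt_height[of h k \<omega> \<eta>] pt_height[of k h \<eta> \<omega>] d_commute[OF in_X(1,2)] 1 2 by auto
  moreover have "\<Lambda> * ((H - h) - (H' - k)) \<le> d (pt \<omega>' (H - h)) (pt \<eta>' (H' - k))"
    "\<Lambda> * ((H' - k) - (H - h)) \<le> d (pt \<omega>' (H - h)) (pt \<eta>' (H' - k))"
    using pt_height[of "H - h" "H' - k" \<omega>' \<eta>'] pt_height[of "H' - k" "H - h" \<eta>' \<omega>'] d_commute[OF in_X(3,4)] 1 2 by auto
  ultimately show ?thesis by (cases "H \<le> H'") (simp_all add: algebra_simps)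
qed

end

section \<open>The hyperbolic plane in polar coordinates\<close>

text \<open>With \<open>z = y / 2 \<le> pi / 4\<close>:
  \<open>sin y = 2 * sin z * cos z \<ge> 2 * z * (cos z)^2 \<ge> z\<close>.\<close>

lemma half_le_sin:
  fixes y :: real
  assumes "0 \<le> y" "y \<le> pi / 2" shows "y / 2 \<le> sin y"
proof -
  define z where "z = y / 2"
  have z: "0 \<le> z" "z \<le> pi / 4" using assms unfolding z_def by auto
  have c: "sqrt 2 / 2 \<le> cos z" using z cos_monotone_0_pi_le[of z "pi / 4"] by (simp add: cos_45)
  have s: "z * cos z \<le> sin z"
  proof (cases "z = 0")
    case False
    then have "0 < z" using z by simp
    then obtain \<xi> where \<xi>: "0 < \<xi>" "\<xi> < z" "sin z - sin 0 = (z - 0) * cos \<xi>"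
      using MVT2[of 0 z sin cos] by (auto intro: DERIV_sin)
    have "cos z \<le> cos \<xi>" using \<xi> z pi_gt_zero by (intro cos_monotone_0_pi_le) auto
    then show ?thesis using \<xi> z by (simp add: mult_left_mono)
  qed simp
  have "(sqrt 2 / 2)\<^sup>2 \<le> (cos z)\<^sup>2" using c by (intro power_mono) auto
  then have "1 / 2 \<le> (cos z)\<^sup>2" by (simp add: power_divide)
  then have "z * (1 / 2) \<le> z * (cos z)\<^sup>2" using z by (intro mult_left_mono) auto
  also have "\<dots> = (z * cos z) * cos z" by (simp add: power2_eq_square)
  also have "\<dots> \<le> sin z * cos z"
  proof (rule mult_right_mono[OF s])
    show "0 \<le> cos z" using c by (meson divide_nonneg_nonneg order_trans real_sqrt_ge_zero zero_le_numeral)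
  qed
  finally have "z / 2 \<le> sin z * cos z" by simp
  moreover have "sin y = 2 * sin z * cos z" unfolding z_def using sin_double[of "y / 2"] by simp
  ultimately show ?thesis unfolding z_def by simp
qed

lemma le_sinh: "0 \<le> x \<Longrightarrow> x \<le> sinh (x::real)"
  and sinh_le_mult_cosh: "0 \<le> x \<Longrightarrow> sinh x \<le> x * cosh (x::real)"
proof -
  assume x: "0 \<le> x"
  have "\<exists>c\<ge>0. c \<le> x \<and> sinh x = x * cosh c"
  proof (cases "x = 0")
    case False
    then have "0 < x" using x by simp
    moreover have "(sinh has_real_derivative cosh y) (at y)" for y :: real
      by (auto intro!: derivative_eq_intros)
    ultimately obtain \<xi> where "0 < \<xi>" "\<xi> < x" "sinh x - sinh 0 = (x - 0) * cosh \<xi>"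
      using MVT2[of 0 x sinh cosh] by blast
    then show ?thesis by (intro exI[of _ \<xi>]) auto
  qed auto
  then obtain c where c: "0 \<le> c" "c \<le> x" "sinh x = x * cosh c" by blast
  show "x \<le> sinh x" using c(3) mult_left_mono[OF cosh_real_ge_1[of c] x] by simp
  have "cosh c \<le> cosh x" using c by (subst cosh_real_nonneg_le_iff) auto
  then show "sinh x \<le> x * cosh x" using c(3) mult_left_mono[OF _ x] by simp
qed

lemma ln_3_bounds: "1 \<le> ln (3::real)" "ln (3::real) \<le> 2"
proof -
  show "1 \<le> ln (3::real)" using exp_le by (simp add: ln_ge_iff)
  show "ln (3::real) \<le> 2" using ln_le_minus_one[of 3] by simp
qed

text \<open>The hyperbolic law of cosines in curvature -1.\<close>

definition polar_dist :: "real \<Rightarrow> real \<Rightarrow> real \<Rightarrow> real" where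
  "polar_dist r r' \<theta> = arcosh (cosh r * cosh r' - sinh r * sinh r' * cos \<theta>)"

lemma polar_arg:
  fixes r r' :: real
  shows "cosh r * cosh r' - sinh r * sinh r' * cos \<theta> = cosh (r' - r) + sinh r * sinh r' * (1 - cos \<theta>)"
  by (simp add: cosh_diff algebra_simps)

lemma polar_arg_ge:
  fixes r r' :: real
  assumes "0 \<le> r" "0 \<le> r'"
  shows "cosh (r' - r) \<le> cosh r * cosh r' - sinh r * sinh r' * cos \<theta>" "1 \<le> cosh r * cosh r' - sinh r * sinh r' * cos \<theta>"
proof -
  have "0 \<le> sinh r * sinh r' * (1 - cos \<theta>)" using assms by (intro mult_nonneg_nonneg) auto
  then show "cosh (r' - r) \<le> cosh r * cosh r' - sinh r * sinh r' * cos \<theta>" unfolding polar_arg by simp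
  then show "1 \<le> cosh r * cosh r' - sinh r * sinh r' * cos \<theta>" using cosh_real_ge_1[of "r' - r"] by linarith
qed

lemma cosh_polar_dist:
  assumes "0 \<le> r" "0 \<le> r'"
  shows "cosh (polar_dist r r' \<theta>) = cosh (r' - r) + sinh r * sinh r' * (1 - cos \<theta>)" "0 \<le> polar_dist r r' \<theta>"
  using polar_arg_ge[OF assms, of \<theta>] unfolding polar_dist_def polar_arg[symmetric] by (simp_all add: cosh_arcosh_real)

lemma polar_dist_commute: "polar_dist r r' \<theta> = polar_dist r' r (- \<theta>)"
  unfolding polar_dist_def by (simp add: mult.commute)

lemma polar_dist_ge_radial:
  assumes "0 \<le> r" "0 \<le> r'" shows "\<bar>r' - r\<bar> \<le> polar_dist r r' \<theta>"
proof -
  have "cosh \<bar>r' - r\<bar> \<le> cosh (polar_dist r r' \<theta>)"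
    using polar_arg_ge(1)[OF assms, of \<theta>] cosh_polar_dist[OF assms, of \<theta>] unfolding polar_arg by simp
  then show ?thesis using cosh_polar_dist(2)[OF assms] by (subst (asm) cosh_real_nonneg_le_iff) auto
qed

lemma polar_dist_mono:
  assumes "0 \<le> r" "r \<le> r'" shows "polar_dist r r \<theta> \<le> polar_dist r r' \<theta>"
proof -
  have "sinh r * sinh r * (1 - cos \<theta>) \<le> sinh r * sinh r' * (1 - cos \<theta>)"
    using assms by (intro mult_right_mono mult_left_mono) auto
  then have "cosh (polar_dist r r \<theta>) \<le> cosh (polar_dist r r' \<theta>)"
    using assms cosh_real_ge_1[of "r' - r"] by (simp add: cosh_polar_dist)
  then show ?thesis using assms by (subst (asm) cosh_real_nonneg_le_iff) (auto simp: cosh_polar_dist)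
qed

lemma sinh_half_polar_dist:
  assumes "0 \<le> r" shows "sinh (polar_dist r r \<theta> / 2) = sinh r * \<bar>sin (\<theta> / 2)\<bar>"
proof -
  let ?e = "polar_dist r r \<theta>"
  have "cosh ?e = 1 + 2 * (sinh (?e / 2))\<^sup>2" using cosh_double[of "?e / 2"] cosh_square_eq[of "?e / 2"] by simp
  moreover have "1 - cos \<theta> = 2 * (sin (\<theta> / 2))\<^sup>2" using cos_double_sin[of "\<theta> / 2"] by simp
  ultimately have "2 * (sinh (?e / 2))\<^sup>2 = sinh r * sinh r * (2 * (sin (\<theta> / 2))\<^sup>2)"
    using cosh_polar_dist(1)[OF assms assms, of \<theta>] by simp
  then have "(sinh (?e / 2))\<^sup>2 = (sinh r * \<bar>sin (\<theta> / 2)\<bar>)\<^sup>2" by (simp add: power2_eq_square)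
  moreover have "0 \<le> sinh (?e / 2)" using cosh_polar_dist(2)[OF assms assms, of \<theta>] by simp
  ultimately show ?thesis using assms by (simp add: power2_eq_iff_nonneg)
qed

text \<open>The triangle inequality through the point of radius \<open>r\<close> in the second
  direction, verified on the formula. It comes down to \<open>tanh (e / 2) \<le> tanh r\<close>: a
  chord is at most the diameter.\<close>

lemma polar_dist_triangle:
  assumes "0 \<le> r" "r \<le> r'" shows "polar_dist r r' \<theta> \<le> polar_dist r r \<theta> + (r' - r)"
proof -
  define e where "e = polar_dist r r \<theta>"
  have r': "0 \<le> r'" using assms by simp
  have e0: "0 \<le> e" unfolding e_def using assms by (simp add: cosh_polar_dist)
  have ce: "cosh e = 1 + sinh r * sinh r * (1 - cos \<theta>)" unfolding e_def using assms by (simp add: cosh_polar_dist)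
  have "sinh (e / 2) \<le> sinh r"
    unfolding e_def sinh_half_polar_dist[OF assms(1)] using assms by (simp add: mult_left_le)
  then have "e / 2 \<le> r" by simp
  then have le: "sinh (e / 2) * cosh r \<le> cosh (e / 2) * sinh r"
    using sinh_diff[of r "e / 2"] sinh_real_nonneg_iff[of "r - e / 2"] by (simp add: mult.commute)
  have "(cosh e - 1) * cosh r \<le> sinh e * sinh r"
  proof -
    have "cosh e - 1 = 2 * sinh (e / 2) * sinh (e / 2)"
      using cosh_double[of "e / 2"] cosh_square_eq[of "e / 2"] by (simp add: power2_eq_square)
    moreover have "sinh e = 2 * sinh (e / 2) * cosh (e / 2)" using sinh_double[of "e / 2"] by simp
    moreover have "2 * sinh (e / 2) * (sinh (e / 2) * cosh r) \<le> 2 * sinh (e / 2) * (cosh (e / 2) * sinh r)"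
      using le e0 by (intro mult_left_mono) auto
    ultimately show ?thesis by (simp add: mult.assoc)
  qed
  then have "sinh (r' - r) * ((cosh e - 1) * cosh r) \<le> sinh (r' - r) * (sinh e * sinh r)"
    using assms by (intro mult_left_mono) auto
  moreover have "sinh r' = sinh r * cosh (r' - r) + cosh r * sinh (r' - r)"
    using sinh_add[of r "r' - r"] by simp
  \<comment> \<open>The claim multiplied by \<open>sinh r\<close>, so that the addition formula for
    \<open>sinh r'\<close> can be used; \<open>r = 0\<close> is treated apart when the factor is
    cancelled.\<close>
  ultimately have "sinh r * (cosh (r' - r) + sinh r * sinh r' * (1 - cos \<theta>)) \<le> sinh r * cosh (e + (r' - r))"
  proof -
    assume a: "sinh (r' - r) * ((cosh e - 1) * cosh r) \<le> sinh (r' - r) * (sinh e * sinh r)"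
      and b: "sinh r' = sinh r * cosh (r' - r) + cosh r * sinh (r' - r)"
    have "sinh r * (cosh (r' - r) + sinh r * sinh r' * (1 - cos \<theta>)) = sinh r * cosh (r' - r) + sinh r' * (cosh e - 1)"
      unfolding ce by (simp add: algebra_simps)
    also have "\<dots> = sinh r * (cosh e * cosh (r' - r)) + sinh (r' - r) * ((cosh e - 1) * cosh r)"
      unfolding b by (simp add: algebra_simps)
    also have "\<dots> \<le> sinh r * (cosh e * cosh (r' - r)) + sinh (r' - r) * (sinh e * sinh r)" using a by simp
    also have "\<dots> = sinh r * cosh (e + (r' - r))" unfolding cosh_add by (simp add: algebra_simps)
    finally show ?thesis .
  qed
  then have "cosh (r' - r) + sinh r * sinh r' * (1 - cos \<theta>) \<le> cosh (e + (r' - r))"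
  proof (cases "r = 0")
    case True
    then have "e = 0" using ce e0 cosh_real_one_iff[of e] by simp
    then show ?thesis using True by simp
  next
    case False
    then have "0 < sinh r" using assms by simp
    assume "sinh r * (cosh (r' - r) + sinh r * sinh r' * (1 - cos \<theta>)) \<le> sinh r * cosh (e + (r' - r))"
    then show ?thesis using \<open>0 < sinh r\<close> by (simp only: mult_le_cancel_left_pos)
  qed
  then have "cosh (polar_dist r r' \<theta>) \<le> cosh (e + (r' - r))" unfolding cosh_polar_dist(1)[OF assms(1) r'] .
  then show ?thesis using assms e0 unfolding e_def[symmetric]
    by (subst (asm) cosh_real_nonneg_le_iff) (auto simp: cosh_polar_dist)
qed

lemma sinh_exp_bounds:
  assumes "0 \<le> (x::real)" shows "sinh x \<le> exp x / 2" "1 \<le> sinh x \<Longrightarrow> exp x \<le> 3 * sinh x"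
proof -
  show "sinh x \<le> exp x / 2" unfolding sinh_def by simp
  have "cosh x \<le> sinh x + 1"
  proof (rule power2_le_imp_le)
    show "(cosh x)\<^sup>2 \<le> (sinh x + 1)\<^sup>2" unfolding cosh_square_eq using assms by (simp add: power2_eq_square algebra_simps)
    show "0 \<le> sinh x + 1" using assms by (simp add: add_nonneg_nonneg)
  qed
  then show "exp x \<le> 3 * sinh x" if "1 \<le> sinh x" using that cosh_plus_sinh[of x] by linarith
qed

text \<open>\<open>t = sinh (e / 2)\<close> mediates between the arc
  \<open>sinh r * \<bar>\<theta>\<bar>\<close>, with which it is comparable, and the distance
  \<open>e\<close>, which is of order \<open>t\<close> for small \<open>t\<close> and close to
  \<open>2 * ln t\<close> for large \<open>t\<close>.\<close>

lemma polar_dist_of_chord: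
  assumes r: "0 \<le> r" and \<theta>: "\<bar>\<theta>\<bar> \<le> pi"
  defines "e \<equiv> polar_dist r r \<theta>"
  obtains t where "0 \<le> t" "sinh r * \<bar>\<theta>\<bar> \<le> 4 * t" "2 * t \<le> sinh r * \<bar>\<theta>\<bar>" "t \<le> sinh r" "e \<le> 2 * t"
    "t \<le> 1 \<Longrightarrow> t \<le> e" "1 < t \<Longrightarrow> 2 * ln t + 1 \<le> e" "1 < t \<Longrightarrow> e \<le> 2 * ln (3 * t)"
proof -
  define t where "t = sinh (e / 2)"
  have e0: "0 \<le> e" unfolding e_def using r by (simp add: cosh_polar_dist)
  have t: "t = sinh r * \<bar>sin (\<theta> / 2)\<bar>" unfolding t_def e_def by (rule sinh_half_polar_dist[OF r])
  have s0: "0 \<le> sinh r" using r by simp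
  have abs_sin: "\<bar>sin (\<theta> / 2)\<bar> = sin (\<bar>\<theta>\<bar> / 2)"
  proof -
    have "0 \<le> sin (\<bar>\<theta>\<bar> / 2)" using \<theta> by (intro sin_ge_zero) auto
    then show ?thesis by (cases "0 \<le> \<theta>") auto
  qed
  have "\<bar>\<theta>\<bar> / 2 / 2 \<le> sin (\<bar>\<theta>\<bar> / 2)" using \<theta> by (intro half_le_sin) auto
  moreover have "sin (\<bar>\<theta>\<bar> / 2) \<le> \<bar>\<theta>\<bar> / 2" by (rule sin_x_le_x) simp
  ultimately have b: "\<bar>\<theta>\<bar> \<le> 4 * \<bar>sin (\<theta> / 2)\<bar>" "2 * \<bar>sin (\<theta> / 2)\<bar> \<le> \<bar>\<theta>\<bar>" unfolding abs_sin by auto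
  show thesis
  proof (rule that)
    show t0: "0 \<le> t" unfolding t_def using e0 by simp
    show "sinh r * \<bar>\<theta>\<bar> \<le> 4 * t" using mult_left_mono[OF b(1) s0] unfolding t by (simp add: algebra_simps)
    show "2 * t \<le> sinh r * \<bar>\<theta>\<bar>" using mult_left_mono[OF b(2) s0] unfolding t by (simp add: algebra_simps)
    show "t \<le> sinh r" unfolding t using s0 by (simp add: mult_left_le)
    show "e \<le> 2 * t" unfolding t_def using le_sinh[of "e / 2"] e0 by simp
    show "t \<le> e" if "t \<le> 1"
    proof -
      have "e / 2 \<le> 1" using le_sinh[of "e / 2"] e0 that unfolding t_def by simp
      then have "cosh (e / 2) \<le> cosh 1" using e0 by (subst cosh_real_nonneg_le_iff) auto
      also have "cosh (1::real) \<le> 2"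
      proof -
        have "exp (1::real) \<le> 3" by (rule exp_le)
        moreover have "exp (- 1::real) \<le> 1" by simp
        moreover have "cosh (1::real) = (exp 1 + exp (- 1)) / 2" by (simp add: cosh_field_def)
        ultimately show ?thesis by argo
      qed
      finally have "e / 2 * cosh (e / 2) \<le> e / 2 * 2" using e0 by (intro mult_left_mono) auto
      then show ?thesis using sinh_le_mult_cosh[of "e / 2"] e0 unfolding t_def by simp
    qed
    show "2 * ln t + 1 \<le> e" if "1 < t"
    proof -
      have "2 * t \<le> exp (e / 2)" using sinh_exp_bounds(1)[of "e / 2"] e0 unfolding t_def by simp
      then have "ln (2 * t) \<le> ln (exp (e / 2))" using that by (intro ln_mono) auto
      then have "ln (2 * t) \<le> e / 2" by simp
      moreover have "1 / 2 \<le> ln (2::real)"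
      proof -
        have "(exp (1 / 2))\<^sup>2 \<le> (2::real)\<^sup>2" using exp_le by (simp add: exp_double[symmetric])
        then have "exp (1 / 2) \<le> (2::real)" by (rule power2_le_imp_le) simp
        then show ?thesis by (subst ln_ge_iff) simp_all
      qed
      ultimately show ?thesis using that by (simp add: ln_mult)
    qed
    show "e \<le> 2 * ln (3 * t)" if "1 < t"
    proof -
      have "exp (e / 2) \<le> 3 * t" using sinh_exp_bounds(2)[of "e / 2"] e0 that unfolding t_def by simp
      then have "e / 2 \<le> ln (3 * t)" using that by (subst ln_ge_iff) simp_all
      then show ?thesis by simp
    qed
  qed
qed

section \<open>Comparison of the coded map with the polar metric\<close>

context coded_plane begin

text \<open>The unit \<open>ln 3\<close> of the radius is chosen so that the length of a large
  circle roughly triples with each row, as the grid does.\<close>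

lemma scale_sinh:
  assumes H: "0 \<le> H"
  shows "scale (row H) (H - real (row H)) \<le> 3 * sinh (H * ln 3)"
    and "sinh (H * ln 3) \<le> 4 * scale (row H) (H - real (row H))"
proof -
  define n where "n = row H"
  note r = row[OF H, folded n_def]
  have l: "0 \<le> H * ln 3" using H by simp
  have "scale n (H - real n) \<le> 3 * sinh (H * ln 3) \<and> sinh (H * ln 3) \<le> 4 * scale n (H - real n)"
  proof (cases "n = 0")
    case True
    have H1: "H \<le> 1" using r True by simp
    have "H * 1 \<le> H * ln 3" using H ln_3_bounds by (intro mult_left_mono) auto
    then have 1: "H \<le> sinh (H * ln 3)" using le_sinh[OF l] by linarith
    have "cosh (H * ln 3) \<le> cosh (ln 3)"
      using H H1 by (subst cosh_real_nonneg_le_iff) (auto simp: mult_le_cancel_right1)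
    also have "cosh (ln 3) = (5 / 3 :: real)" by (simp add: cosh_ln_real)
    finally have "H * ln 3 * cosh (H * ln 3) \<le> H * 2 * 2"
      using H ln_3_bounds by (intro mult_mono) (auto intro: mult_left_mono)
    then have 2: "sinh (H * ln 3) \<le> H * 4" using sinh_le_mult_cosh[OF l] by simp
    show ?thesis using 1 2 H True unfolding scale_def by simp
  next
    case False
    then have nH: "real n \<le> H" "1 \<le> H" using r by auto
    have n3: "exp (real n * ln 3) = (3::real) ^ n" by (simp add: exp_of_nat_mult)
    have "real n * ln 3 \<le> H * ln 3" using nH by (intro mult_right_mono) auto
    then have e1: "3 ^ n \<le> exp (H * ln 3)" unfolding n3[symmetric] by simp
    have "H * ln 3 \<le> (real n + 1) * ln 3" using r by (intro mult_right_mono) auto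
    then have "exp (H * ln 3) \<le> exp ((real n + 1) * ln 3)" by simp
    also have "\<dots> = 3 ^ n * 3" by (simp add: distrib_right exp_add n3)
    finally have e2: "exp (H * ln 3) \<le> 3 ^ n * 3" .
    have "(3::real) = 3 ^ 1" by simp
    also have "\<dots> \<le> 3 ^ n" using False by (intro power_increasing) auto
    finally have three: "3 \<le> exp (H * ln 3)" using e1 by linarith
    have "exp (- (H * ln 3)) = 1 / exp (H * ln 3)" by (simp add: exp_minus divide_inverse)
    also have "\<dots> \<le> 1 / 3" using three by (intro divide_left_mono) auto
    finally have em: "exp (- (H * ln 3)) \<le> 1 / 3" .
    have s: "sinh (H * ln 3) = (exp (H * ln 3) - exp (- (H * ln 3))) / 2" by (simp add: sinh_field_def)
    have sc: "scale n (H - real n) = 3 ^ n" using False unfolding scale_def by simp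
    define a b where "a = exp (H * ln 3)" and "b = exp (- (H * ln 3))"
    have "0 < b" unfolding b_def by simp
    then show ?thesis using em three e1 e2 unfolding s sc a_def[symmetric] b_def[symmetric] by argo
  qed
  then show "scale (row H) (H - real (row H)) \<le> 3 * sinh (H * ln 3)"
    "sinh (H * ln 3) \<le> 4 * scale (row H) (H - real (row H))" unfolding n_def by auto
qed

definition height_of :: "real \<Rightarrow> real" where "height_of r = r / ln 3"

lemma height_of: "0 \<le> r \<Longrightarrow> 0 \<le> height_of r" "height_of r * ln 3 = r"
  "\<bar>height_of r - height_of r'\<bar> \<le> \<bar>r - r'\<bar>" "\<bar>r - r'\<bar> \<le> 2 * \<bar>height_of r - height_of r'\<bar>"
proof -
  show "0 \<le> r \<Longrightarrow> 0 \<le> height_of r" unfolding height_of_def by simp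
  show *: "height_of r * ln 3 = r" unfolding height_of_def by simp
  have d: "\<bar>r - r'\<bar> = \<bar>height_of r - height_of r'\<bar> * ln 3"
    unfolding height_of_def by (simp add: diff_divide_distrib[symmetric])
  show "\<bar>height_of r - height_of r'\<bar> \<le> \<bar>r - r'\<bar>"
    unfolding d using mult_left_mono[OF ln_3_bounds(1), of "\<bar>height_of r - height_of r'\<bar>"] by simp
  show "\<bar>r - r'\<bar> \<le> 2 * \<bar>height_of r - height_of r'\<bar>"
    unfolding d using mult_left_mono[OF ln_3_bounds(2), of "\<bar>height_of r - height_of r'\<bar>"] by simp
qed

definition angle :: "real \<Rightarrow> real" where "angle x = pi * x / 6"

lemma angle_bounds: "\<bar>angle x\<bar> \<le> \<bar>x\<bar>" "\<bar>x\<bar> \<le> 3 * \<bar>angle x\<bar>" "\<bar>x\<bar> \<le> 6 \<Longrightarrow> \<bar>angle x\<bar> \<le> pi"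
proof -
  have a: "\<bar>angle x\<bar> = pi * \<bar>x\<bar> / 6" unfolding angle_def by (simp add: abs_mult)
  have "pi * \<bar>x\<bar> \<le> 6 * \<bar>x\<bar>" using pi_less_4 by (intro mult_right_mono) auto
  then show "\<bar>angle x\<bar> \<le> \<bar>x\<bar>" unfolding a by simp
  have "2 * \<bar>x\<bar> \<le> pi * \<bar>x\<bar>" using pi_ge_two by (intro mult_right_mono) auto
  then show "\<bar>x\<bar> \<le> 3 * \<bar>angle x\<bar>" unfolding a by simp
  show "\<bar>angle x\<bar> \<le> pi" if "\<bar>x\<bar> \<le> 6" unfolding a using mult_left_mono[OF that, of pi] by simp
qed

text \<open>To join two points of the same circle at large distance, both move towards the origin until
  their distance along the circle is bounded.\<close>

lemma cover_circle_upper: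
  assumes r: "0 \<le> r" and x: "\<bar>x - x'\<bar> \<le> 6"
  shows "d (cover x (height_of r)) (cover x' (height_of r)) \<le> 108 * \<Lambda> * polar_dist r r (angle (x - x'))"
proof -
  define \<theta> where "\<theta> = angle (x - x')"
  define e where "e = polar_dist r r \<theta>"
  define H where "H = height_of r"
  have H: "0 \<le> H" "H * ln 3 = r" unfolding H_def using height_of r by auto
  have th: "\<bar>\<theta>\<bar> \<le> pi" "\<bar>x - x'\<bar> \<le> 3 * \<bar>\<theta>\<bar>" unfolding \<theta>_def using angle_bounds x by auto
  obtain t where t: "0 \<le> t" "sinh r * \<bar>\<theta>\<bar> \<le> 4 * t" "2 * t \<le> sinh r * \<bar>\<theta>\<bar>" "t \<le> sinh r" "e \<le> 2 * t"
    "t \<le> 1 \<Longrightarrow> t \<le> e" "1 < t \<Longrightarrow> 2 * ln t + 1 \<le> e" "1 < t \<Longrightarrow> e \<le> 2 * ln (3 * t)"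
    using polar_dist_of_chord[OF r th(1)] unfolding e_def by blast
  have horizontal: "d (cover x G) (cover x' G) \<le> 18 * \<Lambda> * (sinh (G * ln 3) * \<bar>\<theta>\<bar>)" if G: "0 \<le> G" for G
  proof -
    have "0 \<le> scale (row G) (G - real (row G))" using scale_nonneg row(1)[OF G] .
    then have "scale (row G) (G - real (row G)) * \<bar>x - x'\<bar> \<le> 3 * sinh (G * ln 3) * (3 * \<bar>\<theta>\<bar>)"
      using scale_sinh(1)[OF G] th(2) G by (intro mult_mono) auto
    then have "2 * \<Lambda> * (scale (row G) (G - real (row G)) * \<bar>x - x'\<bar>) \<le> 2 * \<Lambda> * (3 * sinh (G * ln 3) * (3 * \<bar>\<theta>\<bar>))"
      using \<Lambda> by (intro mult_left_mono) auto
    moreover have "2 * \<Lambda> * (3 * sinh (G * ln 3) * (3 * \<bar>\<theta>\<bar>)) = 18 * \<Lambda> * (sinh (G * ln 3) * \<bar>\<theta>\<bar>)" by simp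
    ultimately show ?thesis using cover_horizontal[OF G, of x x'] by (simp only: mult.assoc)
  qed
  have "d (cover x H) (cover x' H) \<le> 108 * \<Lambda> * e"
  proof (cases "t \<le> 1")
    case True
    have "d (cover x H) (cover x' H) \<le> 18 * \<Lambda> * (sinh r * \<bar>\<theta>\<bar>)" using horizontal[OF H(1)] unfolding H(2) .
    also have "\<dots> \<le> 18 * \<Lambda> * (4 * e)" using \<Lambda> t(2) t(6)[OF True] by (intro mult_left_mono) auto
    also have "\<dots> \<le> 108 * \<Lambda> * e" using \<Lambda> cosh_polar_dist(2)[OF r r, of \<theta>] unfolding e_def by simp
    finally show ?thesis .
  next
    case False
    then have t1: "1 < t" by simp
    have s1: "1 < sinh r" using t1 t(4) by linarith
    have "t \<le> exp r" using t(4) sinh_exp_bounds(1)[OF r] exp_gt_zero[of r] by linarith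
    then have "ln t \<le> r" using t1 by (metis exp_gt_zero ln_exp ln_mono zero_less_one less_trans)
    \<comment> \<open>Going inwards by \<open>ln t\<close> shortens the arc by a factor of about
      \<open>t\<close>, hence to bounded length, at a cost controlled by
      \<open>2 * ln t + 1 \<le> e\<close>.\<close>
    define r2 where "r2 = r - ln t"
    have r2: "0 \<le> r2" unfolding r2_def using \<open>ln t \<le> r\<close> by simp
    define G where "G = height_of r2"
    have G: "0 \<le> G" "G * ln 3 = r2" unfolding G_def using height_of r2 by auto
    have HG: "\<bar>H - G\<bar> \<le> ln t" using height_of(3)[of r r2] t1 unfolding H_def G_def r2_def by simp
    have "sinh r2 * \<bar>\<theta>\<bar> \<le> 6"
    proof -
      have "sinh r2 \<le> exp r2 / 2" by (rule sinh_exp_bounds(1)[OF r2])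
      also have "exp r2 = exp r / t" unfolding r2_def using t1 by (simp add: exp_diff)
      also have "exp r / t / 2 \<le> 3 * sinh r / t / 2"
        using sinh_exp_bounds(2)[OF r] s1 t1 by (intro divide_right_mono) auto
      finally have "sinh r2 * \<bar>\<theta>\<bar> \<le> 3 * sinh r / t / 2 * \<bar>\<theta>\<bar>" by (rule mult_right_mono) simp
      also have "\<dots> = 3 / (2 * t) * (sinh r * \<bar>\<theta>\<bar>)" by simp
      also have "\<dots> \<le> 3 / (2 * t) * (4 * t)" using t(2) t1 by (intro mult_left_mono) auto
      also have "\<dots> = 6" using t1 by simp
      finally show ?thesis .
    qed
    then have "18 * \<Lambda> * (sinh r2 * \<bar>\<theta>\<bar>) \<le> 18 * \<Lambda> * 6" using \<Lambda> by (intro mult_left_mono) auto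
    then have 1: "d (cover x G) (cover x' G) \<le> 108 * \<Lambda>" using horizontal[OF G(1)] unfolding G(2) by argo
    have "5 * \<Lambda> * \<bar>H - G\<bar> \<le> 5 * \<Lambda> * ln t" using HG \<Lambda> by simp
    then have 2: "d (cover x H) (cover x G) \<le> 5 * \<Lambda> * ln t" "d (cover x' G) (cover x' H) \<le> 5 * \<Lambda> * ln t"
      using cover_vertical[OF H(1) G(1), of x] cover_vertical[OF G(1) H(1), of x'] by (simp_all add: abs_minus_commute)
    have "d (cover x H) (cover x' H) \<le> d (cover x H) (cover x G) + d (cover x G) (cover x' H)"
      "d (cover x G) (cover x' H) \<le> d (cover x G) (cover x' G) + d (cover x' G) (cover x' H)"
      using H G by (auto intro!: d_triangle cover_in)
    then have "d (cover x H) (cover x' H) \<le> \<Lambda> * (108 + 10 * ln t)" using 1 2 by (simp add: algebra_simps)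
    also have "\<dots> \<le> \<Lambda> * (108 * e)"
    proof -
      have "0 \<le> ln t" using t1 by simp
      then have "108 + 10 * ln t \<le> 108 * (2 * ln t + 1)" by simp
      also have "\<dots> \<le> 108 * e" using t(7)[OF t1] by simp
      finally show ?thesis using \<Lambda> by (intro mult_left_mono) auto
    qed
    finally show ?thesis by simp
  qed
  then show ?thesis unfolding H_def e_def \<theta>_def .
qed

text \<open>The alternatives of \<open>cover_lower\<close> give a linear and a logarithmic bound.
  The constant comes from the linear one: \<open>t \<le> 2 * 126 * D\<close> and
  \<open>e \<le> 2 * t\<close>.\<close>

lemma cover_circle_lower:
  assumes r: "0 \<le> r" and x: "\<bar>x - x'\<bar> \<le> 6"
  defines "H \<equiv> height_of r"
  shows "\<Lambda> * polar_dist r r (angle (x - x')) \<le>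
    504 * (d (cover x H) (cover x' H) + d (cover (x + 1) H) (cover (x' + 1) H))"
proof -
  have H: "0 \<le> H" "H * ln 3 = r" unfolding H_def using height_of r by auto
  have main: "\<Lambda> * polar_dist r r \<theta> \<le>
      504 * (d (cover x H) (cover x' H) + d (cover (x + 1) H) (cover (x' + 1) H))"
    if x: "x \<le> x'" "x' \<le> x + 6" and \<theta>: "\<bar>\<theta>\<bar> \<le> x' - x" "\<bar>\<theta>\<bar> \<le> pi" for x x' \<theta>
  proof -
    define e where "e = polar_dist r r \<theta>"
    define D where "D = (d (cover x H) (cover x' H) + d (cover (x + 1) H) (cover (x' + 1) H)) / \<Lambda>"
    obtain t where t: "0 \<le> t" "sinh r * \<bar>\<theta>\<bar> \<le> 4 * t" "2 * t \<le> sinh r * \<bar>\<theta>\<bar>" "t \<le> sinh r" "e \<le> 2 * t"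
      "t \<le> 1 \<Longrightarrow> t \<le> e" "1 < t \<Longrightarrow> 2 * ln t + 1 \<le> e" "1 < t \<Longrightarrow> e \<le> 2 * ln (3 * t)"
      using polar_dist_of_chord[OF r \<theta>(2)] unfolding e_def by blast
    define s where "s = scale (row H) (H - real (row H))"
    have s0: "0 \<le> s" unfolding s_def using scale_nonneg row(1)[OF H(1)] .
    have "sinh r * \<bar>\<theta>\<bar> \<le> (4 * s) * (x' - x)"
      using scale_sinh(2)[OF H(1)] \<theta>(1) s0 r unfolding H(2) s_def[symmetric] by (intro mult_mono) auto
    then have ts: "t \<le> 2 * (s * (x' - x))" using t(3) by simp
    have "e \<le> 504 * D"
      using cover_lower[OF H(1) x] unfolding D_def[symmetric] s_def[symmetric]
    proof (elim disjE exE conjE)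
      assume "s * (x' - x) \<le> 126 * D"
      then show ?thesis using ts t(5) by argo
    next
      fix K :: nat assume K: "1 \<le> K" "real K \<le> 2 * D" "s * (x' - x) \<le> 24 * 3 ^ K"
      show ?thesis
      proof (cases "t \<le> 1")
        case True
        have "1 \<le> 2 * D" using K by linarith
        then show ?thesis using True t(5) by argo
      next
        case False
        then have t1: "1 < t" by simp
        \<comment> \<open>The factor 144 is below \<open>3 ^ 6\<close>, and \<open>1 \<le> K\<close>
          later absorbs the added 6 into a multiple of \<open>K\<close>.\<close>
        have "3 * t \<le> 3 * (48 * 3 ^ K)" using ts K(3) by argo
        also have "\<dots> \<le> 3 ^ (K + 6)" by (simp add: power_add)
        finally have "3 * t \<le> 3 ^ (K + 6)" .
        then have "ln (3 * t) \<le> ln (3 ^ (K + 6))" using t1 by simp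
        also have "\<dots> = real (K + 6) * ln 3" by (rule ln_realpow)
        also have "\<dots> \<le> real (K + 6) * 2" by (intro mult_left_mono ln_3_bounds) simp
        also have "\<dots> \<le> 14 * real K" using K(1) by simp
        finally have "e \<le> 28 * real K" using t(8)[OF t1] by simp
        then show ?thesis using K(1,2) by simp
      qed
    qed
    then show ?thesis unfolding e_def D_def using \<Lambda> by (simp add: field_simps)
  qed
  have th: "\<bar>angle (x - x')\<bar> \<le> \<bar>x - x'\<bar>" "\<bar>angle (x - x')\<bar> \<le> pi" using angle_bounds x by auto
  show ?thesis
  proof (cases "x \<le> x'")
    case True
    then show ?thesis using main[of x x' "angle (x - x')"] th x by simp
  next
    case False
    have "d (cover x H) (cover x' H) = d (cover x' H) (cover x H)"
      "d (cover (x + 1) H) (cover (x' + 1) H) = d (cover (x' + 1) H) (cover (x + 1) H)"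
      using H by (auto intro!: d_commute cover_in)
    then show ?thesis using main[of x' x "angle (x - x')"] th x False by simp
  qed
qed

definition plane_dist :: "real \<Rightarrow> real \<Rightarrow> real \<Rightarrow> real \<Rightarrow> real" where
  "plane_dist x r x' r' = d (cover x (height_of r)) (cover x' (height_of r')) +
     d (cover (x + 1) (height_of r)) (cover (x' + 1) (height_of r'))"

text \<open>Both distances are compared with those on the smaller of the two circles, plus the
  radial difference. The constants are \<open>226 = 2 * 108 + 10\<close> and
  \<open>5546 = 504 * 11 + 2\<close>.\<close>

lemma plane_dist_near:
  assumes r: "0 \<le> r" "0 \<le> r'" and x: "\<bar>x - x'\<bar> \<le> 6"
  shows "plane_dist x r x' r' \<le> 226 * \<Lambda> * polar_dist r r' (angle (x - x'))"
    "\<Lambda> * polar_dist r r' (angle (x - x')) \<le> 5546 * plane_dist x r x' r'"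
proof -
  have main: "plane_dist x r x' r' \<le> 226 * \<Lambda> * polar_dist r r' (angle (x - x')) \<and>
      \<Lambda> * polar_dist r r' (angle (x - x')) \<le> 5546 * plane_dist x r x' r'"
    if r: "0 \<le> r" "r \<le> r'" and x: "\<bar>x - x'\<bar> \<le> 6" for x x' r r'
  proof -
    define H H' where "H = height_of r" and "H' = height_of r'"
    define \<delta> e where "\<delta> = polar_dist r r' (angle (x - x'))" and "e = polar_dist r r (angle (x - x'))"
    have H: "0 \<le> H" "0 \<le> H'" unfolding H_def H'_def using height_of(1) r by auto
    have gap: "\<bar>H - H'\<bar> \<le> r' - r" "r' - r \<le> 2 * \<bar>H - H'\<bar>"
      using height_of(3,4)[of r r'] r unfolding H_def H'_def by auto
    have \<delta>: "e \<le> \<delta>" "r' - r \<le> \<delta>" "\<delta> \<le> e + (r' - r)"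
      unfolding \<delta>_def e_def using polar_dist_mono[OF r] polar_dist_ge_radial[of r r' "angle (x - x')"]
        polar_dist_triangle[OF r] r by auto
    define S where "S = plane_dist x r x' r'"
    define S0 where "S0 = d (cover x H) (cover x' H) + d (cover (x + 1) H) (cover (x' + 1) H)"
    have vert: "d (cover y H) (cover y H') \<le> 5 * \<Lambda> * \<bar>H - H'\<bar>" for y using cover_vertical[OF H] .
    have cov: "cover y H \<in> X" "cover y H' \<in> X" for y using cover_in H by auto
    have tri: "d (cover y H) (cover y' H') \<le> d (cover y H) (cover y' H) + 5 * \<Lambda> * \<bar>H - H'\<bar>"
      "d (cover y H) (cover y' H) \<le> d (cover y H) (cover y' H') + 5 * \<Lambda> * \<bar>H - H'\<bar>" for y y'
      using d_triangle[OF cov(1)[of y] cov(1)[of y'] cov(2)[of y']] d_triangle[OF cov(1)[of y] cov(2)[of y'] cov(1)[of y']]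
        d_commute[OF cov(1)[of y'] cov(2)[of y']] vert[of y'] by linarith+
    have S: "S \<le> S0 + 10 * \<Lambda> * \<bar>H - H'\<bar>" "S0 \<le> S + 10 * \<Lambda> * \<bar>H - H'\<bar>"
      using tri(1)[of x x'] tri(1)[of "x + 1" "x' + 1"] tri(2)[of x x'] tri(2)[of "x + 1" "x' + 1"]
      unfolding S_def S0_def plane_dist_def H_def[symmetric] H'_def[symmetric] by (simp_all add: algebra_simps)
    have S0_upper: "S0 \<le> 216 * \<Lambda> * e"
      using cover_circle_upper[OF r(1) x] cover_circle_upper[OF r(1), of "x + 1" "x' + 1"] x
      unfolding S0_def e_def H_def by simp
    have S0_lower: "\<Lambda> * e \<le> 504 * S0" using cover_circle_lower[OF r(1) x] unfolding S0_def e_def H_def .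
    have S_height: "\<Lambda> * \<bar>H - H'\<bar> \<le> S"
      using cover_height[OF H] unfolding S_def plane_dist_def H_def H'_def .
    have "\<Lambda> * \<bar>H - H'\<bar> \<le> \<Lambda> * \<delta>" using gap \<delta> \<Lambda> by (intro mult_left_mono) auto
    moreover have "\<Lambda> * e \<le> \<Lambda> * \<delta>" using \<delta> \<Lambda> by (intro mult_left_mono) auto
    ultimately have 1: "S \<le> 226 * \<Lambda> * \<delta>" using S(1) S0_upper by argo
    have "\<Lambda> * \<delta> \<le> \<Lambda> * (e + 2 * \<bar>H - H'\<bar>)" using gap \<delta> \<Lambda> by (intro mult_left_mono) auto
    also have "\<dots> = \<Lambda> * e + 2 * (\<Lambda> * \<bar>H - H'\<bar>)" by (simp add: algebra_simps)
    finally have 2: "\<Lambda> * \<delta> \<le> 5546 * S" using S0_lower S(2) S_height by argo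
    show ?thesis using 1 2 unfolding S_def \<delta>_def by blast
  qed
  have "plane_dist x r x' r' \<le> 226 * \<Lambda> * polar_dist r r' (angle (x - x')) \<and>
      \<Lambda> * polar_dist r r' (angle (x - x')) \<le> 5546 * plane_dist x r x' r'"
  proof (cases "r \<le> r'")
    case True
    then show ?thesis using main r x by blast
  next
    case False
    have "plane_dist x r x' r' = plane_dist x' r' x r"
      unfolding plane_dist_def using r by (simp add: d_commute cover_in height_of)
    moreover have "polar_dist r r' (angle (x - x')) = polar_dist r' r (angle (x' - x))"
      using polar_dist_commute[of r r' "angle (x - x')"] by (simp add: angle_def algebra_simps diff_divide_distrib)
    ultimately show ?thesis using main[of r' r x' x] r x False by (simp add: abs_minus_commute)
  qed
  then show "plane_dist x r x' r' \<le> 226 * \<Lambda> * polar_dist r r' (angle (x - x'))"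
    "\<Lambda> * polar_dist r r' (angle (x - x')) \<le> 5546 * plane_dist x r x' r'" by auto
qed

lemma plane_dist_period:
  assumes r: "0 \<le> r" "0 \<le> r'"
  shows "plane_dist x r (x' + 12) r' = plane_dist x r x' r'"
    "polar_dist r r' (angle (x - (x' + 12))) = polar_dist r r' (angle (x - x'))"
proof -
  have H: "0 \<le> height_of r" "0 \<le> height_of r'" using height_of(1) r by auto
  have self: "d (cover y (height_of r)) (cover y (height_of r)) = 0" for y
    using cover_vertical[OF H(1,1), of y] d_nonneg[OF cover_in cover_in, OF H(1,1), of y y] by simp
  have "d (cover y (height_of r)) (cover (y' + 12) (height_of r')) = d (cover y (height_of r)) (cover y' (height_of r'))" for y y'
    by (intro d_replace cover_in cover_period self H)
  from this[of x x'] this[of "x + 1" "x' + 1"] show "plane_dist x r (x' + 12) r' = plane_dist x r x' r'"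
    unfolding plane_dist_def by (simp add: algebra_simps)
  have "angle (x - (x' + 12)) = angle (x - x') - 2 * pi" unfolding angle_def by (simp add: field_simps)
  then have "cos (angle (x - (x' + 12))) = cos (angle (x - x'))" by (simp add: cos_diff)
  then show "polar_dist r r' (angle (x - (x' + 12))) = polar_dist r r' (angle (x - x'))"
    unfolding polar_dist_def by simp
qed

text \<open>Directions lie in an interval of length 12, so a single full turn brings their
  difference to at most half a circle.\<close>

lemma plane_dist_bilipschitz:
  assumes r: "0 \<le> r" "0 \<le> r'" and x: "\<bar>x - x'\<bar> \<le> 12"
  shows "plane_dist x r x' r' \<le> 226 * \<Lambda> * polar_dist r r' (angle (x - x'))"
    "\<Lambda> * polar_dist r r' (angle (x - x')) \<le> 5546 * plane_dist x r x' r'"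
proof -
  consider "\<bar>x - x'\<bar> \<le> 6" | "\<bar>x - (x' + 12)\<bar> \<le> 6" | "\<bar>x - (x' - 12)\<bar> \<le> 6" using x by linarith
  then have "plane_dist x r x' r' \<le> 226 * \<Lambda> * polar_dist r r' (angle (x - x')) \<and>
    \<Lambda> * polar_dist r r' (angle (x - x')) \<le> 5546 * plane_dist x r x' r'"
  proof cases
    case 1
    then show ?thesis using plane_dist_near[OF r] by blast
  next
    case 2
    from plane_dist_near[OF r 2] show ?thesis unfolding plane_dist_period[OF r] by blast
  next
    case 3
    from plane_dist_near[OF r 3] show ?thesis using plane_dist_period[OF r, of x "x' - 12"] by simp
  qed
  then show "plane_dist x r x' r' \<le> 226 * \<Lambda> * polar_dist r r' (angle (x - x'))"
    "\<Lambda> * polar_dist r r' (angle (x - x')) \<le> 5546 * plane_dist x r x' r'" by auto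
qed

end

section \<open>Hyperbolic space and products of hyperbolic planes\<close>

text \<open>Superadditivity of \<open>cosh - 1\<close>: the surplus for two summands is
  \<open>(cosh a - 1) * (cosh b - 1) + sinh a * sinh b\<close>.\<close>

lemma cosh_sum_ge:
  fixes a :: "'i \<Rightarrow> real"
  assumes "finite I" "\<And>i. i \<in> I \<Longrightarrow> 0 \<le> a i"
  shows "(\<Sum>i\<in>I. cosh (a i) - 1) \<le> cosh (\<Sum>i\<in>I. a i) - 1"
  using assms
proof (induction I rule: finite_induct)
  case (insert j I)
  let ?s = "\<Sum>i\<in>I. a i"
  have s: "0 \<le> ?s" "0 \<le> a j" using insert by (auto intro: sum_nonneg)
  have "0 \<le> (cosh (a j) - 1) * (cosh ?s - 1)" "0 \<le> sinh (a j) * sinh ?s"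
    using s cosh_real_ge_1[of "a j"] cosh_real_ge_1[of ?s] by (auto intro: mult_nonneg_nonneg)
  then have "(cosh (a j) - 1) + (cosh ?s - 1) \<le> cosh (a j + ?s) - 1"
    unfolding cosh_add by (simp add: algebra_simps)
  moreover have "(\<Sum>i\<in>I. cosh (a i) - 1) \<le> cosh ?s - 1" using insert by auto
  ultimately show ?case using insert.hyps by simp
qed simp

text \<open>Horospherical coordinates: \<open>1 / horo n x\<close> is the height of \<open>x\<close> in the upper half-space model
  and \<open>x k / horo n x\<close> are the horizontal coordinates.\<close>

definition horo :: "nat \<Rightarrow> (nat \<Rightarrow> real) \<Rightarrow> real" where
  "horo n x = x 0 - x n"

text \<open>The half-plane formula \<open>cosh d = 1 + |p - q|^2 / (2 * t * t')\<close> for points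
  at heights \<open>t\<close> and \<open>t'\<close>.\<close>

definition plane_cosh :: "nat \<Rightarrow> nat \<Rightarrow> (nat \<Rightarrow> real) \<Rightarrow> (nat \<Rightarrow> real) \<Rightarrow> real" where
  "plane_cosh n k x y = 1 + horo n x * horo n y / 2 *
     ((x k / horo n x - y k / horo n y)\<^sup>2 + (1 / horo n x - 1 / horo n y)\<^sup>2)"

text \<open>The hyperboloid coordinates of the projection of \<open>x\<close> to the half-plane spanned by the
  \<open>k\<close>-th horizontal direction.\<close>

definition plane_time :: "nat \<Rightarrow> nat \<Rightarrow> (nat \<Rightarrow> real) \<Rightarrow> real" where
  "plane_time n k x = (horo n x + ((x k)\<^sup>2 + 1) / horo n x) / 2"

definition plane_space :: "nat \<Rightarrow> nat \<Rightarrow> (nat \<Rightarrow> real) \<Rightarrow> complex" where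
  "plane_space n k x = Complex (x k) ((((x k)\<^sup>2 + 1) / horo n x - horo n x) / 2)"

definition plane_radius :: "nat \<Rightarrow> nat \<Rightarrow> (nat \<Rightarrow> real) \<Rightarrow> real" where
  "plane_radius n k x = arcosh (plane_time n k x)"

definition plane_direction :: "nat \<Rightarrow> nat \<Rightarrow> (nat \<Rightarrow> real) \<Rightarrow> real" where
  "plane_direction n k x = 6 * Arg (plane_space n k x) / pi"

lemma hyperbolic_space_sum:
  assumes "n \<ge> 2" "x \<in> hyperbolic_space n"
  shows "(x 0)\<^sup>2 = 1 + (\<Sum>k = 1..n - 1. (x k)\<^sup>2) + (x n)\<^sup>2"
proof -
  have "{1..n} = insert n {1..n - 1}" using assms(1) by auto
  then have "lorentz_form n x x = (x n * x n + (\<Sum>k = 1..n - 1. x k * x k)) - x 0 * x 0"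
    unfolding lorentz_form_def using assms(1) by simp
  then show ?thesis using assms(2) unfolding hyperbolic_space_def by (simp add: power2_eq_square)
qed

lemma horo_pos:
  assumes "n \<ge> 2" "x \<in> hyperbolic_space n" shows "0 < horo n x"
proof -
  have "0 \<le> (\<Sum>k = 1..n - 1. (x k)\<^sup>2)" by (rule sum_nonneg) simp
  then have "(x n)\<^sup>2 < (x 0)\<^sup>2" using hyperbolic_space_sum[OF assms] by simp
  moreover have "0 < x 0" using assms(2) unfolding hyperbolic_space_def by simp
  ultimately have "x n < x 0" using power2_less_imp_less[of "x n" "x 0"] by simp
  then show ?thesis unfolding horo_def by simp
qed

text \<open>The half-space formula in dimension \<open>n\<close>. Its horizontal part is a sum of
  one square per direction, which is what separates the planes.\<close>

lemma lorentz_form_planes: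
  assumes n: "n \<ge> 2" and x: "x \<in> hyperbolic_space n" and y: "y \<in> hyperbolic_space n"
  shows "- lorentz_form n x y = 1 + horo n x * horo n y / 2 *
     ((\<Sum>k = 1..n - 1. (x k / horo n x - y k / horo n y)\<^sup>2) + (1 / horo n x - 1 / horo n y)\<^sup>2)"
proof -
  define v w where "v = horo n x" and "w = horo n y"
  have vw: "0 < v" "0 < w" unfolding v_def w_def using horo_pos n x y by auto
  define A B C where "A = (\<Sum>k = 1..n - 1. (x k)\<^sup>2)" and "B = (\<Sum>k = 1..n - 1. (y k)\<^sup>2)"
    and "C = (\<Sum>k = 1..n - 1. x k * y k)"
  have "v * (x 0 + x n) = 1 + A" using hyperbolic_space_sum[OF n x]
    unfolding v_def horo_def A_def by (simp add: power2_eq_square algebra_simps)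
  then have xs: "x 0 + x n = (1 + A) / v" using vw by (simp add: field_simps)
  have "w * (y 0 + y n) = 1 + B" using hyperbolic_space_sum[OF n y]
    unfolding w_def horo_def B_def by (simp add: power2_eq_square algebra_simps)
  then have ys: "y 0 + y n = (1 + B) / w" using vw by (simp add: field_simps)
  have "{1..n} = insert n {1..n - 1}" using n by auto
  then have "- lorentz_form n x y = x 0 * y 0 - x n * y n - C"
    unfolding lorentz_form_def C_def using n by simp
  also have "x 0 * y 0 - x n * y n = (v * (y 0 + y n) + (x 0 + x n) * w) / 2"
    unfolding v_def w_def horo_def by (simp add: algebra_simps)
  also have "\<dots> = (v * (1 + B) / w + (1 + A) * w / v) / 2" unfolding xs ys by simp
  finally have lhs: "- lorentz_form n x y = (v * (1 + B) / w + (1 + A) * w / v) / 2 - C" .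
  have "(\<Sum>k = 1..n - 1. (x k / v - y k / w)\<^sup>2) = (\<Sum>k = 1..n - 1. (x k)\<^sup>2 / v\<^sup>2 + (y k)\<^sup>2 / w\<^sup>2 - 2 * (x k * y k) / (v * w))"
    using vw by (intro sum.cong) (auto simp: power2_eq_square field_simps)
  also have "\<dots> = A / v\<^sup>2 + B / w\<^sup>2 - 2 * C / (v * w)"
    unfolding A_def B_def C_def by (simp add: sum.distrib sum_subtractf sum_divide_distrib sum_distrib_left)
  finally have sum: "(\<Sum>k = 1..n - 1. (x k / v - y k / w)\<^sup>2) = A / v\<^sup>2 + B / w\<^sup>2 - 2 * C / (v * w)" .
  show ?thesis unfolding lhs v_def[symmetric] w_def[symmetric] sum
    using vw by (simp add: field_simps power2_eq_square)
qed

lemma plane_cosh_ge_1: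
  assumes "n \<ge> 2" "x \<in> hyperbolic_space n" "y \<in> hyperbolic_space n"
  shows "1 \<le> plane_cosh n k x y"
  unfolding plane_cosh_def using horo_pos[OF assms(1,2)] horo_pos[OF assms(1,3)] by simp

text \<open>A single plane keeps one horizontal square and the vertical one; all planes together
  count the vertical square \<open>n - 1\<close> times. The second comparison passes from
  \<open>cosh\<close> to distances by \<open>cosh_sum_ge\<close>.\<close>

lemma hyperbolic_dist_planes:
  assumes n: "n \<ge> 2" and x: "x \<in> hyperbolic_space n" and y: "y \<in> hyperbolic_space n"
  shows "k \<in> {1..n - 1} \<Longrightarrow> arcosh (plane_cosh n k x y) \<le> hyperbolic_dist n x y"
    "hyperbolic_dist n x y \<le> (\<Sum>k = 1..n - 1. arcosh (plane_cosh n k x y))"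
proof -
  define c where "c = horo n x * horo n y / 2"
  define s where "s k = (x k / horo n x - y k / horo n y)\<^sup>2" for k
  define q where "q = (1 / horo n x - 1 / horo n y)\<^sup>2"
  have c0: "0 \<le> c" unfolding c_def using horo_pos[OF n x] horo_pos[OF n y] by simp
  have q0: "0 \<le> q" "\<And>k. 0 \<le> s k" unfolding q_def s_def by simp_all
  have D: "- lorentz_form n x y = 1 + c * ((\<Sum>k = 1..n - 1. s k) + q)"
    unfolding c_def s_def q_def by (rule lorentz_form_planes[OF n x y])
  have P: "plane_cosh n k x y = 1 + c * (s k + q)" for k unfolding plane_cosh_def c_def s_def q_def ..
  have P1: "1 \<le> plane_cosh n k x y" for k using plane_cosh_ge_1[OF n x y] .
  show "arcosh (plane_cosh n k x y) \<le> hyperbolic_dist n x y" if k: "k \<in> {1..n - 1}"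
  proof -
    have "s k \<le> (\<Sum>k = 1..n - 1. s k)" using k q0 by (intro member_le_sum) auto
    then have "plane_cosh n k x y \<le> - lorentz_form n x y"
      unfolding D P using c0 by (simp add: mult_left_mono)
    then show ?thesis unfolding hyperbolic_dist_def using P1[of k]
      by (metis arcosh_real_strict_mono less_eq_real_def)
  qed
  have D1: "1 \<le> - lorentz_form n x y" unfolding D using c0 q0 by (simp add: sum_nonneg add_nonneg_nonneg)
  have "q \<le> (\<Sum>k = 1..n - 1. q)"
    using n q0 member_le_sum[of 1 "{1..n - 1}" "\<lambda>k. q"] by simp
  then have "- lorentz_form n x y - 1 \<le> c * ((\<Sum>k = 1..n - 1. s k) + (\<Sum>k = 1..n - 1. q))"
    unfolding D using c0 by (simp add: mult_left_mono)
  also have "\<dots> = (\<Sum>k = 1..n - 1. cosh (arcosh (plane_cosh n k x y)) - 1)"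
    using P1 by (simp add: P sum.distrib sum_distrib_left distrib_left)
  also have "\<dots> \<le> cosh (\<Sum>k = 1..n - 1. arcosh (plane_cosh n k x y)) - 1"
    using P1 by (intro cosh_sum_ge) auto
  finally have "cosh (hyperbolic_dist n x y) \<le> cosh (\<Sum>k = 1..n - 1. arcosh (plane_cosh n k x y))"
    unfolding hyperbolic_dist_def using D1 by simp
  then show "hyperbolic_dist n x y \<le> (\<Sum>k = 1..n - 1. arcosh (plane_cosh n k x y))"
    using P1 D1 unfolding hyperbolic_dist_def by (subst (asm) cosh_real_nonneg_le_iff) (auto intro!: sum_nonneg)
qed

lemma plane_time:
  assumes "n \<ge> 2" "x \<in> hyperbolic_space n"
  shows "1 \<le> plane_time n k x" "sinh (plane_radius n k x) = cmod (plane_space n k x)"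
proof -
  define w where "w = horo n x"
  have w: "0 < w" unfolding w_def by (rule horo_pos[OF assms])
  have "0 \<le> (w - 1)\<^sup>2 + (x k)\<^sup>2" by simp
  then have "2 * w \<le> w * w + ((x k)\<^sup>2 + 1)" by (simp add: power2_eq_square algebra_simps)
  then show t: "1 \<le> plane_time n k x" unfolding plane_time_def w_def[symmetric] using w by (simp add: field_simps)
  have "(plane_time n k x)\<^sup>2 - 1 = (x k)\<^sup>2 + ((((x k)\<^sup>2 + 1) / w - w) / 2)\<^sup>2"
    unfolding plane_time_def w_def[symmetric] using w by (simp add: field_simps power2_eq_square)
  then show "sinh (plane_radius n k x) = cmod (plane_space n k x)"
    unfolding plane_radius_def sinh_arcosh_real[OF t] plane_space_def w_def[symmetric] cmod_def by simp
qed

text \<open>Radius and argument are polar coordinates on the hyperboloid of the plane, where the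
  Lorentz form turns into the law of cosines.\<close>

lemma plane_cosh_polar:
  assumes n: "n \<ge> 2" and x: "x \<in> hyperbolic_space n" and y: "y \<in> hyperbolic_space n"
  shows "arcosh (plane_cosh n k x y) = polar_dist (plane_radius n k x) (plane_radius n k y)
    (Arg (plane_space n k x) - Arg (plane_space n k y))"
proof -
  define v w where "v = horo n x" and "w = horo n y"
  have vw: "0 < v" "0 < w" unfolding v_def w_def using horo_pos n x y by auto
  let ?z = "plane_space n k x" and ?z' = "plane_space n k y"
  have re: "Re z = cmod z * cos (Arg z)" "Im z = cmod z * sin (Arg z)" for z
    using rcis_cmod_Arg[of z] by (metis Re_rcis, metis Im_rcis)
  have "cmod ?z * cmod ?z' * cos (Arg ?z - Arg ?z') = Re ?z * Re ?z' + Im ?z * Im ?z'"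
    unfolding re[of ?z] re[of ?z'] cos_diff by (simp add: algebra_simps)
  moreover have "cosh (plane_radius n k x) = plane_time n k x" "cosh (plane_radius n k y) = plane_time n k y"
    unfolding plane_radius_def using plane_time(1)[OF n x] plane_time(1)[OF n y] by auto
  moreover have "plane_time n k x * plane_time n k y - (Re ?z * Re ?z' + Im ?z * Im ?z') = plane_cosh n k x y"
    unfolding plane_time_def plane_space_def plane_cosh_def v_def[symmetric] w_def[symmetric]
    using vw by (simp add: field_simps power2_eq_square)
  ultimately show ?thesis unfolding polar_dist_def plane_time(2)[OF n x] plane_time(2)[OF n y] by simp
qed

lemma sum_pairs:
  fixes m :: nat
  shows "(\<Sum>i < 2 * m. f i) = (\<Sum>k < m. f (2 * k) + f (2 * k + 1) :: real)"
  by (induction m) auto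

section \<open>The embedding of hyperbolic space\<close>

context coded_plane begin

text \<open>The summand \<open>of_bool (odd i)\<close> is the turn by one unit that yields the
  complementary coordinate of the same plane.\<close>

definition embedding :: "nat \<Rightarrow> (nat \<Rightarrow> real) \<Rightarrow> nat \<Rightarrow> 'p" where
  "embedding n x = (\<lambda>i\<in>{..<2 * (n - 1)}.
     cover (plane_direction n (i div 2 + 1) x + of_bool (odd i)) (height_of (plane_radius n (i div 2 + 1) x)))"

lemma embedding_bilipschitz:
  assumes n: "n \<ge> 2"
  shows "bilipschitz_embedding (hyperbolic_space n) (hyperbolic_dist n)
    (power_space (2 * (n - 1)) X) (l1_power_dist (2 * (n - 1)) d) (embedding n)"
proof -
  define S where "S x y = l1_power_dist (2 * (n - 1)) d (embedding n x) (embedding n y)" for x y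
  define P where "P k x y = plane_dist (plane_direction n k x) (plane_radius n k x) (plane_direction n k y) (plane_radius n k y)" for k x y
  have rad: "0 \<le> plane_radius n k x" if "x \<in> hyperbolic_space n" for k x
    unfolding plane_radius_def using plane_time(1)[OF n that] by simp
  have S: "S x y = (\<Sum>k = 1..n - 1. P k x y)" for x y
  proof -
    have "S x y = (\<Sum>k < n - 1. P (k + 1) x y)"
      unfolding S_def l1_power_dist_def sum_pairs
      by (intro sum.cong) (auto simp: embedding_def P_def plane_dist_def)
    also have "\<dots> = (\<Sum>k = 1..n - 1. P k x y)"
      by (rule sum.reindex_bij_witness[of _ "\<lambda>k. k - 1" "\<lambda>k. k + 1"]) auto
    finally show ?thesis .
  qed
  define \<delta> where "\<delta> k x y = arcosh (plane_cosh n k x y)" for k x y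
  have P: "P k x y \<le> 226 * \<Lambda> * \<delta> k x y" "\<Lambda> * \<delta> k x y \<le> 5546 * P k x y"
    if x: "x \<in> hyperbolic_space n" and y: "y \<in> hyperbolic_space n" for k x y
  proof -
    let ?a = "plane_direction n k x" and ?b = "plane_direction n k y"
    have dir: "\<bar>plane_direction n k x\<bar> \<le> 6" for x
    proof -
      have "\<bar>Arg (plane_space n k x)\<bar> \<le> pi" using Arg_bounded[of "plane_space n k x"] by auto
      then show ?thesis unfolding plane_direction_def by (simp add: abs_mult field_simps)
    qed
    have near: "\<bar>?a - ?b\<bar> \<le> 12" using dir[of x] dir[of y] by linarith
    have ang: "angle (?a - ?b) = Arg (plane_space n k x) - Arg (plane_space n k y)"
      unfolding angle_def plane_direction_def by (simp add: field_simps)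
    show "P k x y \<le> 226 * \<Lambda> * \<delta> k x y" "\<Lambda> * \<delta> k x y \<le> 5546 * P k x y"
      using plane_dist_bilipschitz[OF rad[OF x, of k] rad[OF y, of k] near]
      unfolding P_def \<delta>_def plane_cosh_polar[OF n x y] ang by auto
  qed
  have upper: "S x y \<le> 226 * \<Lambda> * real (n - 1) * hyperbolic_dist n x y"
    and lower: "\<Lambda> * hyperbolic_dist n x y \<le> 5546 * S x y"
    if x: "x \<in> hyperbolic_space n" and y: "y \<in> hyperbolic_space n" for x y
  proof -
    have "S x y \<le> (\<Sum>k = 1..n - 1. 226 * \<Lambda> * hyperbolic_dist n x y)"
      unfolding S
    proof (rule sum_mono)
      fix k assume "k \<in> {1..n - 1}"
      then have "226 * \<Lambda> * \<delta> k x y \<le> 226 * \<Lambda> * hyperbolic_dist n x y"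
        using hyperbolic_dist_planes(1)[OF n x y, of k] \<Lambda> unfolding \<delta>_def by (intro mult_left_mono) auto
      then show "P k x y \<le> 226 * \<Lambda> * hyperbolic_dist n x y" using P(1)[OF x y, of k] by linarith
    qed
    then show "S x y \<le> 226 * \<Lambda> * real (n - 1) * hyperbolic_dist n x y" by (simp add: algebra_simps)
    have "\<Lambda> * hyperbolic_dist n x y \<le> \<Lambda> * (\<Sum>k = 1..n - 1. \<delta> k x y)"
      using hyperbolic_dist_planes(2)[OF n x y] \<Lambda> unfolding \<delta>_def by (intro mult_left_mono) auto
    also have "\<dots> \<le> 5546 * S x y" unfolding S sum_distrib_left using P(2)[OF x y] by (intro sum_mono)
    finally show "\<Lambda> * hyperbolic_dist n x y \<le> 5546 * S x y" .
  qed
  define L where "L = max 1 (max (226 * \<Lambda> * real (n - 1)) (5546 / \<Lambda>))"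
  have L: "1 \<le> L" "226 * \<Lambda> * real (n - 1) \<le> L" "5546 / \<Lambda> \<le> L" unfolding L_def by auto
  have bounds: "inverse L * hyperbolic_dist n x y \<le> S x y \<and> S x y \<le> L * hyperbolic_dist n x y"
    if x: "x \<in> hyperbolic_space n" and y: "y \<in> hyperbolic_space n" for x y
  proof
    have "0 \<le> arcosh (plane_cosh n 1 x y)" using plane_cosh_ge_1[OF n x y, of 1] by simp
    moreover have "1 \<in> {1..n - 1}" using n by simp
    ultimately have D: "0 \<le> hyperbolic_dist n x y"
      using hyperbolic_dist_planes(1)[OF n x y, of 1] by linarith
    have "226 * \<Lambda> * real (n - 1) * hyperbolic_dist n x y \<le> L * hyperbolic_dist n x y"
      using L(2) D by (rule mult_right_mono)
    then show "S x y \<le> L * hyperbolic_dist n x y" using upper[OF x y] by linarith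
    have low: "hyperbolic_dist n x y \<le> 5546 / \<Lambda> * S x y" using lower[OF x y] \<Lambda> by (simp add: field_simps)
    moreover have "0 \<le> S x y"
    proof -
      have "0 \<le> 5546 / \<Lambda> * S x y" using low D by linarith
      then show ?thesis using \<Lambda> by (simp add: zero_le_mult_iff zero_le_divide_iff)
    qed
    then have "5546 / \<Lambda> * S x y \<le> L * S x y" using L(3) by (intro mult_right_mono) auto
    ultimately show "inverse L * hyperbolic_dist n x y \<le> S x y" using L(1) by (simp add: field_simps)
  qed
  show ?thesis unfolding bilipschitz_embedding_def
  proof (intro conjI exI[of _ L] ballI funcsetI L)
    fix x assume "x \<in> hyperbolic_space n"
    then show "embedding n x \<in> power_space (2 * (n - 1)) X"
      unfolding power_space_def embedding_def using rad by (auto intro!: cover_in height_of)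
  next
    fix x y assume xy: "x \<in> hyperbolic_space n" "y \<in> hyperbolic_space n"
    show "inverse L * hyperbolic_dist n x y \<le> l1_power_dist (2 * (n - 1)) d (embedding n x) (embedding n y)"
      "l1_power_dist (2 * (n - 1)) d (embedding n x) (embedding n y) \<le> L * hyperbolic_dist n x y"
      using bounds[OF xy] unfolding S_def by auto
  qed
qed

end

theorem corollary1p5:
  fixes n :: nat
    and V :: "'v set"
    and E :: "'v set set"
  assumes "n \<ge> 2"
    and "simplicial_tree V E"
    and "exponentially_branching V E"
  shows "\<exists>\<psi>. bilipschitz_embedding
           (hyperbolic_space n) (hyperbolic_dist n)
           (power_space (2 * (n - 1)) (geometric_realization V E))
           (l1_power_dist (2 * (n - 1)) (simplicial_dist V E)) \<psi>"
proof -
  obtain t0 \<sigma> where t0: "t0 \<in> V" "0 < \<sigma>" and branching: "\<forall>t\<in>V. infinite (graph_neighbours E t) \<or>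
      exp (\<sigma> * simplicial_dist V E (vertex_point t) (vertex_point t0)) < real (card (graph_neighbours E t))"
    using assms(3) unfolding exponentially_branching_def exponentially_branching_at_def by blast
  have "exponential_tree V E t0 \<sigma>"
    by (intro exponential_tree.intro exponential_tree_axioms.intro tree.intro)
      (rule assms(2) t0 bspec[OF branching]; assumption?)+
  \<comment> \<open>Here \<open>27 = 3 ^ 3\<close> and \<open>164 = 2 * 3 ^ 4 + 2\<close>.\<close>
  moreover have "real (cap k) \<le> 164 * 27 ^ k" for k
  proof -
    have "(3::real) ^ (3 * k + 4) = 81 * 27 ^ k" by (simp add: power_add power_mult)
    moreover have "(1::real) \<le> 27 ^ k" by (rule one_le_power) simp
    ultimately show ?thesis unfolding cap_def by simp
  qed
  ultimately obtain \<Lambda> pt where "code_space (geometric_realization V E) (simplicial_dist V E) \<Lambda> pt cap"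
    using exponential_tree.code_points[of V E t0 \<sigma> cap 164 27] by auto
  then have "coded_plane (geometric_realization V E) (simplicial_dist V E) \<Lambda> pt"
    by (rule coded_plane.intro)
  then show ?thesis using coded_plane.embedding_bilipschitz[OF _ assms(1)] by blast
qed

end
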